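(* Let $n\ge 1$ and $w\in S_n$. Then \[\mathfrak{G}_w=\sum_{\substack{\mathcal{B}\in\overline{\mathsf{BPD}}(w)\\ \check{\mathcal{B}}\text{ is reduced}}}(-1)^{\ell(\delta(\check{\mathcal{B}}))-\ell(w)}\,\mathfrak{S}_{\delta(\check{\mathcal{B}})}.\]
   Context: $S_n$ is the symmetric group, $s_i=(i\ i+1)$, $\ell$ is Coxeter length, $w_0=n\,n-1\cdots 1$. Schubert polynomials: $\mathfrak{S}_{w_0}=x_1^{n-1}x_2^{n-2}\cdots x_{n-1}$ and $\mathfrak{S}_{ws_i}=N_i(\mathfrak{S}_w)$ whenever $w(i)>w(i+1)$, where $N_i(f)=(f-s_i\cdot f)/(x_i-x_{i+1})$ and $s_i$ acts by swapping $x_i,x_{i+1}$. Grothendieck polynomials: $\mathfrak{G}_{w_0}=x_1^{n-1}\cdots x_{n-1}$ and $\mathfrak{G}_{ws_i}=N_i((1-x_{i+1})\mathfrak{G}_w)$ whenever $w(i)>w(i+1)$. (Both families are stable under the inclusion $S_n\subset S_{n+1}$, so they are indexed by permutations.) A bumpless pipe dream (BPD) of size $n$ is a tiling of the $n\times n$ grid (row $1$ on top, column $1$ on the left) by six tile types: an elbow joining the bottom and right edges of the cell; an elbow joining the top and left edges; a horizontal segment; a vertical segment; a crossing (horizontal and vertical segment); a blank tile; such that the segments connect into $n$ pipes, each entering through the bottom edge of a column and leaving through the right edge of a row (pipes travel only north and east). Label the pipes $1,\dots,n$ by their entry column; at a crossing tile the larger of the two incoming labels (from below and from the left) exits through the top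 and the smaller through the right. Define $\delta(\mathcal{B})\in S_n$ by $\delta(\mathcal{B})(r)=$ the label leaving the right edge of row $r$. A BPD is reduced if each pair of pipes crosses at most once. $\overline{\mathsf{BPD}}(w)$ is the set of BPDs of size $n$ with $\delta(\mathcal{B})=w$. A co-BPD of size $n$ is a tiling of the $n\times n$ grid by: an elbow joining top and right edges; an elbow joining bottom and left edges; a crossing; a blank tile; a horizontal segment; a vertical segment; such that the segments form $n$ pipes each entering through the top edge of a column and leaving through the right edge of a row (travelling only south and east). Label pipes $1,\dots,n$ by their entry column; at a crossing the larger of the two incoming labels (from above and from the left) exits through the bottom and the smaller through the right; $\delta$ of a co-BPD is read as the labels on the right edge from top to bottom. A co-BPD is reduced if each pair of pipes crosses at most once. For a BPD $\mathcal{B}$, $\check{\mathcal{B}}$ is the co-BPD obtained by the tile-by-tile replacement: bottom–right elbow $\mapsto$ top–right elbow; top–left elbow $\mapsto$ bottom–left elbow; horizontal $\mapsto$ crossing; vertical $\mapsto$ blank; crossing $\mapsto$ horizontal; blank $\mapsto$ vertical. *)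

theory Defs
  imports
    "HOL-Combinatorics.Permutations"
    "HOL-Library.FuncSet"
    "HOL-Library.Poly_Mapping"
begin

section \<open>Permutations\<close>

text \<open>A permutation in \<open>S\<^sub>n\<close> is a function \<open>w\<close> with \<open>w permutes {1..n}\<close>; its one-line notation is
  \<open>w 1, \<dots>, w n\<close>, and \<open>w s\<^sub>i\<close> is \<open>w \<circ> s\<^sub>i\<close>, which swaps the entries in positions \<open>i\<close> and \<open>i + 1\<close>.\<close>

definition simple_transp :: "nat \<Rightarrow> nat \<Rightarrow> nat" where
  "simple_transp i = transpose i (i + 1)"

definition longest_perm :: "nat \<Rightarrow> nat \<Rightarrow> nat" where
  "longest_perm n = (\<lambda>i. if i \<in> {1..n} then n + 1 - i else i)"

definition coxeter_length :: "nat \<Rightarrow> (nat \<Rightarrow> nat) \<Rightarrow> nat" where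
  "coxeter_length n w =
    (LEAST k. \<exists>is. length is = k \<and> set is \<subseteq> {1..<n} \<and> w = foldr (\<circ>) (map simple_transp is) id)"


section \<open>Schubert and Grothendieck polynomials\<close>

text \<open>Polynomials with integer coefficients in \<open>x\<^sub>0, x\<^sub>1, x\<^sub>2, \<dots>\<close>: a monomial is a finitely
  supported exponent function, a polynomial a finitely supported coefficient function.
  The variable \<open>x\<^sub>0\<close> is never used.\<close>

type_synonym mpoly = "(nat \<Rightarrow>\<^sub>0 nat) \<Rightarrow>\<^sub>0 int"

definition var :: "nat \<Rightarrow> mpoly" where
  "var i = Poly_Mapping.single (Poly_Mapping.single i 1) 1"

text \<open>The inner \<open>map_key\<close> exchanges the exponents of \<open>x\<^sub>i\<close> and \<open>x\<^bsub>i+1\<^esub>\<close> in a monomial.\<close>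

definition swap_vars :: "nat \<Rightarrow> mpoly \<Rightarrow> mpoly" where
  "swap_vars i f = Poly_Mapping.map_key (Poly_Mapping.map_key (simple_transp i)) f"

text \<open>The quotient is unique because \<open>mpoly\<close> is an integral domain; it exists because
  \<open>f - s\<^sub>i f\<close> vanishes at \<open>x\<^sub>i = x\<^bsub>i+1\<^esub>\<close>.\<close>

definition divided_diff :: "nat \<Rightarrow> mpoly \<Rightarrow> mpoly" where
  "divided_diff i f = (THE g. g * (var i - var (i + 1)) = f - swap_vars i f)"

definition staircase :: "nat \<Rightarrow> mpoly" where
  "staircase n = (\<Prod>i\<in>{1..<n}. var i ^ (n - i))"

text \<open>The relations collect all polynomials obtained for \<open>w\<close> along descending chains from \<open>w\<^sub>0\<close>.
  By the braid relations of the operators there is exactly one for each \<open>w\<close> in \<open>S\<^sub>n\<close>.\<close>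

inductive schubert_rel :: "nat \<Rightarrow> (nat \<Rightarrow> nat) \<Rightarrow> mpoly \<Rightarrow> bool" for n where
  longest: "schubert_rel n (longest_perm n) (staircase n)"
| descent: "\<lbrakk>schubert_rel n w f; i \<in> {1..<n}; w i > w (i + 1)\<rbrakk>
    \<Longrightarrow> schubert_rel n (w \<circ> simple_transp i) (divided_diff i f)"

definition schubert :: "nat \<Rightarrow> (nat \<Rightarrow> nat) \<Rightarrow> mpoly" where
  "schubert n w = (THE f. schubert_rel n w f)"

inductive grothendieck_rel :: "nat \<Rightarrow> (nat \<Rightarrow> nat) \<Rightarrow> mpoly \<Rightarrow> bool" for n where
  longest: "grothendieck_rel n (longest_perm n) (staircase n)"
| descent: "\<lbrakk>grothendieck_rel n w f; i \<in> {1..<n}; w i > w (i + 1)\<rbrakk>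
    \<Longrightarrow> grothendieck_rel n (w \<circ> simple_transp i) (divided_diff i ((1 - var (i + 1)) * f))"

definition grothendieck :: "nat \<Rightarrow> (nat \<Rightarrow> nat) \<Rightarrow> mpoly" where
  "grothendieck n w = (THE f. grothendieck_rel n w f)"


section \<open>Tilings\<close>

datatype edge = Top | Bottom | Left | Right

datatype tile =
    Elbow_BR | Elbow_TL | Elbow_TR | Elbow_BL | Horizontal | Vertical | Crossing | Blank

fun edges :: "tile \<Rightarrow> edge set" where
  "edges Elbow_BR = {Bottom, Right}"
| "edges Elbow_TL = {Top, Left}"
| "edges Elbow_TR = {Top, Right}"
| "edges Elbow_BL = {Bottom, Left}"
| "edges Horizontal = {Left, Right}"
| "edges Vertical = {Top, Bottom}"
| "edges Crossing = {Top, Bottom, Left, Right}"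
| "edges Blank = {}"

definition grid :: "nat \<Rightarrow> (nat \<times> nat) set" where
  "grid n = {1..n} \<times> {1..n}"

text \<open>Cells are pairs (row, column), with row 1 on top and column 1 on the left. Tilings are
  extensional functions, so that distinct tilings are distinct functions.\<close>

type_synonym tiling = "nat \<times> nat \<Rightarrow> tile"

text \<open>The segments of neighbouring cells fit together at all interior edges.\<close>

definition connected_tiling :: "nat \<Rightarrow> tiling \<Rightarrow> bool" where
  "connected_tiling n B \<longleftrightarrow>
    (\<forall>r\<in>{1..n}. \<forall>c\<in>{1..<n}. Right \<in> edges (B (r, c)) \<longleftrightarrow> Left \<in> edges (B (r, c + 1))) \<and>
    (\<forall>r\<in>{1..<n}. \<forall>c\<in>{1..n}. Bottom \<in> edges (B (r, c)) \<longleftrightarrow> Top \<in> edges (B (r + 1, c)))"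

text \<open>The boundary conditions say that the pipes enter through the bottom edges of the \<open>n\<close> columns
  (for co-BPDs: the top edges) and leave through the right edges of the \<open>n\<close> rows. Closed loops
  cannot occur, since each tile can be traversed travelling north and east only
  (for co-BPDs: south and east only).\<close>

definition bpds :: "nat \<Rightarrow> tiling set" where
  "bpds n = {B \<in> grid n \<rightarrow>\<^sub>E {Elbow_BR, Elbow_TL, Horizontal, Vertical, Crossing, Blank}.
     connected_tiling n B \<and>
     (\<forall>c\<in>{1..n}. Bottom \<in> edges (B (n, c)) \<and> Top \<notin> edges (B (1, c))) \<and>
     (\<forall>r\<in>{1..n}. Right \<in> edges (B (r, n)) \<and> Left \<notin> edges (B (r, 1)))}"

definition cobpds :: "nat \<Rightarrow> tiling set" where
  "cobpds n = {D \<in> grid n \<rightarrow>\<^sub>E {Elbow_TR, Elbow_BL, Horizontal, Vertical, Crossing, Blank}.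
     connected_tiling n D \<and>
     (\<forall>c\<in>{1..n}. Top \<in> edges (D (1, c)) \<and> Bottom \<notin> edges (D (n, c))) \<and>
     (\<forall>r\<in>{1..n}. Right \<in> edges (D (r, n)) \<and> Left \<notin> edges (D (r, 1)))}"


section \<open>Labels\<close>

text \<open>BPDs and co-BPDs are treated uniformly: \<open>T k c\<close> is the tile in column \<open>c\<close> of the \<open>k\<close>-th row met
  when travelling in the vertical direction of the pipes (upwards for BPDs, downwards for co-BPDs).
  Then \<open>v_label X T k c\<close> is the label leaving this tile vertically, for \<open>k = 0\<close> the label \<open>c\<close>
  entering column \<open>c\<close>, and \<open>h_label X T k c\<close> is the label leaving it through its right edge.
  Edges without a pipe carry the dummy label 0.
  The rule \<open>X v h\<close> gives the vertically and horizontally outgoing labels of a crossing with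
  vertically incoming label \<open>v\<close> and horizontally incoming label \<open>h\<close>.\<close>

fun v_label :: "(nat \<Rightarrow> nat \<Rightarrow> nat \<times> nat) \<Rightarrow> (nat \<Rightarrow> nat \<Rightarrow> tile) \<Rightarrow> nat \<Rightarrow> nat \<Rightarrow> nat"
and h_label :: "(nat \<Rightarrow> nat \<Rightarrow> nat \<times> nat) \<Rightarrow> (nat \<Rightarrow> nat \<Rightarrow> tile) \<Rightarrow> nat \<Rightarrow> nat \<Rightarrow> nat" where
  "v_label X T 0 c = c"
| "v_label X T (Suc k) 0 = 0"
| "v_label X T (Suc k) (Suc c) =
    (let v = v_label X T k (Suc c); h = h_label X T (Suc k) c in
     case T (Suc k) (Suc c) of
       Vertical \<Rightarrow> v
     | Elbow_TL \<Rightarrow> h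
     | Elbow_BL \<Rightarrow> h
     | Crossing \<Rightarrow> fst (X v h)
     | _ \<Rightarrow> 0)"
| "h_label X T 0 c = 0"
| "h_label X T (Suc k) 0 = 0"
| "h_label X T (Suc k) (Suc c) =
    (let v = v_label X T k (Suc c); h = h_label X T (Suc k) c in
     case T (Suc k) (Suc c) of
       Horizontal \<Rightarrow> h
     | Elbow_BR \<Rightarrow> v
     | Elbow_TR \<Rightarrow> v
     | Crossing \<Rightarrow> snd (X v h)
     | _ \<Rightarrow> 0)"

definition sort_rule :: "nat \<Rightarrow> nat \<Rightarrow> nat \<times> nat" where
  "sort_rule v h = (max v h, min v h)"

definition straight_rule :: "nat \<Rightarrow> nat \<Rightarrow> nat \<times> nat" where
  "straight_rule v h = (v, h)"

definition bpd_perm :: "nat \<Rightarrow> tiling \<Rightarrow> nat \<Rightarrow> nat" where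
  "bpd_perm n B = (\<lambda>r. if r \<in> {1..n}
     then h_label sort_rule (\<lambda>k c. B (n + 1 - k, c)) (n + 1 - r) n else r)"

definition cobpd_perm :: "nat \<Rightarrow> tiling \<Rightarrow> nat \<Rightarrow> nat" where
  "cobpd_perm n D = (\<lambda>r. if r \<in> {1..n}
     then h_label sort_rule (\<lambda>k c. D (k, c)) r n else r)"

definition bpds_of :: "nat \<Rightarrow> (nat \<Rightarrow> nat) \<Rightarrow> tiling set" where
  "bpds_of n w = {B \<in> bpds n. bpd_perm n B = w}"

text \<open>Whether two pipes cross is a matter of the pipes as curves, which pass straight through each
  crossing tile, whereas \<open>sort_rule\<close> would exchange the labels at a repeated crossing.
  Hence \<open>straight_rule\<close> is used here.\<close>

definition cobpd_crossings :: "nat \<Rightarrow> tiling \<Rightarrow> nat \<Rightarrow> nat \<Rightarrow> (nat \<times> nat) set" where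
  "cobpd_crossings n D a b = {(r, c) \<in> grid n. D (r, c) = Crossing \<and>
     {v_label straight_rule (\<lambda>k c. D (k, c)) (r - 1) c,
      h_label straight_rule (\<lambda>k c. D (k, c)) r (c - 1)} = {a, b}}"

definition reduced_cobpd :: "nat \<Rightarrow> tiling \<Rightarrow> bool" where
  "reduced_cobpd n D \<longleftrightarrow> D \<in> cobpds n \<and>
     (\<forall>a\<in>{1..n}. \<forall>b\<in>{1..n}. a \<noteq> b \<longrightarrow> card (cobpd_crossings n D a b) \<le> 1)"


section \<open>From BPDs to co-BPDs\<close>

text \<open>The values on \<open>Elbow_TR\<close> and \<open>Elbow_BL\<close> are irrelevant, as these tiles do not occur in BPDs.\<close>

fun check_tile :: "tile \<Rightarrow> tile" where
  "check_tile Elbow_BR = Elbow_TR"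
| "check_tile Elbow_TL = Elbow_BL"
| "check_tile Horizontal = Crossing"
| "check_tile Vertical = Blank"
| "check_tile Crossing = Horizontal"
| "check_tile Blank = Vertical"
| "check_tile Elbow_TR = Elbow_BR"
| "check_tile Elbow_BL = Elbow_TL"

definition check_bpd :: "nat \<Rightarrow> tiling \<Rightarrow> tiling" where
  "check_bpd n B = restrict (check_tile \<circ> B) (grid n)"

lemma Left_check_tile: "Left \<in> edges (check_tile t) \<longleftrightarrow> Left \<in> edges t"
  and Right_check_tile: "Right \<in> edges (check_tile t) \<longleftrightarrow> Right \<in> edges t"
  and Top_check_tile: "Top \<in> edges (check_tile t) \<longleftrightarrow> Top \<notin> edges t"
  and Bottom_check_tile: "Bottom \<in> edges (check_tile t) \<longleftrightarrow> Bottom \<notin> edges t"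
  by (cases t; simp)+

lemma check_bpd_in_cobpds:
  assumes "B \<in> bpds n"
  shows "check_bpd n B \<in> cobpds n"
proof -
  have eq: "check_bpd n B (r, c) = check_tile (B (r, c))" if "r \<in> {1..n}" "c \<in> {1..n}" for r c
    using that by (simp add: check_bpd_def grid_def)
  have "check_bpd n B \<in> grid n \<rightarrow>\<^sub>E {Elbow_TR, Elbow_BL, Horizontal, Vertical, Crossing, Blank}"
  proof (rule PiE_I)
    fix x assume x: "x \<in> grid n"
    then have "B x \<in> {Elbow_BR, Elbow_TL, Horizontal, Vertical, Crossing, Blank}"
      using assms by (auto simp: bpds_def)
    then show "check_bpd n B x \<in> {Elbow_TR, Elbow_BL, Horizontal, Vertical, Crossing, Blank}"
      using x by (auto simp: check_bpd_def)
  qed (simp add: check_bpd_def)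
  moreover have "connected_tiling n (check_bpd n B)"
    using assms
    by (auto simp: bpds_def connected_tiling_def eq
        Left_check_tile Right_check_tile Top_check_tile Bottom_check_tile)
  ultimately show ?thesis
    using assms
    by (auto simp: bpds_def cobpds_def eq
        Left_check_tile Right_check_tile Top_check_tile Bottom_check_tile)
qed

end

theory Submission
  imports Defs "HOL-Library.Multiset"
begin

text \<open>Insert the labels \<open>n, \<dots>, 1\<close> one after the other into a word, where inserting \<open>i\<close> may move other
  labels at the price of factors \<open>- x\<^sub>i\<close>, and passing a label \<open>\<le> k\<close> may cost a factor \<open>1 - x\<^sub>i\<close>. The total
  weight of a word, \<open>weight n X k n w\<close>, satisfies the recursion of the Schubert polynomials for \<open>k = 0\<close>
  and that of the Grothendieck polynomials for \<open>k = n\<close>, up to sign. Raising \<open>k\<close> by one is a linear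
  substitution with coefficients 0 and 1: the insertion kernels for \<open>k\<close> and \<open>k + 1\<close> are intertwined by a
  matrix whose entry at two words is 1 iff there is a row of BPD tiles with these words above and
  below. The \<open>n\<close> rows met on the way from \<open>k = n\<close> to \<open>k = 0\<close> form the tiling. In the words
  between the rows, the labels \<open>\<le> k\<close> follow the pipes of the BPD, which compute a Demazure product,
  and the labels \<open>> k\<close> follow the pipes of its co-BPD, whose crossings must all be length-increasing.\<close>

section \<open>Insertion kernels and row kernels\<close>

text \<open>The insertion of \<open>i\<close> is one line of a lattice model with parameter
  \<open>x_i\<close>. The row kernels contain no variable, so moving a row past all insertions (a
  train argument) gives an expansion whose coefficients do not involve the \<open>x_i\<close>. The
  obstacle is that for a row cut open between two columns the two orders of composition do not agree
  state by state; several auxiliary relations have to be carried along. Labels are exit rows because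
  exits separate the two families between rows \<open>k\<close> and \<open>k + 1\<close>: a BPD pipe
  there leaves in a row \<open><= k\<close>, a co-BPD pipe in a row \<open>> k\<close>, and only
  \<open>k + 1\<close> changes sides in row \<open>k + 1\<close>. BPD labels are determined from
  above and co-BPD labels from below, so a word between two rows is fixed only by the whole stack,
  and its uniqueness and existence need both directions. Exit labels also read the crossings
  backwards and invert the permutations; this is consistent because reversing a word inverts its
  Demazure product.\<close>

text \<open>A word lists the labels of the columns from right to left.\<close>

definition words :: "'a set \<Rightarrow> nat \<Rightarrow> 'a list set" where
  "words S m = {v. length v = m \<and> set v \<subseteq> S}"

lemma words_0 [simp]: "words S 0 = {[]}"
  by (auto simp: words_def)

lemma finite_words: "finite S \<Longrightarrow> finite (words S m)"
  using finite_lists_length_eq[of S m] by (simp add: words_def conj_commute)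

lemma sum_words_Suc:
  assumes "finite S"
  shows "sum f (words S (Suc m)) = (\<Sum>t\<in>S. \<Sum>v\<in>words S m. f (t # v))"
proof -
  have "words S (Suc m) = (\<lambda>(t, v). t # v) ` (S \<times> words S m)"
    by (auto simp: words_def length_Suc_conv image_iff)
  moreover have "inj_on (\<lambda>(t, v). t # v) (S \<times> words S m)"
    by (auto simp: inj_on_def)
  ultimately show ?thesis
    by (simp add: sum.reindex sum.cartesian_product case_prod_unfold)
qed

text \<open>An insertion carries one label from the end of the word to its front, starting with
  \<open>i\<close>. On meeting \<open>c\<close>, the carried label \<open>t\<close> is either put
  down behind \<open>c\<close>, which is then carried on (this factor), or it jumps over
  \<open>c\<close> if \<open>t < c\<close> (factor \<open>- x\<close>).\<close>

definition bump :: "nat \<Rightarrow> 'r::comm_ring_1 \<Rightarrow> nat \<Rightarrow> nat \<Rightarrow> 'r" where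
  "bump k x t c = (if c < t \<and> c \<le> k then 1 - x else 1)"

text \<open>\<open>insert_kernel k x i g v a\<close> is the total weight of inserting the label \<open>i\<close> into the word \<open>g\<close> such that
  the result is \<open>a # v\<close>.\<close>

fun insert_kernel :: "nat \<Rightarrow> 'r::comm_ring_1 \<Rightarrow> nat \<Rightarrow> nat list \<Rightarrow> nat list \<Rightarrow> nat \<Rightarrow> 'r" where
  "insert_kernel k x i [] [] a = (if a = i then 1 else 0)"
| "insert_kernel k x i (c # g) (t # v) a =
     (if a = c then bump k x t c * insert_kernel k x i g v t else 0)
   - (if t = c \<and> a < c then x * insert_kernel k x i g v a else 0)"
| "insert_kernel k x i _ _ a = 0"

text \<open>One tile of row \<open>k + 1\<close> with label \<open>t\<close> above and label \<open>q\<close> below. A label \<open>\<le> k\<close> above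
  (\<open>\<le> k + 1\<close> below) means that a pipe of the BPD passes there, a larger one that a pipe of the co-BPD
  does. The horizontal edge on the right of the tile is empty (\<open>None\<close>) or carries a pipe with label \<open>b\<close>
  in the BPD and label \<open>y\<close> in the co-BPD (\<open>Some (b, y)\<close>); \<open>F\<close> receives the edge on the left.
  Pipes are labelled by their exit rows.\<close>

definition row_step ::
  "nat \<Rightarrow> nat \<Rightarrow> nat \<Rightarrow> (nat \<times> nat) option \<Rightarrow> ((nat \<times> nat) option \<Rightarrow> 'r::comm_ring_1) \<Rightarrow> 'r" where
  "row_step k t q s F = (case s of
     None \<Rightarrow> (if q = t then F None else 0) + (if t \<le> k \<and> k < q then F (Some (t, q)) else 0)
   | Some (b, y) \<Rightarrow>
       if t \<le> k then (if t < b \<and> q = t then F (Some (b, y)) else 0)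
                   + (if b < t \<and> q = b then F (Some (t, y)) else 0)
       else (if t = y \<and> q = b then F None else 0)
          + (if y < t \<and> q = t then F (Some (b, y)) else 0))"

fun row_kernel :: "nat \<Rightarrow> nat list \<Rightarrow> nat list \<Rightarrow> (nat \<times> nat) option \<Rightarrow> 'r::comm_ring_1" where
  "row_kernel k [] [] s = (if s = None then 1 else 0)"
| "row_kernel k (t # v) (q # w) s = row_step k t q s (row_kernel k v w)"
| "row_kernel k _ _ s = 0"

section \<open>Insertion composed with a row, in both orders\<close>

lemma row_step_sum:
  "(\<Sum>v\<in>V. u v * row_step k t q s (F v)) = row_step k t q s (\<lambda>s. \<Sum>v\<in>V. u v * F v s)"
proof (cases s)
  case None
  then show ?thesis
    by (cases "q = t"; cases "t \<le> k"; cases "k < q") (simp_all add: row_step_def sum.distrib distrib_left)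
next
  case (Some p)
  obtain b y where "p = (b, y)" by fastforce
  with Some show ?thesis
    by (cases "t \<le> k"; cases "q = t"; cases "q = b"; cases "t = y"; cases "t < b"; cases "b < t"; cases "y < t")
       (simp_all add: row_step_def sum.distrib distrib_left)
qed

text \<open>Both composites are cut open on the right so that columns can be added one by one:
  \<open>a\<close> is the label that the insertion still carries, \<open>s\<close> the horizontal
  edge at the cut. In \<open>insert_row\<close> the insertion acts above the row, in
  \<open>row_insert\<close> below it.\<close>

definition insert_row where
  "insert_row S k x i g w a s = (\<Sum>v\<in>words S (length g). insert_kernel k x i g v a * row_kernel k v w s)"

definition row_insert where
  "row_insert S k x i g w a s = (\<Sum>u\<in>words S (length g). insert_kernel (Suc k) x i u w a * row_kernel k g u s)"

lemma insert_row_Nil: "insert_row S k x i [] [] a s = (if a = i \<and> s = None then 1 else 0)"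
  by (simp add: insert_row_def)

lemma row_insert_Nil: "row_insert S k x i [] [] a s = (if a = i \<and> s = None then 1 else 0)"
  by (simp add: row_insert_def)

lemma insert_row_Cons:
  assumes S: "finite S" "c \<in> S"
  shows "insert_row S k x i (c # g) (q # w) a s =
     (if a = c then \<Sum>t\<in>S. bump k x t c * row_step k t q s (insert_row S k x i g w t) else 0)
   - (if a < c then x * row_step k c q s (insert_row S k x i g w a) else 0)"
proof -
  have "insert_row S k x i (c # g) (q # w) a s =
    (\<Sum>t\<in>S. \<Sum>v\<in>words S (length g). insert_kernel k x i (c # g) (t # v) a * row_step k t q s (row_kernel k v w))"
    by (simp add: insert_row_def sum_words_Suc[OF S(1)])
  also have "\<dots> = (\<Sum>t\<in>S. (if a = c then bump k x t c * (\<Sum>v\<in>words S (length g). insert_kernel k x i g v t * row_step k t q s (row_kernel k v w)) else 0)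
      - (if t = c then (if a < c then x * (\<Sum>v\<in>words S (length g). insert_kernel k x i g v a * row_step k t q s (row_kernel k v w)) else 0) else 0))"
    by (intro sum.cong refl)
       (simp add: sum_distrib_left mult.assoc left_diff_distrib sum_subtractf if_distrib[of "\<lambda>z. z * _"] cong: if_cong)
  also have "\<dots> = (\<Sum>t\<in>S. (if a = c then bump k x t c * row_step k t q s (insert_row S k x i g w t) else 0)
      - (if t = c then (if a < c then x * row_step k t q s (insert_row S k x i g w a) else 0) else 0))"
    unfolding row_step_sum insert_row_def by simp
  also have "\<dots> = (if a = c then \<Sum>t\<in>S. bump k x t c * row_step k t q s (insert_row S k x i g w t) else 0)
   - (if a < c then x * row_step k c q s (insert_row S k x i g w a) else 0)"
    using S by (simp add: sum_subtractf sum.delta')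
  finally show ?thesis .
qed

lemma row_insert_Cons:
  assumes S: "finite S" "a \<in> S" "q \<in> S"
  shows "row_insert S k x i (c # g) (q # w) a s =
     bump (Suc k) x q a * row_step k c a s (row_insert S k x i g w q)
   - (if a < q then x * row_step k c q s (row_insert S k x i g w a) else 0)"
proof -
  have "row_insert S k x i (c # g) (q # w) a s =
    (\<Sum>e\<in>S. \<Sum>u\<in>words S (length g). insert_kernel (Suc k) x i (e # u) (q # w) a * row_step k c e s (row_kernel k g u))"
    by (simp add: row_insert_def sum_words_Suc[OF S(1)])
  also have "\<dots> = (\<Sum>e\<in>S. (if e = a then bump (Suc k) x q e * (\<Sum>u\<in>words S (length g). insert_kernel (Suc k) x i u w q * row_step k c e s (row_kernel k g u)) else 0)
      - (if e = q then (if a < e then x * (\<Sum>u\<in>words S (length g). insert_kernel (Suc k) x i u w a * row_step k c e s (row_kernel k g u)) else 0) else 0))"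
    by (intro sum.cong refl)
       (simp add: sum_distrib_left mult.assoc left_diff_distrib sum_subtractf if_distrib[of "\<lambda>z. z * _"] cong: if_cong)
  also have "\<dots> = (\<Sum>e\<in>S. (if e = a then bump (Suc k) x q e * row_step k c e s (row_insert S k x i g w q) else 0)
      - (if e = q then (if a < e then x * row_step k c e s (row_insert S k x i g w a) else 0) else 0))"
    unfolding row_step_sum row_insert_def by simp
  also have "\<dots> = bump (Suc k) x q a * row_step k c a s (row_insert S k x i g w q)
   - (if a < q then x * row_step k c q s (row_insert S k x i g w a) else 0)"
    using S by (simp add: sum_subtractf sum.delta')
  finally show ?thesis .
qed

text \<open>Collects the configurations in which the carried label is also the BPD label of the
  edge. They arise when a label \<open>t <= k\<close> is put down above a tile that connects it with
  the horizontal edge on its left.\<close>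

definition diag where
  "diag S k f b y = (\<Sum>t\<in>{t \<in> S. b < t \<and> t \<le> k}. f t (Some (t, y)))"

text \<open>Since \<open>t <= k\<close>, the factor is \<open>1 - x\<close> precisely for
  \<open>c < t\<close>; splitting off \<open>- x\<close> leaves a second diagonal sum that starts
  above both \<open>b\<close> and \<open>c\<close>.\<close>

lemma diag_bump:
  assumes "finite S"
  shows "(\<Sum>t\<in>{t \<in> S. b < t \<and> t \<le> k}. bump k x t c * f t (Some (t, y)))
    = diag S k f b y - x * diag S k f (max b c) y"
proof -
  have "(\<Sum>t\<in>{t \<in> S. b < t \<and> t \<le> k}. bump k x t c * f t (Some (t, y)))
    = (\<Sum>t\<in>{t \<in> S. b < t \<and> t \<le> k}. f t (Some (t, y)) - (if max b c < t then x * f t (Some (t, y)) else 0))"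
    by (intro sum.cong refl) (auto simp: bump_def algebra_simps)
  also have "\<dots> = diag S k f b y - (\<Sum>t\<in>{t \<in> S. b < t \<and> t \<le> k}. (if max b c < t then x * f t (Some (t, y)) else 0))"
    by (simp add: sum_subtractf diag_def)
  also have "(\<Sum>t\<in>{t \<in> S. b < t \<and> t \<le> k}. (if max b c < t then x * f t (Some (t, y)) else 0)) =
     (\<Sum>t\<in>{t \<in> S. max b c < t \<and> t \<le> k}. x * f t (Some (t, y)))"
    using assms by (intro sum.mono_neutral_cong_right) auto
  finally show ?thesis by (simp add: diag_def sum_distrib_left)
qed

lemma sum_bump_None:
  assumes S: "finite S" "S \<subseteq> {0<..}" "q \<in> S"
  shows "(\<Sum>t\<in>S. bump k x t c * row_step k t q None (f t)) =
    bump k x q c * f q None + (if k < q then diag S k f 0 q - x * diag S k f c q else 0)"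
proof -
  have "(\<Sum>t\<in>S. bump k x t c * row_step k t q None (f t)) =
    (\<Sum>t\<in>S. (if t = q then bump k x t c * f t None else 0)) + (\<Sum>t\<in>S. if t \<le> k \<and> k < q then bump k x t c * f t (Some (t, q)) else 0)"
    unfolding sum.distrib[symmetric] by (intro sum.cong refl) (auto simp: row_step_def algebra_simps)
  also have "(\<Sum>t\<in>S. (if t = q then bump k x t c * f t None else 0)) = bump k x q c * f q None"
    using S by (simp add: sum.delta')
  also have "(\<Sum>t\<in>S. if t \<le> k \<and> k < q then bump k x t c * f t (Some (t, q)) else 0) =
     (if k < q then (\<Sum>t\<in>{t \<in> S. 0 < t \<and> t \<le> k}. bump k x t c * f t (Some (t, q))) else 0)"
    using S by (auto intro!: sum.mono_neutral_cong_right split: if_splits)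
  finally show ?thesis using diag_bump[OF S(1), where b = 0 and y = q and f = f] by simp
qed

lemma sum_bump_Some:
  assumes S: "finite S" "S \<subseteq> {0<..}" "q \<in> S" "y \<in> S" "k < y"
  shows "(\<Sum>t\<in>S. bump k x t c * row_step k t q (Some (b, y)) (f t)) =
    (if q \<le> k \<and> q < b \<or> k < q \<and> y < q then bump k x q c * f q (Some (b, y)) else 0)
    + (if q = b then bump k x y c * f y None + diag S k f b y - x * diag S k f (max b c) y else 0)"
proof -
  have "(\<Sum>t\<in>S. bump k x t c * row_step k t q (Some (b, y)) (f t)) =
    (\<Sum>t\<in>S. (if t = q then (if q \<le> k \<and> q < b \<or> k < q \<and> y < q then bump k x t c * f t (Some (b, y)) else 0) else 0))
   + (\<Sum>t\<in>S. (if t = y then (if q = b then bump k x t c * f t None else 0) else 0)) + (\<Sum>t\<in>S. if q = b \<and> b < t \<and> t \<le> k then bump k x t c * f t (Some (t, y)) else 0)"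
    unfolding sum.distrib[symmetric] using S by (intro sum.cong refl) (auto simp: row_step_def algebra_simps)
  also have "(\<Sum>t\<in>S. if q = b \<and> b < t \<and> t \<le> k then bump k x t c * f t (Some (t, y)) else 0) =
     (if q = b then (\<Sum>t\<in>{t \<in> S. b < t \<and> t \<le> k}. bump k x t c * f t (Some (t, y))) else 0)"
    using S by (auto intro!: sum.mono_neutral_cong_right split: if_splits)
  finally show ?thesis using S diag_bump[OF S(1), where f = f] by (simp add: sum.delta')
qed

text \<open>The relations between \<open>insert_row\<close> (as \<open>f\<close>) and \<open>row_insert\<close> (as \<open>h\<close>) that are preserved when a column
  with a label in \<open>L\<close> is added. Only \<open>same\<close> and \<open>diff\<close> at \<open>b = y = k + 1\<close> are wanted in the end; the
  others close the induction.\<close>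

locale intertwine =
  fixes S :: "nat set" and k :: nat and x :: "'r::comm_ring_1" and L :: "nat set"
    and f h :: "nat \<Rightarrow> (nat \<times> nat) option \<Rightarrow> 'r"
  assumes low: "\<lbrakk>Suc k \<notin> L; a \<in> S; a \<le> k\<rbrakk> \<Longrightarrow> h a None = f a None"
    and mid: "\<lbrakk>Suc k \<notin> L; Suc k \<in> S\<rbrakk> \<Longrightarrow> h (Suc k) None = 0"
    and zero: "Suc k \<notin> L \<Longrightarrow> f (Suc k) None = 0" "Suc k \<notin> L \<Longrightarrow> f a (Some (b, Suc k)) = 0"
    and high: "\<lbrakk>Suc k \<notin> L; y \<in> S; Suc k < y\<rbrakk> \<Longrightarrow> (1 - x) * h y None = f y None + diag S k f 0 y"
    and same: "\<lbrakk>b \<le> Suc k; b \<in> S; b \<notin> L \<or> b = Suc k; y \<in> S; k < y; Suc k \<in> L \<longrightarrow> y = Suc k\<rbrakk>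
      \<Longrightarrow> h b (Some (b, y)) = f y None + diag S k f b y"
    and diff: "\<lbrakk>b \<le> Suc k; b \<in> S; b \<notin> L \<or> b = Suc k; y \<in> S; k < y; Suc k \<in> L \<longrightarrow> y = Suc k; a \<in> S; a \<noteq> b\<rbrakk>
      \<Longrightarrow> h a (Some (b, y)) = (if a < b \<or> y < a then f a (Some (b, y)) else 0)"

text \<open>Among the terms in which the carried label \<open>a\<close> jumps over \<open>c\<close>,
  the row forces \<open>a = q\<close>, unless \<open>c\<close> is a co-BPD pipe crossing
  \<open>y\<close>, which reproduces the whole diagonal sum. Terms with \<open>c\<close> in front
  contribute for \<open>a = c\<close> only.\<close>

lemma diag_step:
  assumes S: "finite S" "S \<subseteq> {0<..}" "q \<in> S" "y \<in> S" "k < y" "c \<in> S"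
    and f': "\<And>a. f' a (Some (a,y)) = (if a = c then \<Sum>t\<in>S. bump k x t c * row_step k t q (Some (a,y)) (f t) else 0)
       - (if a < c then x * row_step k c q (Some (a,y)) (f a) else 0)"
  shows "diag S k f' b y = (if b < c \<and> c \<le> k then
        (if q < c \<or> y < q then bump k x q c * f q (Some (c, y)) else 0)
        + (if q = c then bump k x y c * f y None + diag S k f c y - x * diag S k f c y else 0)
        - (if b < q \<and> q < c then x * f q (Some (c, y)) else 0) else 0)
      - (if c = y \<and> b < q \<and> q \<le> k then x * f q None else 0)
      - (if y < c \<and> q = c then x * diag S k f b y else 0)"
proof -
  have "diag S k f' b y = (\<Sum>t\<in>S. if b < t \<and> t \<le> k then f' t (Some (t, y)) else 0)"
    unfolding diag_def using S by (intro sum.mono_neutral_cong_left) auto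
  also have "\<dots> = (\<Sum>a\<in>S. if a = c then (if b < a \<and> a \<le> k then \<Sum>t\<in>S. bump k x t c * row_step k t q (Some (a,y)) (f t) else 0) else 0)
     - (\<Sum>a\<in>S. if b < a \<and> a \<le> k \<and> a < c then x * row_step k c q (Some (a,y)) (f a) else 0)"
    unfolding sum_subtractf[symmetric] by (intro sum.cong refl) (auto simp: f')
  also have "(\<Sum>a\<in>S. if a = c then (if b < a \<and> a \<le> k then \<Sum>t\<in>S. bump k x t c * row_step k t q (Some (a,y)) (f t) else 0) else 0)
     = (if b < c \<and> c \<le> k then \<Sum>t\<in>S. bump k x t c * row_step k t q (Some (c,y)) (f t) else 0)"
    using S by (simp add: sum.delta')
  also have "(\<Sum>a\<in>S. if b < a \<and> a \<le> k \<and> a < c then x * row_step k c q (Some (a,y)) (f a) else 0)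
     = (\<Sum>a\<in>S. if a = q then (if b < a \<and> a \<le> k \<and> a < c \<and> c \<le> k then x * f a (Some (c, y)) else 0) else 0)
     + (\<Sum>a\<in>S. if a = q then (if b < a \<and> a \<le> k \<and> c = y then x * f a None else 0) else 0)
     + (\<Sum>a\<in>S. if b < a \<and> a \<le> k \<and> y < c \<and> q = c then x * f a (Some (a, y)) else 0)"
    unfolding sum.distrib[symmetric] using S by (intro sum.cong refl) (auto simp: row_step_def)
  also have "(\<Sum>a\<in>S. if b < a \<and> a \<le> k \<and> y < c \<and> q = c then x * f a (Some (a, y)) else 0)
     = (if y < c \<and> q = c then x * diag S k f b y else 0)"
    unfolding diag_def sum_distrib_left using S by (auto intro!: sum.mono_neutral_cong_right split: if_splits)
  finally show ?thesis using S sum_bump_Some[OF S(1-5), where f = f and b = c and x = x and c = c] by (auto simp: sum.delta')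
qed

text \<open>A new column acts linearly on the cut-open sums, and each relation for the new ones
  reduces to old relations. Which of them enter depends on whether a BPD pipe
  (\<open>c <= k\<close>) or a co-BPD pipe (\<open>c > k\<close>) comes from above and on the order
  of the labels. Adding \<open>c = k + 1\<close> retires the relations that assume
  \<open>k + 1\<close> outside \<open>L\<close>.\<close>

lemma intertwine_step:
  fixes x :: "'r::comm_ring_1"
  assumes I: "intertwine S k x L f h" and S: "finite S" "S \<subseteq> {0<..}" "q \<in> S" "c \<in> S" "c \<notin> L"
    and f': "\<And>a s. f' a s = (if a = c then \<Sum>t\<in>S. bump k x t c * row_step k t q s (f t) else 0)
       - (if a < c then x * row_step k c q s (f a) else 0)"
    and h': "\<And>a s. a \<in> S \<Longrightarrow> h' a s = bump (Suc k) x q a * row_step k c a s (h q)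
       - (if a < q then x * row_step k c q s (h a) else 0)"
  shows "intertwine S k x (insert c L) f' h'"
proof -
  interpret intertwine S k x L f h by fact
  have fN: "f' a None = (if a = c then bump k x q c * f q None + (if k < q then diag S k f 0 q - x * diag S k f c q else 0) else 0)
     - (if a < c then x * ((if q = c then f a None else 0) + (if c \<le> k \<and> k < q then f a (Some (c, q)) else 0)) else 0)" for a
    using S unfolding f' sum_bump_None[OF S(1-3), where f = f] by (simp add: row_step_def)
  have fS: "f' a (Some (b, y)) = (if a = c then
      (if q \<le> k \<and> q < b \<or> k < q \<and> y < q then bump k x q c * f q (Some (b, y)) else 0)
    + (if q = b then bump k x y c * f y None + diag S k f b y - x * diag S k f (max b c) y else 0) else 0)
     - (if a < c then x * row_step k c q (Some (b, y)) (f a) else 0)" if "y \<in> S" "k < y" for a b y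
    unfolding f' sum_bump_Some[OF S(1-3) that, where f = f] by simp
  have hN: "h' a None = bump (Suc k) x q a * ((if a = c then h q None else 0) + (if c \<le> k \<and> k < a then h q (Some (c, a)) else 0))
     - (if a < q then x * ((if q = c then h a None else 0) + (if c \<le> k \<and> k < q then h a (Some (c, q)) else 0)) else 0)" if "a \<in> S" for a
    unfolding h'[OF that] by (simp add: row_step_def)
  have d0: "diag S k f b (Suc k) = 0" if "Suc k \<notin> L" for b
    using that zero by (simp add: diag_def)
  have dbig [simp]: "k \<le> b \<Longrightarrow> diag S k f b y = 0" for b y
    by (auto simp: diag_def intro!: sum.neutral)
  show ?thesis
  proof
    fix a assume a: "Suc k \<notin> insert c L" "a \<in> S" "a \<le> k"
    have q: "q \<le> k \<or> q = Suc k \<or> Suc k < q" by auto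
    show "h' a None = f' a None"
    proof (cases a c rule: linorder_cases)
      case less
      then show ?thesis using S low[of a] diff[of c q a] a q
        by (auto simp: fN hN bump_def)
    next
      case equal
      then show ?thesis using S low[of q] high[of q] same[of c q] a q mid zero d0
        by (auto simp: fN hN bump_def algebra_simps)
    next
      case greater
      then show ?thesis using S low[of q] diff[of c q a] a q
        by (auto simp: fN hN bump_def algebra_simps)
    qed
  next
    assume a: "Suc k \<notin> insert c L" "Suc k \<in> S"
    then show "h' (Suc k) None = 0"
      using S mid zero d0 same[of c "Suc k"] diff[of c "Suc k" q] diff[of c q "Suc k"]
      by (auto simp: hN bump_def algebra_simps)
  next
    assume a: "Suc k \<notin> insert c L"
    then show "f' (Suc k) None = 0"
      using S zero by (auto simp: fN)
  next
    fix a b assume a: "Suc k \<notin> insert c L"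
    then show "f' a (Some (b, Suc k)) = 0"
      using S zero by (auto simp: f' row_step_def intro!: sum.neutral)
  next
    fix y assume a: "Suc k \<notin> insert c L" "y \<in> S" "Suc k < y"
    have d: "diag S k f' 0 y = (if 0 < c \<and> c \<le> k then
        (if q < c \<or> y < q then bump k x q c * f q (Some (c, y)) else 0)
        + (if q = c then bump k x y c * f y None + diag S k f c y - x * diag S k f c y else 0)
        - (if 0 < q \<and> q < c then x * f q (Some (c, y)) else 0) else 0)
      - (if c = y \<and> 0 < q \<and> q \<le> k then x * f q None else 0)
      - (if y < c \<and> q = c then x * diag S k f 0 y else 0)"
      by (rule diag_step) (use S a f' in auto)
    show "(1 - x) * h' y None = f' y None + diag S k f' 0 y"
    proof (cases "c \<le> k")
      case True
      then show ?thesis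
        using S a same[of c y] diff[of c y q] diff[of c q y] low[of q] mid d0 zero
        by (cases q c rule: linorder_cases; cases q y rule: linorder_cases)
           (auto simp: hN fN d bump_def, simp_all add: algebra_simps)
    next
      case False
      then have c: "Suc k < c" using a by auto
      \<comment> \<open>\<open>high\<close> multiplied by \<open>x\<close>: the form in which it
        enters when the carried \<open>y\<close> jumps over \<open>q = c\<close>.\<close>
      have y: "(1 - x) * (x * h y None) = x * (f y None + diag S k f 0 y)"
        using high[of y] a by (metis insertCI mult.left_commute)
      have q: "q \<le> k \<or> q = Suc k \<or> Suc k < q" by auto
      show ?thesis
        using S a c low[of q] high[of q] high[of y] mid d0 zero y q
        by (cases q c rule: linorder_cases; cases c y rule: linorder_cases; cases q y rule: linorder_cases)
           (auto simp: hN fN d bump_def, simp_all add: algebra_simps)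
    qed
  next
    fix b y assume a: "b \<le> Suc k" "b \<in> S" "b \<notin> insert c L \<or> b = Suc k" "y \<in> S" "k < y" "Suc k \<in> insert c L \<longrightarrow> y = Suc k"
    have d: "diag S k f' b y = (if b < c \<and> c \<le> k then
        (if q < c \<or> y < q then bump k x q c * f q (Some (c, y)) else 0)
        + (if q = c then bump k x y c * f y None + diag S k f c y - x * diag S k f c y else 0)
        - (if b < q \<and> q < c then x * f q (Some (c, y)) else 0) else 0)
      - (if c = y \<and> b < q \<and> q \<le> k then x * f q None else 0)
      - (if y < c \<and> q = c then x * diag S k f b y else 0)"
      by (rule diag_step) (use S a f' in auto)
    show "h' b (Some (b, y)) = f' y None + diag S k f' b y"
    proof (cases "c \<le> k")
      case True
      have bc: "b \<noteq> c" using a True S by auto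
      consider "c < b" | "b < c" "q = c" | "b < c" "q \<noteq> c" using bc by linarith
      then show ?thesis
      proof cases
        case 1
        then show ?thesis using S a True diff[of b y q] by (auto simp: h' row_step_def fN d)
      next
        case 2
        then show ?thesis using S a True same[of c y]
          by (auto simp: h' row_step_def fN d bump_def, simp_all add: algebra_simps)
      next
        case 3
        then show ?thesis using S a True diff[of c y q] diff[of c y b]
          by (auto simp: h' row_step_def fN d bump_def, simp_all add: algebra_simps)
      qed
    next
      case False
      show ?thesis
      proof (cases c y rule: linorder_cases)
        case less
        then show ?thesis using S a False by (auto simp: h' row_step_def fN d)
      next
        case equal
        then have L: "Suc k \<notin> L" using a S by auto
        consider "q < b" | "q = b" "b \<le> k" | "q = b" "b = Suc k" | "b < q" "q \<le> k" | "q = Suc k" "b \<le> k" | "b < q" "Suc k < q"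
          using a by linarith
        then show ?thesis
        proof cases
          case 1
          then show ?thesis using S a False equal L low[of q] by (auto simp: h' row_step_def fN d bump_def)
        next
          case 2
          then show ?thesis using S a False equal L low[of q] by (auto simp: h' row_step_def fN d bump_def)
        next
          case 3
          have "diag S k f' (Suc k) y = 0"
            by (auto simp: diag_def intro!: sum.neutral)
          with 3 show ?thesis using S a False equal L mid zero d0 by (auto simp: h' row_step_def fN d bump_def)
        next
          case 4
          then show ?thesis using S a False equal L low[of q] by (simp add: h' row_step_def fN d bump_def algebra_simps)
        next
          case 5
          then show ?thesis using S a False equal L mid zero d0 by (simp add: h' row_step_def fN d bump_def)
        next
          case 6
          then show ?thesis using S a False equal L high[of q] by (simp add: h' row_step_def fN d bump_def)
        qed
      next
        case greater
        then show ?thesis using S a False same[of b y]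
          by (auto simp: h' row_step_def fN d) (simp_all add: algebra_simps)
      qed
    qed
  next
    fix b y a assume a: "b \<le> Suc k" "b \<in> S" "b \<notin> insert c L \<or> b = Suc k" "y \<in> S" "k < y" "Suc k \<in> insert c L \<longrightarrow> y = Suc k"
      "a \<in> S" "a \<noteq> b"
    show "h' a (Some (b, y)) = (if a < b \<or> y < a then f' a (Some (b, y)) else 0)"
    proof (cases "c \<le> k")
      case True
      have bc: "b \<noteq> c" using a True S by auto
      consider "b < c" | "c < b" "a = c" "q = b" | "c < b" "a = c" "q \<noteq> b" | "c < b" "a \<noteq> c"
        using bc by linarith
      then show ?thesis
      proof cases
        case 1
        then show ?thesis using S a True diff[of c y a] by (auto simp: h' row_step_def fS)
      next
        case 2
        then show ?thesis using S a True same[of b y] by (auto simp: h' row_step_def fS bump_def, simp_all add: algebra_simps)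
      next
        case 3
        then show ?thesis using S a True diff[of b y q] by (auto simp: h' row_step_def fS bump_def)
      next
        case 4
        then show ?thesis using S a True diff[of b y a] by (auto simp: h' row_step_def fS)
      qed
    next
      case False
      consider "c < y" | "c = y" | "y < c" "a = c" "q = b" | "y < c" "a = c" "q \<noteq> b" | "y < c" "a \<noteq> c" by linarith
      then show ?thesis
      proof cases
        case 1
        then show ?thesis using S a False by (auto simp: h' row_step_def fS)
      next
        case 2
        have "Suc k \<notin> L" using 2 a S by auto
        then show ?thesis using 2 S a False low[of a] mid zero by (auto simp: h' row_step_def fS)
      next
        case 3
        then show ?thesis using S a False same[of b y] by (auto simp: h' row_step_def fS bump_def)
      next
        case 4
        then show ?thesis using S a False diff[of b y q] by (auto simp: h' row_step_def fS bump_def)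
      next
        case 5
        then show ?thesis using S a False diff[of b y a] by (auto simp: h' row_step_def fS)
      qed
    qed
  qed
qed

text \<open>The induction starts at the leftmost column, the end of the lists, with only
  \<open>i\<close> seen so far; \<open>i <= k\<close> keeps \<open>k + 1\<close> outside
  \<open>L\<close> there.\<close>

lemma intertwine_insert_row:
  assumes S: "finite S" "S \<subseteq> {0<..}" and g: "distinct g" "set g \<subseteq> S" "i \<notin> set g" "i \<le> k"
    and w: "length w = length g" "set w \<subseteq> S"
  shows "intertwine S k x (insert i (set g)) (insert_row S k x i g w) (row_insert S k x i g w)"
  using w(1) g w(2)
proof (induction w g rule: list_induct2)
  case Nil
  then show ?case
    by unfold_locales (auto simp: insert_row_Nil row_insert_Nil diag_def)
next
  case (Cons q w c g)
  have "intertwine S k x (insert c (insert i (set g))) (insert_row S k x i (c # g) (q # w)) (row_insert S k x i (c # g) (q # w))"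
    by (rule intertwine_step[where L = "insert i (set g)" and f = "insert_row S k x i g w" and h = "row_insert S k x i g w" and q = q and c = c])
       (use Cons S in \<open>simp_all add: insert_row_Cons row_insert_Cons\<close>)
  then show ?case
    by (simp add: insert_commute)
qed

section \<open>Weights of words and the passage from \<open>k\<close> to
  \<open>k + 1\<close>\<close>

definition insertion :: "nat \<Rightarrow> 'r::comm_ring_1 \<Rightarrow> nat \<Rightarrow> nat list \<Rightarrow> nat list \<Rightarrow> 'r" where
  "insertion k x i g v = insert_kernel k x i g (tl v) (hd v)"

abbreviation full_row :: "nat \<Rightarrow> nat list \<Rightarrow> nat list \<Rightarrow> 'r::comm_ring_1" where
  "full_row k v w \<equiv> row_kernel k v w (Some (Suc k, Suc k))"

text \<open>The cut is closed at the rightmost column, where the edge carries \<open>k + 1\<close>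
  in both tilings. No label exceeds \<open>k + 1\<close> and is at most \<open>k\<close>, so the
  diagonal sum in \<open>same\<close> vanishes and the two orders agree.\<close>

lemma insertion_full_row:
  fixes x :: "'r::comm_ring_1"
  assumes S: "finite S" "S \<subseteq> {0<..}" and g: "distinct g" "set g \<subseteq> S" "i \<notin> set g" "i \<le> k" "Suc k \<in> insert i (set g)"
    and w: "length w = Suc (length g)" "set w \<subseteq> S"
  shows "(\<Sum>v\<in>words S (Suc (length g)). insertion k x i g v * full_row k v w)
       = (\<Sum>u\<in>words S (length g). full_row k g u * insertion (Suc k) x i u w)"
proof -
  obtain q w' where w': "w = q # w'" "length w' = length g" "q \<in> S" "set w' \<subseteq> S"
    using w by (cases w) auto
  interpret intertwine S k x "insert i (set g)" "insert_row S k x i g w'" "row_insert S k x i g w'"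
    by (rule intertwine_insert_row) (use S g w' in auto)
  have "(\<Sum>v\<in>words S (Suc (length g)). insertion k x i g v * full_row k v w)
     = (\<Sum>t\<in>S. row_step k t q (Some (Suc k, Suc k)) (insert_row S k x i g w' t))"
    unfolding sum_words_Suc[OF S(1)] w'(1) row_kernel.simps insertion_def row_step_sum insert_row_def by simp
  \<comment> \<open>With \<open>b = y = k + 1\<close>, labels \<open>t <= k\<close> lie below
    \<open>b\<close> and all others are at least \<open>y\<close>, so every admissible tile has
    \<open>t = q\<close>.\<close>
  also have "\<dots> = (\<Sum>t\<in>S. if t = q then (if q = Suc k then insert_row S k x i g w' (Suc k) None else insert_row S k x i g w' q (Some (Suc k, Suc k))) else 0)"
    by (intro sum.cong refl) (auto simp: row_step_def)
  also have "\<dots> = (if q = Suc k then insert_row S k x i g w' (Suc k) None else insert_row S k x i g w' q (Some (Suc k, Suc k)))"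
    using w' S by simp
  also have "\<dots> = row_insert S k x i g w' q (Some (Suc k, Suc k))"
  proof -
    have "Suc k \<in> S" using g by auto
    moreover have "diag S k (insert_row S k x i g w') (Suc k) (Suc k) = 0"
      by (auto simp: diag_def intro!: sum.neutral)
    ultimately show ?thesis
      using same[of "Suc k" "Suc k"] diff[of "Suc k" "Suc k" q] w' by auto
  qed
  also have "\<dots> = (\<Sum>u\<in>words S (length g). full_row k g u * insertion (Suc k) x i u w)"
    by (simp add: row_insert_def w'(1) insertion_def mult.commute)
  finally show ?thesis .
qed

lemma mset_insert_kernel:
  "insert_kernel k x i g v a \<noteq> 0 \<Longrightarrow> add_mset a (mset v) = add_mset i (mset g)"
  by (induction k x i g v a rule: insert_kernel.induct) (auto split: if_splits dest!: mult_not_zero)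

lemma mset_insertion:
  assumes "insertion k x i g v \<noteq> 0" "v \<noteq> []"
  shows "mset v = add_mset i (mset g)"
  using mset_insert_kernel[of k x i g "tl v" "hd v"] assms by (cases v) (auto simp: insertion_def)

primrec weight :: "nat \<Rightarrow> (nat \<Rightarrow> 'r::comm_ring_1) \<Rightarrow> nat \<Rightarrow> nat \<Rightarrow> nat list \<Rightarrow> 'r" where
  "weight n X k 0 w = (if w = [] then 1 else 0)"
| "weight n X k (Suc m) w =
     (\<Sum>g\<in>words {1..n} m. insertion k (X (n - m)) (n - m) g w * weight n X k m g)"

abbreviation labels :: "nat \<Rightarrow> nat \<Rightarrow> nat set" where
  "labels n m \<equiv> {n - m<..n}"

definition arrangements :: "'a set \<Rightarrow> 'a list set" where
  "arrangements A = {w. distinct w \<and> set w = A}"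

lemma arrangements_iff_mset:
  assumes "finite A"
  shows "w \<in> arrangements A \<longleftrightarrow> mset w = mset_set A"
proof
  assume w: "mset w = mset_set A"
  have "set w = A"
    using arg_cong[OF w, of set_mset] assms by simp
  moreover have "distinct w"
    unfolding distinct_count_atmost_1 w using assms \<open>set w = A\<close> by (simp add: count_mset_set')
  ultimately show "w \<in> arrangements A"
    by (simp add: arrangements_def)
qed (auto simp: arrangements_def mset_set_set)

lemma labels_Suc: "m < n \<Longrightarrow> labels n (Suc m) = insert (n - m) (labels n m)"
  by auto

lemma weight_support:
  assumes "weight n X k m w \<noteq> 0" "length w = m" "m \<le> n"
  shows "w \<in> arrangements (labels n m)"
  using assms
proof (induction m arbitrary: w)
  case 0
  then show ?case by (auto simp: arrangements_def)
next
  case (Suc m)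
  then obtain g where g: "g \<in> words {1..n} m" "insertion k (X (n - m)) (n - m) g w \<noteq> 0" "weight n X k m g \<noteq> 0"
    by (auto elim!: sum.not_neutral_contains_not_neutral dest!: mult_not_zero)
  then have "g \<in> arrangements (labels n m)"
    using Suc by (auto simp: words_def)
  moreover have "mset w = add_mset (n - m) (mset g)"
    using mset_insertion[OF g(2)] Suc.prems by (cases w) auto
  ultimately show ?case
    using Suc.prems labels_Suc[of m n]
    by (simp add: arrangements_iff_mset)
qed

lemma insertion_arrangements:
  assumes "insertion k x (n - m) g w \<noteq> 0" "w \<in> arrangements (labels n (Suc m))" "m < n"
  shows "g \<in> arrangements (labels n m)"
  using mset_insertion[OF assms(1)] assms(2,3) labels_Suc[of m n]
  by (cases w) (auto simp: arrangements_iff_mset)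

lemma arrangements_length: "w \<in> arrangements A \<Longrightarrow> length w = card A"
  by (auto simp: arrangements_def distinct_card)

lemma insert_kernel_cong:
  "\<forall>c\<in>set g. Suc k < c \<Longrightarrow> insert_kernel (Suc k) x i g v a = insert_kernel k x i g v a"
  by (induction k x i g v a rule: insert_kernel.induct) (auto simp: bump_def)

text \<open>The parameter \<open>k\<close> is felt only by labels that are met during a later
  insertion. These exceed \<open>n - m + 1\<close>, hence \<open>k + 1\<close>, so no factor
  \<open>1 - x\<close> distinguishes the two values.\<close>

lemma weight_Suc_eq:
  assumes "w \<in> arrangements (labels n m)" "k \<le> n - m" "m \<le> n"
  shows "weight n X (Suc k) m w = weight n X k m w"
  using assms
proof (induction m arbitrary: w)
  case (Suc m)
  have "insertion (Suc k) (X (n - m)) (n - m) g w * weight n X (Suc k) m g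
      = insertion k (X (n - m)) (n - m) g w * weight n X k m g" if g: "g \<in> words {1..n} m" for g
  proof (cases "g \<in> arrangements (labels n m)")
    case True
    then have "\<forall>c\<in>set g. Suc k < c"
      using Suc.prems by (auto simp: arrangements_def)
    then show ?thesis
      using Suc.IH[OF True] Suc.prems by (simp add: insertion_def insert_kernel_cong)
  next
    case False
    then show ?thesis
      using insertion_arrangements[of k _ n m g w] insertion_arrangements[of "Suc k" _ n m g w] Suc.prems
      by (metis Suc_le_eq mult_zero_left)
  qed
  then show ?case by simp
qed simp

text \<open>Without BPD pipes from above every label keeps its column: the horizontal strand runs
  left across larger labels and ends at the column of \<open>k + 1\<close>.\<close>

lemma row_kernel_high:
  assumes "\<forall>c\<in>set v. k < c" "length v = length w"
  shows "row_kernel k v w None = (if v = w then 1 else (0::'r::comm_ring_1))"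
    "distinct v \<Longrightarrow> full_row k v w = (if v = w \<and> Suc k \<in> set v then 1 else (0::'r))"
  using assms(2,1) by (induction v w rule: list_induct2) (auto simp: row_step_def)

text \<open>The row is moved past the latest insertion by \<open>insertion_full_row\<close>, one
  label at a time. This ends at \<open>k = n - m\<close>, when \<open>k + 1\<close> is the latest
  label: there both values of \<open>k\<close> give the same weight and the row acts as the
  identity.\<close>

lemma weight_Suc:
  fixes X :: "nat \<Rightarrow> 'r::comm_ring_1"
  assumes "w \<in> arrangements (labels n m)" "n - m \<le> k" "k < n" "m \<le> n"
  shows "weight n X (Suc k) m w = (\<Sum>v\<in>words {1..n} m. full_row k v w * weight n X k m v)"
  using assms
proof (induction m arbitrary: w)
  case (Suc m)
  define x where "x = X (n - m)"
  let ?W = "words {1..n} m"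
  have w: "length w = Suc m" "set w \<subseteq> {1..n}" "w \<in> words {1..n} (Suc m)"
    using Suc.prems arrangements_length[of w] by (auto simp: arrangements_def words_def)
  show ?case
  proof (cases "n - m \<le> k")
    case True
    have eq: "weight n X (Suc k) m u = (\<Sum>g\<in>?W. full_row k g u * weight n X k m g)"
      if "insertion (Suc k) x (n - m) u w \<noteq> 0" for u
      using insertion_arrangements[OF that] Suc True by simp
    have ex: "(\<Sum>u\<in>?W. full_row k g u * insertion (Suc k) x (n - m) u w) =
        (\<Sum>v\<in>words {1..n} (Suc m). insertion k x (n - m) g v * full_row k v w)"
      if g: "g \<in> ?W" "weight n X k m g \<noteq> 0" for g
    proof -
      have "g \<in> arrangements (labels n m)" "length g = m"
        using weight_support[OF g(2)] g(1) Suc.prems by (auto simp: words_def)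
      then show ?thesis
        using insertion_full_row[of "{1..n}" g "n - m" k w x, OF finite_atLeastAtMost] w Suc.prems True
        by (auto simp: arrangements_def subset_iff)
    qed
    have "weight n X (Suc k) (Suc m) w = (\<Sum>u\<in>?W. insertion (Suc k) x (n - m) u w * (\<Sum>g\<in>?W. full_row k g u * weight n X k m g))"
    proof -
      have "insertion (Suc k) x (n - m) u w * weight n X (Suc k) m u =
          insertion (Suc k) x (n - m) u w * (\<Sum>g\<in>?W. full_row k g u * weight n X k m g)" for u
        by (cases "insertion (Suc k) x (n - m) u w = 0") (simp_all add: eq)
      then show ?thesis
        by (simp add: x_def)
    qed
    also have "\<dots> = (\<Sum>u\<in>?W. \<Sum>g\<in>?W. weight n X k m g * (full_row k g u * insertion (Suc k) x (n - m) u w))"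
      by (simp add: sum_distrib_left mult_ac)
    also have "\<dots> = (\<Sum>g\<in>?W. weight n X k m g * (\<Sum>u\<in>?W. full_row k g u * insertion (Suc k) x (n - m) u w))"
      by (subst sum.swap) (simp add: sum_distrib_left)
    also have "\<dots> = (\<Sum>g\<in>?W. weight n X k m g * (\<Sum>v\<in>words {1..n} (Suc m). insertion k x (n - m) g v * full_row k v w))"
    proof (intro sum.cong refl)
      fix g assume "g \<in> ?W"
      then show "weight n X k m g * (\<Sum>u\<in>?W. full_row k g u * insertion (Suc k) x (n - m) u w) =
          weight n X k m g * (\<Sum>v\<in>words {1..n} (Suc m). insertion k x (n - m) g v * full_row k v w)"
        by (cases "weight n X k m g = 0") (simp_all only: ex mult_zero_left not_False_eq_True)
    qed
    also have "\<dots> = (\<Sum>g\<in>?W. \<Sum>v\<in>words {1..n} (Suc m). full_row k v w * (insertion k x (n - m) g v * weight n X k m g))"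
      by (simp add: sum_distrib_left mult_ac)
    also have "\<dots> = (\<Sum>v\<in>words {1..n} (Suc m). full_row k v w * (\<Sum>g\<in>?W. insertion k x (n - m) g v * weight n X k m g))"
      by (subst sum.swap) (simp add: sum_distrib_left)
    finally show ?thesis by (simp add: x_def)
  next
    case False
    then have k: "k = n - Suc m" using Suc.prems by auto
    have "(\<Sum>v\<in>words {1..n} (Suc m). full_row k v w * weight n X k (Suc m) v)
       = (\<Sum>v\<in>words {1..n} (Suc m). if v = w then weight n X k (Suc m) v else 0)"
    proof (intro sum.cong refl)
      fix v assume v: "v \<in> words {1..n} (Suc m)"
      show "full_row k v w * weight n X k (Suc m) v = (if v = w then weight n X k (Suc m) v else 0)"
      proof (cases "weight n X k (Suc m) v = 0")
        case False
        then have "v \<in> arrangements (labels n (Suc m))"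
          using weight_support[OF False] v Suc.prems by (auto simp: words_def)
        then have "full_row k v w = (if v = w then 1 else (0::'r))"
          using row_kernel_high(2)[of v k w, where 'r = 'r] w v k Suc.prems by (auto simp: words_def arrangements_def)
        then show ?thesis by simp
      qed auto
    qed
    also have "\<dots> = weight n X k (Suc m) w"
      using w finite_words[of "{1..n}" "Suc m"] by simp
    finally show ?thesis
      using weight_Suc_eq[of w n "Suc m" k X] Suc.prems k by simp
  qed
qed simp

section \<open>Exchanging two adjacent labels\<close>

text \<open>Insertion of \<open>i + 1\<close> with parameter \<open>y\<close>, then of
  \<open>i\<close> with parameter \<open>x\<close>, both cut open on the right: \<open>b\<close> is
  carried by the first, \<open>a\<close> by the second.\<close>

definition pair_kernel where
  "pair_kernel S k x y i h w a b =
     (\<Sum>g\<in>words S (length h). insert_kernel k x i g w a * insert_kernel k y (Suc i) h g b)"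

lemma pair_kernel_Cons:
  assumes S: "finite S" "p \<in> S" "a \<in> S"
  shows "pair_kernel S k x y i (c # h) (p # w) a b =
      (if b = c then bump k x p a * bump k y a c * pair_kernel S k x y i h w p a
         - (if a < p then x * bump k y p c * pair_kernel S k x y i h w a p else 0) else 0)
      - (if a = c \<and> b < c then y * bump k x p c * pair_kernel S k x y i h w p b else 0)
      + (if p = c \<and> a < c \<and> b < c then x * y * pair_kernel S k x y i h w a b else 0)"
proof -
  let ?I = "insert_kernel k x i" and ?J = "insert_kernel k y (Suc i)" and ?W = "words S (length h)"
  have J: "(\<Sum>g\<in>?W. u g * ?J (c # h) (e # g) b) =
     (if b = c then bump k y e c * (\<Sum>g\<in>?W. u g * ?J h g e) else 0)
   - (if e = c \<and> b < c then y * (\<Sum>g\<in>?W. u g * ?J h g b) else 0)" for u e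
    by (cases "b = c"; cases "e = c \<and> b < c") (auto simp: sum_distrib_left mult_ac right_diff_distrib sum_subtractf sum_negf)
  have "pair_kernel S k x y i (c # h) (p # w) a b =
     (\<Sum>e\<in>S. \<Sum>g\<in>?W. ?I (e # g) (p # w) a * ?J (c # h) (e # g) b)"
    by (simp add: pair_kernel_def sum_words_Suc[OF S(1)])
  also have "\<dots> = (\<Sum>e\<in>S. (if e = a then bump k x p a * (\<Sum>g\<in>?W. ?I g w p * ?J (c # h) (e # g) b) else 0)
       - (if e = p then (if a < p then x * (\<Sum>g\<in>?W. ?I g w a * ?J (c # h) (e # g) b) else 0) else 0))"
    by (intro sum.cong refl)
       (simp add: sum_distrib_left mult.assoc left_diff_distrib sum_subtractf if_distrib[of "\<lambda>z. z * _"] cong: if_cong)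
  also have "\<dots> = bump k x p a * (\<Sum>g\<in>?W. ?I g w p * ?J (c # h) (a # g) b)
       - (if a < p then x * (\<Sum>g\<in>?W. ?I g w a * ?J (c # h) (p # g) b) else 0)"
    using S by (simp add: sum_subtractf sum.delta' del: insert_kernel.simps)
  finally show ?thesis
    unfolding J pair_kernel_def[symmetric] by (auto simp: algebra_simps)
qed

lemma pair_kernel_Nil: "pair_kernel S k x y i [] [] a b = (if a = i \<and> b = Suc i then 1 else 0)"
  by (simp add: pair_kernel_def)

lemma pair_kernel_second:
  assumes "i \<notin> set h" shows "pair_kernel S k x y i h w a i = 0"
proof -
  have "insert_kernel k y (Suc i) h g i = 0" for g
    using mset_insert_kernel[of k y "Suc i" h g i] assms
    by (metis add_mset_eq_singleton_iff in_multiset_in_set insert_iff n_not_Suc_n set_mset_add_mset_insert)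
  then show ?thesis by (simp add: pair_kernel_def)
qed

text \<open>Closes the cut: the second insertion meets the label that the first one left in front,
  which gives the coefficient of \<open>r # q # w\<close>. The recursion of
  \<open>pair_kernel\<close> is not symmetric in \<open>x\<close> and \<open>y\<close>; that of
  these closed coefficients is.\<close>

definition last_two :: "'r::comm_ring_1 \<Rightarrow> 'r \<Rightarrow> (nat \<Rightarrow> nat \<Rightarrow> 'r) \<Rightarrow> nat \<Rightarrow> nat \<Rightarrow> 'r" where
  "last_two b x P q r = (if q < r then P q r else (1 - b * x) * P q r - x * P r q)"

fun inverted :: "nat \<Rightarrow> nat list \<Rightarrow> bool" where
  "inverted i [] = False"
| "inverted i (a # w) = (a = i \<or> a \<noteq> Suc i \<and> inverted i w)"

abbreviation swap_labels :: "nat \<Rightarrow> nat list \<Rightarrow> nat list" where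
  "swap_labels i \<equiv> map (transpose i (Suc i))"

text \<open>The divided difference recursion, with denominators cleared: \<open>b = 0\<close> gives the operators of the Schubert
  polynomials and \<open>b = 1\<close> those of the Grothendieck polynomials, up to a sign that \<open>signed_weight\<close>
  absorbs into \<open>sign w\<close>.\<close>

definition exchange_rel where
  "exchange_rel b x y i w Kxy Kyx Ks \<longleftrightarrow>
     (if inverted i w then (1 - b * y) * Kxy - (1 - b * x) * Kyx = (y - x) * Ks else Kxy = Kyx)"

text \<open>Common form of \<open>bump\<close> on the labels \<open>1..n\<close> for
  \<open>k = 0\<close> (with \<open>b = 0\<close>) and for \<open>k >= n\<close> (with
  \<open>b = 1\<close>).\<close>

definition uniform_bump :: "'r::comm_ring_1 \<Rightarrow> 'r \<Rightarrow> nat \<Rightarrow> nat \<Rightarrow> 'r" where "uniform_bump b x t c = (if c < t then 1 - b * x else 1)"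

lemma uniform_bump_simps: "c < t \<Longrightarrow> uniform_bump b x t c = 1 - b * x" "\<not> c < t \<Longrightarrow> uniform_bump b x t c = 1"
  by (simp_all add: uniform_bump_def)

text \<open>The coefficients in \<open>pair_word_step\<close> below. All four are symmetric in \<open>x\<close> and \<open>y\<close>, so that each column
  with a larger label preserves the exchange relation.\<close>

definition sym1 :: "'r::comm_ring_1 \<Rightarrow> 'r \<Rightarrow> 'r \<Rightarrow> nat \<Rightarrow> nat \<Rightarrow> nat \<Rightarrow> 'r" where
  "sym1 b x y p d c = (if c < d then 1 - b * (x + y - b * x * y) else 1)"
definition sym2 :: "'r::comm_ring_1 \<Rightarrow> 'r \<Rightarrow> 'r \<Rightarrow> nat \<Rightarrow> nat \<Rightarrow> nat \<Rightarrow> 'r" where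
  "sym2 b x y p d c = (if d < c \<and> c < p then b * x * y else 0)"
definition sym3 :: "'r::comm_ring_1 \<Rightarrow> 'r \<Rightarrow> 'r \<Rightarrow> nat \<Rightarrow> nat \<Rightarrow> nat \<Rightarrow> 'r" where
  "sym3 b x y p d c = (if c < d then 0 else if d < p \<and> p < c then - (x + y) else - (x + y - b * x * y))"
definition sym4 :: "'r::comm_ring_1 \<Rightarrow> 'r \<Rightarrow> 'r \<Rightarrow> nat \<Rightarrow> nat \<Rightarrow> nat \<Rightarrow> 'r" where
  "sym4 b x y p d c = (if d < c \<and> d < p then - (x * y) else 0)"

lemmas sym_defs = sym1_def sym2_def sym3_def sym4_def

lemma sym_commute:
  "sym1 b y x p d c = sym1 b x y p d c" "sym2 b y x p d c = sym2 b x y p d c"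
  "sym3 b y x p d c = sym3 b x y p d c" "sym4 b y x p d c = sym4 b x y p d c"
  by (auto simp: sym_defs algebra_simps)

lemma exchange_rel_linear:
  fixes b :: "'r::comm_ring_1"
  assumes "exchange_rel b x y i w K1 K2 K3" "exchange_rel b x y i w L1 L2 L3"
  shows "exchange_rel b x y i w (u * K1 + v * L1) (u * K2 + v * L2) (u * K3 + v * L3)"
proof (cases "inverted i w")
  case True
  have "(1 - b * y) * (u * K1 + v * L1) - (1 - b * x) * (u * K2 + v * L2)
      = u * ((1 - b * y) * K1 - (1 - b * x) * K2) + v * ((1 - b * y) * L1 - (1 - b * x) * L2)"
    by (simp add: algebra_simps)
  also have "\<dots> = u * ((y - x) * K3) + v * ((y - x) * L3)"
    using assms True by (simp add: exchange_rel_def)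
  also have "\<dots> = (y - x) * (u * K3 + v * L3)"
    by (simp add: algebra_simps)
  finally show ?thesis using True by (simp add: exchange_rel_def)
qed (use assms in \<open>simp add: exchange_rel_def\<close>)

lemma transpose_Suc_fixed: "c \<noteq> j \<Longrightarrow> c \<noteq> Suc j \<Longrightarrow> transpose j (Suc j) c = c"
  by (simp add: transpose_def)

lemma transpose_Suc_outside_iff:
  assumes "c \<noteq> j" "c \<noteq> Suc j"
  shows "transpose j (Suc j) t < c \<longleftrightarrow> t < c" "c < transpose j (Suc j) t \<longleftrightarrow> c < t"
    "transpose j (Suc j) t = c \<longleftrightarrow> t = c"
  using assms by (auto simp: transpose_def)

lemma transpose_Suc_less_iff:
  "{a, b} \<noteq> {j, Suc j} \<Longrightarrow> transpose j (Suc j) a < transpose j (Suc j) b \<longleftrightarrow> a < b"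
  by (auto simp: transpose_def)

definition pair_word where
  "pair_word S k i b x y h w q r = last_two b x (pair_kernel S k x y i h w) q r"

context
  fixes S :: "nat set" and k i :: nat and b :: "'r::comm_ring_1"
  assumes S: "finite S" "i \<in> S" "Suc i \<in> S"
    and bump_eq: "\<And>z t c. c \<in> S \<Longrightarrow> bump k z t c = uniform_bump b z t c"
begin

abbreviation "KK \<equiv> pair_word S k i b"

text \<open>A direct expansion in each of the six orders of \<open>c\<close>, \<open>d\<close>,
  \<open>p\<close>. The recurring expression \<open>x + y - b * x * y\<close> is the sum of the
  multiplicative formal group law:
  \<open>1 - b * (x + y - b * x * y) = (1 - b * x) * (1 - b * y)\<close>.\<close>

lemma pair_word_step:
  assumes "c \<in> S" "d \<in> S" "p \<in> S" "c \<noteq> p" "c \<noteq> d" "p \<noteq> d"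
  shows "KK x y (c # h) (p # w) d c = sym1 b x y p d c * KK x y h w p d + sym2 b x y p d c * KK x y h w d p"
    and "KK x y (c # h) (p # w) c d = sym3 b x y p d c * KK x y h w p d + sym4 b x y p d c * KK x y h w d p"
proof -
  let ?P = "pair_kernel S k x y i h w" and ?P' = "pair_kernel S k x y i (c # h) (p # w)"
  have P': "?P' d c = uniform_bump b x p d * uniform_bump b y d c * ?P p d - (if d < p then x * uniform_bump b y p c * ?P d p else 0)"
      "?P' c d = - (if d < c then y * uniform_bump b x p c * ?P p d else 0)"
    using assms S by (simp_all add: pair_kernel_Cons bump_eq)
  consider "p < d" "d < c" | "p < c" "c < d" | "c < p" "p < d" | "d < p" "p < c" | "d < c" "c < p" | "c < d" "d < p"
    using assms by (metis nat_neq_iff)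
  then have "KK x y (c # h) (p # w) d c = sym1 b x y p d c * KK x y h w p d + sym2 b x y p d c * KK x y h w d p
    \<and> KK x y (c # h) (p # w) c d = sym3 b x y p d c * KK x y h w p d + sym4 b x y p d c * KK x y h w d p"
    unfolding pair_word_def last_two_def P' by cases (simp_all add: uniform_bump_simps sym_defs algebra_simps)
  then show "KK x y (c # h) (p # w) d c = sym1 b x y p d c * KK x y h w p d + sym2 b x y p d c * KK x y h w d p"
    and "KK x y (c # h) (p # w) c d = sym3 b x y p d c * KK x y h w p d + sym4 b x y p d c * KK x y h w d p"
    by auto
qed

lemma pair_word_same:
  assumes "c \<in> S" "q \<in> S" "r \<in> S" "q \<noteq> c" "r \<noteq> c"
  shows "KK x y (c # h) (c # w) q r = (if q < c \<and> r < c then x * y * KK x y h w q r else 0)"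
  using assms S by (auto simp: pair_word_def last_two_def pair_kernel_Cons algebra_simps)

lemma pair_word_absent:
  assumes "c \<in> S" "p \<in> S" "q \<in> S" "r \<in> S" "q \<noteq> c" "r \<noteq> c" "p \<noteq> c"
  shows "KK x y (c # h) (p # w) q r = 0"
  using assms S by (auto simp: pair_word_def last_two_def pair_kernel_Cons)

lemma sym_transpose:
  assumes "Suc i < c" "{p, d} \<noteq> {i, Suc i}"
  defines "s \<equiv> transpose i (Suc i)"
  shows "sym1 b x y (s p) (s d) c = sym1 b x y p d c" "sym2 b x y (s p) (s d) c = sym2 b x y p d c"
    "sym3 b x y (s p) (s d) c = sym3 b x y p d c" "sym4 b x y (s p) (s d) c = sym4 b x y p d c"
  using assms(2) by (simp_all add: sym_defs s_def insert_commute transpose_Suc_less_iff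
      transpose_Suc_outside_iff[OF Suc_lessD[OF assms(1), THEN less_imp_neq, THEN not_sym] assms(1)[THEN less_imp_neq, THEN not_sym]])

lemma pair_word_second:
  assumes "i \<notin> set h"
  shows "KK x y h w i (Suc i) = pair_kernel S k x y i h w i (Suc i)"
    and "KK x y h w (Suc i) i = - x * pair_kernel S k x y i h w i (Suc i)"
  by (simp_all add: pair_word_def last_two_def pair_kernel_second[OF assms])

text \<open>Columns with larger labels preserve the relation since their coefficients are symmetric.
  At the start \<open>[i + 1, i]\<close> has weight 1 and \<open>[i, i + 1]\<close> has weight
  \<open>- x\<close>, and the relation reads
  \<open>(1 - b * y) * (- x) - (1 - b * x) * (- y) = y - x\<close>.\<close>

lemma pair_word_exchange:
  assumes "distinct h" "set h \<subseteq> S" "\<forall>c\<in>set h. Suc i < c"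
    and "length w = length h" "mset (r # q # w) = mset (i # Suc i # h)"
  shows "exchange_rel b x y i (r # q # w) (KK x y h w q r) (KK y x h w q r)
     (KK x y h (swap_labels i w) (transpose i (Suc i) q) (transpose i (Suc i) r))"
  using assms
proof (induction h arbitrary: w q r)
  case Nil
  then have w: "w = []" and "q = i \<and> r = Suc i \<or> q = Suc i \<and> r = i"
    by (auto simp: add_eq_conv_ex)
  then show ?case
    by (auto simp: exchange_rel_def pair_word_def last_two_def pair_kernel_Nil algebra_simps)
next
  case (Cons c h)
  let ?s = "transpose i (Suc i)"
  obtain p w' where w: "w = p # w'" using Cons.prems by (cases w) auto
  have ms: "mset (r # q # p # w') = mset (i # Suc i # c # h)" using Cons.prems w by simp
  have dist: "distinct (r # q # p # w')"
  proof -
    have "distinct (i # Suc i # c # h)" using Cons.prems by auto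
    then show ?thesis using ms by (metis mset_eq_imp_distinct_iff)
  qed
  have sets: "set (r # q # p # w') = set (i # Suc i # c # h)" using ms by (metis mset_eq_setD)
  have inS: "r \<in> S" "q \<in> S" "p \<in> S" "c \<in> S" "set w' \<subseteq> S"
  proof -
    have "set (r # q # p # w') \<subseteq> S" unfolding sets using Cons.prems S by auto
    then show "r \<in> S" "q \<in> S" "p \<in> S" "c \<in> S" "set w' \<subseteq> S" using Cons.prems by auto
  qed
  have sS: "?s z \<in> S" if "z \<in> S" for z using that S by (auto simp: transpose_def)
  have c: "Suc i < c" and cS: "c \<in> S" using Cons.prems by auto
  have IH: "exchange_rel b x y i (r # q # w') (KK x y h w' q r) (KK y x h w' q r) (KK x y h (swap_labels i w') (?s q) (?s r))"
    if "mset (r # q # w') = mset (i # Suc i # h)" for q r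
    using Cons.IH[of w' r q] Cons.prems w that by auto
  note tr = transpose_Suc_outside_iff[OF Suc_lessD[OF c, THEN less_imp_neq, THEN not_sym] c[THEN less_imp_neq, THEN not_sym]]
  have i: "i \<notin> set h" using Cons.prems by auto
  show ?case
  proof (cases "c = p")
    case True
    have "mset (r # q # w') = mset (i # Suc i # h)" using ms True by (simp add: add_mset_commute)
    from exchange_rel_linear[OF IH[OF this] IH[OF this], of "if q < c \<and> r < c then x * y else 0" 0]
    show ?thesis
      using True w dist inS tr sS c
      by (auto simp: pair_word_same exchange_rel_def mult.commute)
  next
    case cp: False
    have step: "exchange_rel b x y i (r' # q' # w) (KK x y (c # h) w q' r') (KK y x (c # h) w q' r')
         (KK x y (c # h) (swap_labels i w) (?s q') (?s r'))"
      if rq: "r' = c \<and> q' = d \<or> r' = d \<and> q' = c" and d: "distinct (d # p # c # w')" "d \<in> S" "mset (d # p # w') = mset (i # Suc i # h)"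
      for d r' q'
    proof (cases "{p, d} = {i, Suc i}")
      case False
      have e1: "exchange_rel b x y i (d # p # w') (KK x y h w' p d) (KK y x h w' p d) (KK x y h (swap_labels i w') (?s p) (?s d))"
        by (rule IH) (use d in auto)
      have "mset (p # d # w') = mset (i # Suc i # h)" using d by (simp add: add_mset_commute)
      from IH[OF this] have e2: "exchange_rel b x y i (d # p # w') (KK x y h w' d p) (KK y x h w' d p) (KK x y h (swap_labels i w') (?s d) (?s p))"
        using False d by (auto simp: exchange_rel_def)
      have inv: "inverted i (r' # q' # w) = inverted i (d # p # w')"
        using rq c w by auto
      have ne: "?s p \<noteq> ?s d" using d by (metis distinct_length_2_or_more transpose_involutory)
      note st = sym_transpose[OF c False]
      have rel: "exchange_rel b x y i (r' # q' # w) = exchange_rel b x y i (d # p # w')"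
        unfolding exchange_rel_def fun_eq_iff inv by simp
      have sc: "?s c = c" using tr by simp
      have s: "?s p \<in> S" "?s d \<in> S" "c \<noteq> ?s p" "c \<noteq> ?s d"
        using sS inS d tr(3)[of p] tr(3)[of d] cp by auto
      have pd: "c \<noteq> d" "p \<noteq> d" using d by auto
      note K = pair_word_step[OF cS d(2) inS(3) cp pd]
        pair_word_step[OF cS s(2) s(1) s(3) s(4) ne, unfolded st]
      have "exchange_rel b x y i (d # p # w') (KK x y (c # h) w q' r') (KK y x (c # h) w q' r')
         (KK x y (c # h) (swap_labels i w) (?s q') (?s r'))"
        using rq by (auto simp only: w list.map K sc sym_commute[of b y x] intro: exchange_rel_linear[OF e1 e2])
      then show ?thesis
        by (simp only: rel)
    next
      case True
      have "swap_labels i w' = w'"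
        by (rule map_idI) (use d True in \<open>auto simp: transpose_def doubleton_eq_iff\<close>)
      have m: "mset (Suc i # i # w') = mset (i # Suc i # h)" using d True by (auto simp: doubleton_eq_iff add_mset_commute)
      \<comment> \<open>The coefficients depend on the order of \<open>p\<close> and
        \<open>d\<close>, which the exchange of labels reverses here. So all terms are expressed by
        one \<open>Z\<close>, symmetric in \<open>x\<close> and \<open>y\<close> because a word
        starting with \<open>i + 1, i\<close> is not inverted.\<close>
      define Z where "Z = KK x y h w' i (Suc i)"
      have Z': "KK y x h w' i (Suc i) = Z"
        using IH[OF m] by (simp add: exchange_rel_def Z_def)
      have Z2: "KK x y h w' (Suc i) i = - x * Z" "KK y x h w' (Suc i) i = - y * Z"
        using pair_word_second[OF i, of x y w'] pair_word_second[OF i, of y x w'] Z' by (simp_all add: Z_def)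
      have sw: "?s c = c" using c by (simp add: transpose_def)
      have "p = i \<and> d = Suc i \<or> p = Suc i \<and> d = i" using True by (auto simp: doubleton_eq_iff)
      then show ?thesis
        using rq w d c inS Z' Z2 cp sw S \<open>swap_labels i w' = w'\<close>
        by (auto simp: pair_word_step exchange_rel_def sym_defs Z_def[symmetric] algebra_simps)
    qed
    have "c \<in> set (r # q # p # w')" using sets by auto
    then consider "c = r" | "c = q" | "c \<in> set w'" using cp by auto
    then show ?thesis
    proof cases
      case 1
      show ?thesis by (rule step[of _ _ q]) (use 1 dist inS ms in \<open>auto simp: add_mset_commute\<close>)
    next
      case 2
      show ?thesis by (rule step[of _ _ r]) (use 2 dist inS ms in \<open>auto simp: add_mset_commute\<close>)
    next
      case 3
      then have "c \<noteq> r" "c \<noteq> q" using dist by auto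
      then show ?thesis
        using w inS sS cp tr by (simp add: pair_word_absent exchange_rel_def)
    qed
  qed
qed

end

section \<open>Exchange of two labels and the insertion of a smaller one\<close>

lemma insert_kernel_zero:
  "a \<noteq> i \<Longrightarrow> a \<notin> set g \<Longrightarrow> insert_kernel k x i g v a = 0"
  using mset_insert_kernel[of k x i g v a]
  by (metis insert_iff set_mset_add_mset_insert set_mset_mset)

context
  fixes S :: "nat set" and k i j :: nat and b x :: "'r::comm_ring_1"
  assumes ij: "i < j" and jS: "j \<in> S" "Suc j \<in> S"
    and bump_eq: "\<And>z t c. c \<in> S \<Longrightarrow> bump k z t c = uniform_bump b z t c"
begin

text \<open>The kernel sees labels only through comparisons. If one of \<open>j\<close>,
  \<open>j + 1\<close> is missing, these two are never compared, and the inserted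
  \<open>i < j\<close> is not moved by the exchange.\<close>

lemma insert_kernel_swap_labels:
  assumes "\<not> (j \<in> set g \<and> Suc j \<in> set g)" "set g \<subseteq> S"
  shows "insert_kernel k x i (swap_labels j g) (swap_labels j v) (transpose j (Suc j) a) = insert_kernel k x i g v a"
  using assms
proof (induction g arbitrary: v a)
  case Nil
  show ?case
    using ij by (cases v) (auto simp: transpose_def)
next
  case (Cons c g)
  show ?case
  proof (cases v)
    case (Cons t v')
    note eq = bump_eq[of c] bump_eq[of "transpose j (Suc j) c"]
    have cS: "c \<in> S" "transpose j (Suc j) c \<in> S"
      using Cons.prems jS by (auto simp: transpose_def)
    have IH: "insert_kernel k x i (swap_labels j g) (swap_labels j v') (transpose j (Suc j) a) = insert_kernel k x i g v' a" for a
      using Cons.IH[of v' a] Cons.prems by auto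
    have z: "insert_kernel k x i g v' a = 0" if "c \<in> {j, Suc j}" "a \<in> {j, Suc j}" "a \<noteq> c" for a
      using that ij Cons.prems by (intro insert_kernel_zero) auto
    have t: "uniform_bump b x (transpose j (Suc j) t) (transpose j (Suc j) c) * insert_kernel k x i g v' t = uniform_bump b x t c * insert_kernel k x i g v' t" for t
      using z[of t] by (cases "c \<in> {j, Suc j} \<and> t \<in> {j, Suc j} \<and> t \<noteq> c") (auto simp: uniform_bump_def transpose_def)
    have a: "(if transpose j (Suc j) a < transpose j (Suc j) c then x * insert_kernel k x i g v' a else 0) = (if a < c then x * insert_kernel k x i g v' a else 0)"
      using z[of a] by (cases "c \<in> {j, Suc j} \<and> a \<in> {j, Suc j} \<and> a \<noteq> c") (auto simp: transpose_def)
    have e: "transpose j (Suc j) z = transpose j (Suc j) c \<longleftrightarrow> z = c" for z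
      by (metis transpose_involutory)
    show ?thesis
      unfolding Cons list.map insert_kernel.simps IH bump_eq[OF cS(1)] bump_eq[OF cS(2)] e t
      using a by (cases "t = c") (simp_all only: simp_thms if_True if_False)
  qed simp
qed

text \<open>Two labels change their order only when the smaller one jumps to the front, so
  \<open>j\<close> never falls behind \<open>j + 1\<close>.\<close>

lemma insert_kernel_inverted:
  assumes "inverted j g" "\<not> inverted j (a # v)"
  shows "insert_kernel k x i g v a = 0"
  using assms
proof (induction g arbitrary: v a)
  case (Cons c g)
  show ?case
  proof (cases v)
    case (Cons t v')
    then show ?thesis
      using Cons.IH[of t v'] Cons.IH[of a v'] Cons.prems by (auto split: if_splits)
  qed simp
qed simp

text \<open>The correction arises where \<open>j\<close> and \<open>j + 1\<close> meet. Putting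
  \<open>j + 1\<close> down behind \<open>j\<close> costs \<open>1 - b * x\<close>, putting
  \<open>j\<close> down behind \<open>j + 1\<close> costs 1, and the jump of \<open>j\<close> over
  \<open>j + 1\<close> costs \<open>- x\<close>; indeed
  \<open>1 - b * x = 1 + b * (- x)\<close>.\<close>

lemma insert_kernel_exchange:
  assumes "\<not> inverted j g" "inverted j (a # v)" "j \<in> set g" "Suc j \<in> set g" "distinct g" "set g \<subseteq> S"
    "mset (a # v) = mset (i # g)" "i \<notin> set g"
  shows "insert_kernel k x i (swap_labels j g) v a =
    insert_kernel k x i g (swap_labels j v) (transpose j (Suc j) a) + b * insert_kernel k x i g v a"
  using assms
proof (induction g arbitrary: v a)
  case (Cons c g)
  let ?s = "transpose j (Suc j)"
  obtain t v' where v: "v = t # v'" using Cons.prems by (cases v) auto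
  have dist: "distinct (a # t # v')"
  proof -
    have "distinct (i # c # g)" using Cons.prems by auto
    then show ?thesis
      using Cons.prems(7) unfolding v by (metis mset_eq_imp_distinct_iff)
  qed
  have cS: "c \<in> S" using Cons.prems by auto
  show ?case
  proof (cases "c = j \<or> c = Suc j")
    case False
    have ga: "insert_kernel k x i (swap_labels j g) v' a = insert_kernel k x i g (swap_labels j v') (?s a) + b * insert_kernel k x i g v' a" if "t = c"
      by (rule Cons.IH) (use Cons.prems False that v in \<open>auto simp: add_mset_commute\<close>)
    have gt: "insert_kernel k x i (swap_labels j g) v' t = insert_kernel k x i g (swap_labels j v') (?s t) + b * insert_kernel k x i g v' t" if "a = c"
      by (rule Cons.IH) (use Cons.prems False that v in \<open>auto simp: add_mset_commute\<close>)
    show ?thesis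
      using ga gt False dist transpose_Suc_outside_iff[of c j] cS
      by (auto simp: v bump_eq uniform_bump_def transpose_Suc_fixed algebra_simps)
  next
    case True
    then have c: "c = Suc j" using Cons.prems by auto
    have g: "Suc j \<notin> set g" "set g \<subseteq> S" using Cons.prems c by auto
    have eq: "insert_kernel k x i (swap_labels j g) v' a = insert_kernel k x i g (swap_labels j v') (?s a)" for a
    proof -
      have "insert_kernel k x i (swap_labels j (swap_labels j g)) (swap_labels j v') (?s a) = insert_kernel k x i (swap_labels j g) v' a"
        by (rule insert_kernel_swap_labels) (use g jS in \<open>auto simp: transpose_def image_iff split: if_splits\<close>)
      then show ?thesis by (simp add: comp_def)
    qed
    have [simp]: "bump k x t j = uniform_bump b x t j" "bump k x t (Suc j) = uniform_bump b x t (Suc j)" for t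
      using bump_eq jS by auto
    have sv: "swap_labels j v' = v'" if "a = j" "t = Suc j"
      by (rule map_idI) (use dist that in \<open>auto simp: transpose_def\<close>)
    have aj: "a \<noteq> Suc j" using Cons.prems by auto
    have at: "a \<noteq> t" using dist by auto
    have e1: "insert_kernel k x i (swap_labels j (c # g)) v a =
        (if a = j then uniform_bump b x t j * insert_kernel k x i (swap_labels j g) v' t else 0)
        - (if t = j \<and> a < j then x * insert_kernel k x i (swap_labels j g) v' a else 0)"
      by (simp add: c v)
    have e2: "insert_kernel k x i (c # g) (swap_labels j v) (?s a) =
        (if a = j then uniform_bump b x (?s t) (Suc j) * insert_kernel k x i g (swap_labels j v') (?s t) else 0)
        - (if t = j \<and> ?s a < Suc j then x * insert_kernel k x i g (swap_labels j v') (?s a) else 0)"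
    proof -
      have "?s t = Suc j \<longleftrightarrow> t = j" "?s a = Suc j \<longleftrightarrow> a = j" by (auto simp: transpose_def)
      then show ?thesis by (simp add: c v)
    qed
    have e3: "insert_kernel k x i (c # g) v a = - (if t = Suc j \<and> a < Suc j then x * insert_kernel k x i g v' a else 0)"
      using aj by (simp add: c v)
    consider "a = j" "t = Suc j" | "a = j" "t \<noteq> j" "t \<noteq> Suc j" | "t = j" "a \<noteq> j" | "a \<noteq> j" "t \<noteq> j"
      using at by auto
    then show ?thesis
    proof cases
      case 1
      then have "insert_kernel k x i (swap_labels j g) v' (Suc j) = insert_kernel k x i g v' j"
        using eq[of "Suc j"] sv by simp
      then show ?thesis using 1 sv unfolding e1 e2 e3 by (simp add: uniform_bump_def algebra_simps)
    next
      case 2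
      then show ?thesis using eq[of t] unfolding e1 e2 e3 by (auto simp: uniform_bump_def transpose_Suc_fixed)
    next
      case 3
      then show ?thesis using eq[of a] aj unfolding e1 e2 e3 by (auto simp: transpose_Suc_fixed)
    next
      case 4
      then have "t \<noteq> Suc j" using Cons.prems v aj by auto
      then show ?thesis using 4 unfolding e1 e2 e3 by simp
    qed
  qed
qed simp

end

section \<open>The exchange relation for weights\<close>

lemma exchange_rel_sum:
  fixes b :: "'r::comm_ring_1"
  assumes "\<And>h. h \<in> H \<Longrightarrow> exchange_rel b x y i w (A h) (B h) (C h)"
  shows "exchange_rel b x y i w (\<Sum>h\<in>H. A h) (\<Sum>h\<in>H. B h) (\<Sum>h\<in>H. C h)"
  using assms unfolding exchange_rel_def sum_distrib_left sum_subtractf[symmetric] by auto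

lemma exchange_rel_mult:
  fixes b :: "'r::comm_ring_1"
  assumes "exchange_rel b x y i w K1 K2 K3"
  shows "exchange_rel b x y i w (u * K1) (u * K2) (u * K3)"
  using exchange_rel_linear[OF assms assms, of u 0] by simp

lemma inverted_swap_labels:
  "j \<in> set w \<or> Suc j \<in> set w \<Longrightarrow> inverted j (swap_labels j w) \<longleftrightarrow> \<not> inverted j w"
  by (induction w) (auto simp: transpose_def split: if_splits)

lemma swap_labels_arrangements:
  assumes "w \<in> arrangements A" "j \<in> A" "Suc j \<in> A"
  shows "swap_labels j w \<in> arrangements A"
proof -
  have "transpose j (Suc j) ` A = A"
    using assms by (intro transpose_image_eq) auto
  with assms(1) show ?thesis
    by (auto simp: arrangements_def distinct_map)
qed

lemma swap_labels_involutory: "swap_labels j (swap_labels j w) = w"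
  by (simp add: comp_def)

text \<open>\<open>s\<close> abstracts the exchange of the variables \<open>x_j\<close> and
  \<open>x_{j+1}\<close>: a ring endomorphism that permutes the parameters \<open>X\<close>.\<close>

context
  fixes n k j :: nat and b :: "'r::comm_ring_1" and X :: "nat \<Rightarrow> 'r" and s :: "'r \<Rightarrow> 'r"
  assumes j: "1 \<le> j" "j < n"
    and kb: "k = 0 \<and> b = 0 \<or> n \<le> k \<and> b = 1"
    and s_add: "\<And>p q. s (p + q) = s p + s q" and s_mult: "\<And>p q. s (p * q) = s p * s q" and s_one: "s 1 = 1"
    and s_X: "\<And>l. s (X l) = X (transpose j (Suc j) l)"
begin

lemma s_zero: "s 0 = 0"
  using s_add[of 0 0] by simp

lemma s_diff: "s (p - q) = s p - s q"
  using s_add[of "p - q" q] by simp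

lemma s_sum: "s (\<Sum>h\<in>H. f h) = (\<Sum>h\<in>H. s (f h))"
  by (induction H rule: infinite_finite_induct) (simp_all add: s_zero s_add)

lemma s_insert_kernel: "s (insert_kernel k x i g v a) = insert_kernel k (s x) i g v a"
  by (induction k x i g v a rule: insert_kernel.induct)
     (simp_all add: s_zero s_one s_diff s_mult bump_def)

lemma s_insertion: "s (insertion k x i g v) = insertion k (s x) i g v"
  by (simp add: insertion_def s_insert_kernel)

lemma bump_uniform_bump: "c \<in> {1..n} \<Longrightarrow> bump k z t c = uniform_bump b z t c"
  using kb by (auto simp: bump_def uniform_bump_def)

lemma s_weight_fixed: "Suc j \<le> n - m \<Longrightarrow> s (weight n X k m w) = weight n X k m w"
proof (induction m arbitrary: w)
  case (Suc m)
  have "s (X (n - m)) = X (n - m)"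
  proof -
    have "n - m \<noteq> j" "n - m \<noteq> Suc j" using Suc.prems by auto
    then show ?thesis by (simp add: s_X transpose_def)
  qed
  then show ?case
    using Suc by (simp add: s_sum s_mult s_insertion)
qed (simp add: s_zero s_one)

lemma insertion_insertion:
  assumes "h \<in> words {1..n} m" "q \<in> {1..n}" "r \<in> {1..n}" "q \<noteq> r"
  shows "(\<Sum>g\<in>words {1..n} (Suc m). insertion k x i g (r # q # w) * insertion k y (Suc i) h g)
    = last_two b x (pair_kernel {1..n} k x y i h w) q r"
proof -
  have "(\<Sum>g\<in>words {1..n} (Suc m). insertion k x i g (r # q # w) * insertion k y (Suc i) h g)
     = (\<Sum>e\<in>{1..n}. \<Sum>g\<in>words {1..n} m.
         ((if r = e then bump k x q e * insert_kernel k x i g w q else 0) - (if q = e \<and> r < e then x * insert_kernel k x i g w r else 0))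
         * insert_kernel k y (Suc i) h g e)"
    by (subst sum_words_Suc) (simp_all add: insertion_def)
  also have "\<dots> = (\<Sum>e\<in>{1..n}.
       (if e = r then bump k x q e * pair_kernel {1..n} k x y i h w q e else 0)
     - (if e = q then (if r < e then x * pair_kernel {1..n} k x y i h w r e else 0) else 0))"
    using assms by (intro sum.cong refl)
      (auto simp: pair_kernel_def words_def sum_distrib_left mult.assoc sum_negf)
  also have "\<dots> = last_two b x (pair_kernel {1..n} k x y i h w) q r"
    using assms by (auto simp: sum_subtractf sum.delta' last_two_def bump_uniform_bump uniform_bump_def)
  finally show ?thesis .
qed

text \<open>Here \<open>j + 1\<close> and \<open>j\<close> are the last two labels inserted. The
  earlier weight involves neither of their parameters, so \<open>s\<close> fixes it and merely
  exchanges the parameters of the last two insertions.\<close>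

lemma weight_exchange_first:
  assumes m: "n - Suc m = j" "Suc (Suc m) \<le> n" and w: "w \<in> arrangements (labels n (Suc (Suc m)))"
  shows "exchange_rel b (X j) (X (Suc j)) j w (weight n X k (Suc (Suc m)) w) (s (weight n X k (Suc (Suc m)) w))
     (weight n X k (Suc (Suc m)) (swap_labels j w))"
proof -
  have nm: "n - m = Suc j" using m by auto
  have len: "length w = Suc (Suc m)" using arrangements_length[OF w] m by simp
  obtain r q w' where w': "w = r # q # w'" "length w' = m"
    using len by (metis length_Suc_conv)
  have lab: "labels n (Suc (Suc m)) = insert j (insert (Suc j) (labels n m))"
    using m by auto
  have wd: "distinct w" "set w = labels n (Suc (Suc m))" using w by (auto simp: arrangements_def)
  have qr: "q \<noteq> r" "q \<in> {1..n}" "r \<in> {1..n}"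
    using wd w' by auto
  let ?t = "transpose j (Suc j)"
  have tqr: "?t q \<noteq> ?t r" "?t q \<in> {1..n}" "?t r \<in> {1..n}"
    using qr j by (auto simp: transpose_def)
  have expand: "(\<Sum>g\<in>words {1..n} (Suc m). insertion k x j g (r # q # w') * (\<Sum>h\<in>words {1..n} m. insertion k y (Suc j) h g * weight n X k m h))
     = (\<Sum>h\<in>words {1..n} m. weight n X k m h * last_two b x (pair_kernel {1..n} k x y j h w') q r)"
    if "q \<noteq> r" "q \<in> {1..n}" "r \<in> {1..n}" for x y q r w'
  proof -
    have "(\<Sum>g\<in>words {1..n} (Suc m). insertion k x j g (r # q # w') * (\<Sum>h\<in>words {1..n} m. insertion k y (Suc j) h g * weight n X k m h))
      = (\<Sum>h\<in>words {1..n} m. weight n X k m h * (\<Sum>g\<in>words {1..n} (Suc m). insertion k x j g (r # q # w') * insertion k y (Suc j) h g))"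
      unfolding sum_distrib_left by (subst sum.swap) (simp add: mult_ac)
    also have "\<dots> = (\<Sum>h\<in>words {1..n} m. weight n X k m h * last_two b x (pair_kernel {1..n} k x y j h w') q r)"
      by (intro sum.cong refl) (simp only: insertion_insertion[OF _ that(2,3,1)])
    finally show ?thesis .
  qed
  have W: "weight n X k (Suc (Suc m)) (r # q # w') = (\<Sum>g\<in>words {1..n} (Suc m). insertion k (X j) j g (r # q # w') * (\<Sum>h\<in>words {1..n} m. insertion k (X (Suc j)) (Suc j) h g * weight n X k m h))"
    for r q w' by (simp only: weight.simps m(1) nm)
  have sW: "s (weight n X k (Suc (Suc m)) (r # q # w')) = (\<Sum>g\<in>words {1..n} (Suc m). insertion k (X (Suc j)) j g (r # q # w') * (\<Sum>h\<in>words {1..n} m. insertion k (X j) (Suc j) h g * weight n X k m h))"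
    for r q w' unfolding W s_sum s_mult s_insertion s_X using s_weight_fixed nm by simp
  have per_word: "exchange_rel b (X j) (X (Suc j)) j (r # q # w')
    (weight n X k m h * last_two b (X j) (pair_kernel {1..n} k (X j) (X (Suc j)) j h w') q r)
    (weight n X k m h * last_two b (X (Suc j)) (pair_kernel {1..n} k (X (Suc j)) (X j) j h w') q r)
    (weight n X k m h * last_two b (X j) (pair_kernel {1..n} k (X j) (X (Suc j)) j h (swap_labels j w')) (?t q) (?t r))"
    if h: "h \<in> words {1..n} m" for h
  proof (cases "weight n X k m h = 0")
    case True
    then show ?thesis by (simp add: exchange_rel_def)
  next
    case False
    have ha: "h \<in> arrangements (labels n m)"
      using weight_support[OF False] h m by (auto simp: words_def)
    have "mset (r # q # w') = mset (j # Suc j # h)"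
    proof -
      have "j \<notin> labels n m" "Suc j \<notin> labels n m" using nm by auto
      then show ?thesis
        using w ha lab m unfolding w'(1) by (simp add: arrangements_iff_mset)
    qed
    note ms = this
    have hs: "distinct h" "set h \<subseteq> {1..n}" "\<forall>c\<in>set h. Suc j < c" "length w' = length h"
      using ha h w'(2) nm by (auto simp: words_def arrangements_def)
    have js: "finite {1..n}" "j \<in> {1..n}" "Suc j \<in> {1..n}"
      using j by auto
    show ?thesis
      by (rule exchange_rel_mult, rule pair_word_exchange[unfolded pair_word_def, OF js _ hs ms]) (rule bump_uniform_bump)
  qed
  show ?thesis
    unfolding w'(1) list.map sW unfolding W expand[OF qr] expand[OF tqr]
    by (rule exchange_rel_sum) (rule per_word)
qed

text \<open>Insertions below \<open>j\<close> propagate the relation. A non-inverted result comes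
  only from non-inverted words. For an inverted one, inverted words are paired with their exchanges;
  the non-inverted ones leave \<open>(1 - b * y) - (1 - b * x) = b * (x - y)\<close>, which the
  correction term of \<open>insert_kernel_exchange\<close> absorbs.\<close>

lemma weight_exchange:
  assumes m: "n - m < j" "m \<le> n" and w: "w \<in> arrangements (labels n m)"
  shows "exchange_rel b (X j) (X (Suc j)) j w (weight n X k m w) (s (weight n X k m w)) (weight n X k m (swap_labels j w))"
  using assms
proof (induction m arbitrary: w)
  case (Suc m)
  show ?case
  proof (cases "n - m = j")
    case True
    then obtain m' where m': "m = Suc m'" using j by (cases m) auto
    show ?thesis unfolding m' by (rule weight_exchange_first) (use Suc.prems True m' in auto)
  next
    case False
    define i where "i = n - m"
    have ij: "i < j" "i \<ge> 1" using Suc.prems False by (auto simp: i_def)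
    let ?x = "X i" and ?W = "words {1..n} m" and ?t = "swap_labels j"
    let ?A = "\<lambda>g w. insertion k (X i) i g w" and ?h = "weight n X k m"
    let ?Q = "arrangements (labels n m)"
    have sx: "s ?x = ?x" using ij by (simp add: s_X transpose_def)
    have jl: "j \<in> labels n m" "Suc j \<in> labels n m" "i \<notin> labels n m" "labels n m \<subseteq> {1..n}" using ij j by (auto simp: i_def)
    have lab: "labels n (Suc m) = insert i (labels n m)" using Suc.prems by (auto simp: i_def)
    have Q: "?Q \<subseteq> ?W"
    proof
      fix g assume g: "g \<in> ?Q"
      then have "length g = m" using arrangements_length[OF g] Suc.prems by simp
      then show "g \<in> ?W" using g jl(4) unfolding words_def arrangements_def by blast
    qed
    have finQ: "finite ?Q" using Q finite_words finite_subset by blast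
    have wt: "weight n X k (Suc m) w = (\<Sum>g\<in>?Q. ?A g w * ?h g)" for w
    proof -
      have "weight n X k (Suc m) w = (\<Sum>g\<in>?W. ?A g w * ?h g)"
        by (simp add: i_def)
      also have "\<dots> = (\<Sum>g\<in>?Q. ?A g w * ?h g)"
      proof (rule sum.mono_neutral_right)
      show "\<forall>g\<in>?W - ?Q. ?A g w * ?h g = 0"
      proof
        fix g assume "g \<in> ?W - ?Q"
        then have "?h g = 0"
          using weight_support[of n X k m g] Suc.prems by (auto simp: words_def)
        then show "?A g w * ?h g = 0" by simp
      qed
      qed (use Q finite_words in auto)
      finally show ?thesis .
    qed
    have IH: "exchange_rel b (X j) (X (Suc j)) j g (?h g) (s (?h g)) (?h (?t g))" if "g \<in> ?Q" for g
      using Suc.IH[OF _ _ that] Suc.prems ij by (auto simp: i_def)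
    have zero: "?A g w = 0" if "g \<in> ?Q" "inverted j g" "\<not> inverted j w" "w \<noteq> []" for g w
      using insert_kernel_inverted[of i j "{1..n}" k b g "hd w" "tl w" ?x] that ij j bump_uniform_bump
      by (simp add: insertion_def)
    have w: "w \<noteq> []" "w \<in> arrangements (labels n (Suc m))" "length w = Suc m"
      using Suc.prems arrangements_length[OF Suc.prems(3)] by auto
    have sw: "s (weight n X k (Suc m) w) = (\<Sum>g\<in>?Q. ?A g w * s (?h g))"
      unfolding wt s_sum s_mult s_insertion sx ..
    show ?thesis
    proof (cases "inverted j w")
      case False
      have "?A g w * ?h g = ?A g w * s (?h g)" if "g \<in> ?Q" for g
        using zero[OF that _ False w(1)] IH[OF that] by (cases "inverted j g") (auto simp: exchange_rel_def)
      then have "weight n X k (Suc m) w = s (weight n X k (Suc m) w)"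
        unfolding sw unfolding wt by (rule sum.cong[OF refl])
      then show ?thesis using False by (simp add: exchange_rel_def)
    next
      case True
      let ?I = "{g \<in> ?Q. inverted j g}" and ?N = "{g \<in> ?Q. \<not> inverted j g}"
      let ?y = "X (Suc j)" and ?z = "X j"
      have split: "sum f ?Q = sum f ?I + sum f ?N" for f :: "nat list \<Rightarrow> 'r"
        using finQ by (subst sum.union_disjoint[symmetric]) (auto intro!: sum.cong)
      have bij: "sum f ?I = (\<Sum>g\<in>?N. f (?t g))" for f :: "nat list \<Rightarrow> 'r"
      proof (rule sum.reindex_bij_witness[of _ ?t ?t])
        fix g assume g: "g \<in> ?I"
        then show "?t g \<in> ?N"
          using swap_labels_arrangements[of g _ j] inverted_swap_labels[of j g] jl by (auto simp: arrangements_def)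
      next
        fix g assume g: "g \<in> ?N"
        then show "?t g \<in> ?I"
          using swap_labels_arrangements[of g _ j] inverted_swap_labels[of j g] jl by (auto simp: arrangements_def)
      qed (simp_all only: swap_labels_involutory)
      have ex: "?A (?t g) w = ?A g (?t w) + b * ?A g w" if g: "g \<in> ?N" for g
      proof -
        have ms: "mset w = mset (i # g)"
          using w(2) g lab jl by (simp add: arrangements_iff_mset)
        show ?thesis
          using insert_kernel_exchange[of i j "{1..n}" k b g "hd w" "tl w" ?x] ij j bump_uniform_bump g w True ms jl
          by (cases w) (auto simp: insertion_def arrangements_def)
      qed
      have ni: "\<not> inverted j (?t w)" "?t w \<noteq> []"
        using True w inverted_swap_labels[of j w] jl lab by (auto simp: arrangements_def)
      have "(1 - b * ?y) * weight n X k (Suc m) w - (1 - b * ?z) * s (weight n X k (Suc m) w)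
          = (\<Sum>g\<in>?Q. ?A g w * ((1 - b * ?y) * ?h g - (1 - b * ?z) * s (?h g)))"
        unfolding sw unfolding wt by (simp add: sum_distrib_left sum_subtractf[symmetric] algebra_simps)
      also have "\<dots> = (\<Sum>g\<in>?I. ?A g w * ((?y - ?z) * ?h (?t g))) + (\<Sum>g\<in>?N. ?A g w * (b * (?z - ?y) * ?h g))"
        unfolding split
      proof (intro arg_cong2[of _ _ _ _ "(+)"] sum.cong refl)
        fix g assume g: "g \<in> ?I"
        then show "?A g w * ((1 - b * ?y) * ?h g - (1 - b * ?z) * s (?h g)) = ?A g w * ((?y - ?z) * ?h (?t g))"
          using IH[of g] by (simp add: exchange_rel_def)
      next
        fix g assume g: "g \<in> ?N"
        then have "s (?h g) = ?h g"
          using IH[of g] by (simp add: exchange_rel_def)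
        then show "?A g w * ((1 - b * ?y) * ?h g - (1 - b * ?z) * s (?h g)) = ?A g w * (b * (?z - ?y) * ?h g)"
          by (simp add: algebra_simps)
      qed
      also have "\<dots> = (\<Sum>g\<in>?N. (?y - ?z) * ((?A (?t g) w - b * ?A g w) * ?h g))"
        unfolding bij swap_labels_involutory sum.distrib[symmetric]
        by (intro sum.cong refl) (simp add: algebra_simps)
      also have "\<dots> = (\<Sum>g\<in>?N. (?y - ?z) * (?A g (?t w) * ?h g))"
        by (intro sum.cong refl) (simp add: ex)
      also have "\<dots> = (?y - ?z) * (\<Sum>g\<in>?N. ?A g (?t w) * ?h g)"
        by (simp add: sum_distrib_left)
      also have "(\<Sum>g\<in>?N. ?A g (?t w) * ?h g) = weight n X k (Suc m) (?t w)"
        unfolding wt split using zero[OF _ _ ni] by simp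
      finally show ?thesis using True by (simp add: exchange_rel_def)
    qed
  qed
qed (use j in simp)

end

section \<open>Schubert and Grothendieck polynomials as weights\<close>

lemma simple_transp_inj: "inj (simple_transp i)"
  by (simp add: simple_transp_def)

lemma map_key_transp_involutory:
  "Poly_Mapping.map_key (simple_transp i) (Poly_Mapping.map_key (simple_transp i) m) = m"
proof -
  have "simple_transp i \<circ> simple_transp i = (\<lambda>x. x)"
    by (simp add: simple_transp_def fun_eq_iff)
  then show ?thesis
    by (simp add: map_key_compose[OF simple_transp_inj simple_transp_inj] map_key_id)
qed

lemma inj_map_key_transp: "inj (Poly_Mapping.map_key (simple_transp i))"
  by (metis injI map_key_transp_involutory)

lemma swap_vars_single:
  "swap_vars i (Poly_Mapping.single m c) = Poly_Mapping.single (Poly_Mapping.map_key (simple_transp i) m) c"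
  using map_key_single[OF inj_map_key_transp, of i "Poly_Mapping.map_key (simple_transp i) m" c]
  by (simp add: swap_vars_def map_key_transp_involutory)

lemma swap_vars_add: "swap_vars i (f + g) = swap_vars i f + swap_vars i g"
  by (simp add: swap_vars_def map_key_plus[OF inj_map_key_transp])

lemma swap_vars_zero: "swap_vars i 0 = 0"
  by (simp add: swap_vars_def map_key_zero[OF inj_map_key_transp])

lemma mpoly_single_induct:
  fixes f :: mpoly
  assumes "P 0" "\<And>m c f. P f \<Longrightarrow> P (Poly_Mapping.single m c + f)"
  shows "P f"
proof (induction f rule: Poly_Mapping.update_induct)
  case const
  then show ?case by (rule assms)
next
  case (update f a b)
  have "Poly_Mapping.update a b f = Poly_Mapping.single a b + f"
    by (rule poly_mapping_eqI) (use update in \<open>auto simp: lookup_update lookup_add lookup_single when_def in_keys_iff\<close>)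
  then show ?case using assms(2) update by simp
qed

lemma swap_vars_mult: "swap_vars i (f * g) = swap_vars i f * swap_vars i g"
proof (induction f rule: mpoly_single_induct)
  case (2 m c f)
  have "swap_vars i (Poly_Mapping.single m c * g) = swap_vars i (Poly_Mapping.single m c) * swap_vars i g"
    by (induction g rule: mpoly_single_induct)
       (simp_all add: swap_vars_zero distrib_left swap_vars_add swap_vars_single mult_single map_key_plus[OF simple_transp_inj])
  then show ?case
    using 2 by (simp add: distrib_right swap_vars_add)
qed (simp add: swap_vars_zero)

lemma swap_vars_one: "swap_vars i 1 = 1"
proof -
  have "swap_vars i (Poly_Mapping.single 0 1) = Poly_Mapping.single 0 1"
    by (simp only: swap_vars_single map_key_zero[OF simple_transp_inj])
  then show ?thesis by (metis single_one)
qed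

lemma swap_vars_var: "swap_vars i (var l) = var (transpose i (Suc i) l)"
  using map_key_single[OF simple_transp_inj, of i "transpose i (Suc i) l" "1::nat"]
  by (simp add: var_def swap_vars_single simple_transp_def)

lemma swap_vars_diff: "swap_vars i (f - g) = swap_vars i f - swap_vars i g"
  using swap_vars_add[of i "f - g" g] by simp

lemma var_neq: "var i \<noteq> var (i + 1)"
proof
  assume "var i = var (i + 1)"
  then have "Poly_Mapping.single i (1::nat) = Poly_Mapping.single (i + 1) 1"
    unfolding var_def by (metis lookup_single_eq lookup_single_not_eq zero_neq_one)
  then show False
    by (metis lookup_single_eq lookup_single_not_eq n_not_Suc_n Suc_eq_plus1 zero_neq_one)
qed

lemma divided_diff_eqI:
  assumes "g * (var i - var (i + 1)) = f - swap_vars i f"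
  shows "divided_diff i f = g"
  unfolding divided_diff_def
proof (rule the_equality)
  fix h assume "h * (var i - var (i + 1)) = f - swap_vars i f"
  then show "h = g" using assms var_neq[of i] by (metis mult_right_cancel right_minus_eq)
qed fact

text \<open>If \<open>w\<close> lists the entry columns at the exits, \<open>inv w c\<close> is the
  exit row of the pipe that enters column \<open>c\<close>; this is the label used in words.\<close>

definition column_word :: "nat \<Rightarrow> (nat \<Rightarrow> nat) \<Rightarrow> nat list" where
  "column_word n w = map (inv w) (rev [1..<Suc n])"

lemma permutes_transp:
  assumes "w permutes {1..n}" "i \<in> {1..<n}"
  shows "w \<circ> simple_transp i permutes {1..n}"
  unfolding simple_transp_def
  by (rule permutes_compose[OF permutes_swap_id assms(1)]) (use assms in auto)

lemma column_word_transp: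
  assumes "w permutes {1..n}"
  shows "column_word n (w \<circ> simple_transp i) = swap_labels i (column_word n w)"
proof -
  have "inv (w \<circ> simple_transp i) = inv (simple_transp i) \<circ> inv w"
    by (rule o_inv_distrib) (use permutes_bij[OF assms] in \<open>simp_all add: simple_transp_def\<close>)
  then show ?thesis
    by (simp add: column_word_def simple_transp_def)
qed

lemma column_word_arrangements:
  assumes "w permutes {1..n}"
  shows "column_word n w \<in> arrangements (labels n n)"
proof -
  have "inv w ` {1..n} = {1..n}"
    using permutes_inv[OF assms] by (rule permutes_image)
  moreover have "{1..<Suc n} = {1..n}" by auto
  ultimately show ?thesis
    using permutes_inj[OF permutes_inv[OF assms]]
    by (auto simp: arrangements_def column_word_def distinct_map simp del: upt_Suc intro: inj_on_subset)
qed

lemma inverted_map: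
  fixes v :: "nat \<Rightarrow> nat"
  assumes "sorted_wrt (>) cs" "inj_on v (set cs)" "a \<in> set cs" "a' \<in> set cs" "v a = i" "v a' = Suc i"
  shows "inverted i (map v cs) \<longleftrightarrow> a' < a"
  using assms
proof (induction cs)
  case (Cons c cs)
  show ?case
  proof (cases "c = a")
    case True
    then show ?thesis using Cons.prems by auto
  next
    case F1: False
    then have n1: "v c \<noteq> i" using Cons.prems by (auto simp: inj_on_def)
    show ?thesis
    proof (cases "c = a'")
      case True
      then have "a < c" using Cons.prems(1,3) F1 by auto
      then show ?thesis using True Cons.prems(5,6) by auto
    next
      case False
      then have "v c \<noteq> Suc i" using Cons.prems by (auto simp: inj_on_def)
      then show ?thesis using Cons F1 False n1 by (auto simp: inj_on_def)
    qed
  qed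
qed simp

lemma inverted_column_word:
  assumes "w permutes {1..n}" "i \<in> {1..<n}"
  shows "inverted i (column_word n w) \<longleftrightarrow> w (Suc i) < w i"
  unfolding column_word_def
proof (rule inverted_map)
  show "sorted_wrt (>) (rev [1..<Suc n])"
    by (simp add: sorted_wrt_rev del: upt_Suc)
  show "inj_on (inv w) (set (rev [1..<Suc n]))"
    using permutes_inj[OF permutes_inv[OF assms(1)]] by (auto intro: inj_on_subset)
  have "w i \<in> {1..n}" "w (Suc i) \<in> {1..n}"
    using permutes_in_image[OF assms(1)] assms(2) by auto
  then show "w i \<in> set (rev [1..<Suc n])" "w (Suc i) \<in> set (rev [1..<Suc n])"
    by auto
qed (use permutes_inverses[OF assms(1)] in simp_all)

lemma weight_swap:
  assumes w: "w permutes {1..n}" and i: "i \<in> {1..<n}" "w (i + 1) < w i"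
    and kb: "k = 0 \<and> b = 0 \<or> n \<le> k \<and> b = 1"
  defines "F \<equiv> weight n var k n (column_word n w)"
  shows "(1 - b * var (Suc i)) * F - (1 - b * var i) * swap_vars i F
     = (var (Suc i) - var i) * weight n var k n (column_word n (w \<circ> simple_transp i))"
proof -
  have "exchange_rel b (var i) (var (Suc i)) i (column_word n w) F (swap_vars i F) (weight n var k n (swap_labels i (column_word n w)))"
    unfolding F_def
    by (rule weight_exchange[where n = n])
       (use i kb column_word_arrangements[OF w] in \<open>auto simp: swap_vars_add swap_vars_mult swap_vars_one swap_vars_var\<close>)
  then show ?thesis
    using inverted_column_word[OF w i(1)] i(2) by (simp add: exchange_rel_def column_word_transp[OF w])
qed

lemma insert_kernel_top:
  assumes "length g = length v" "\<forall>c\<in>set g. i < c" "\<forall>c\<in>set v. i < c"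
  shows "insert_kernel k x i g v i = (if g = v then (- x) ^ length v else 0)"
  using assms by (induction g v rule: list_induct2) auto

text \<open>In an increasing word each label has jumped over all labels inserted before it, which
  happens in one way only.\<close>

lemma weight_longest:
  assumes "m \<le> n"
  shows "weight n X k m [Suc (n - m)..<Suc n] = (\<Prod>i\<in>labels n m. (- X i) ^ (n - i))"
  using assms
proof (induction m)
  case (Suc m)
  let ?v = "[Suc (n - m)..<Suc n]"
  have up: "[Suc (n - Suc m)..<Suc n] = (n - m) # ?v"
    using Suc.prems by (simp add: upt_rec Suc_diff_Suc)
  have v: "?v \<in> words {1..n} m" using Suc.prems by (auto simp: words_def)
  have "insertion k (X (n - m)) (n - m) g ((n - m) # ?v) * weight n X k m g
     = (if g = ?v then (- X (n - m)) ^ m * weight n X k m ?v else 0)" if g: "g \<in> words {1..n} m" for g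
  proof (cases "weight n X k m g = 0")
    case False
    then have "g \<in> arrangements (labels n m)"
      using weight_support[OF False] g Suc.prems by (auto simp: words_def)
    then show ?thesis
      using g Suc.prems by (auto simp: insertion_def words_def arrangements_def insert_kernel_top)
  qed auto
  then have "weight n X k (Suc m) [Suc (n - Suc m)..<Suc n] = (- X (n - m)) ^ m * weight n X k m ?v"
    unfolding up using v by (simp add: finite_words)
  also have "\<dots> = (\<Prod>i\<in>labels n (Suc m). (- X i) ^ (n - i))"
    using Suc labels_Suc[of m n] by simp
  finally show ?case .
qed simp

lemma swap_vars_of_int: "swap_vars i (of_int z) = of_int z"
proof -
  have "swap_vars i (of_nat l) = of_nat l" for l
    by (induction l) (simp_all add: swap_vars_zero swap_vars_one swap_vars_add)
  then show ?thesis
    by (cases z rule: int_diff_cases) (simp add: swap_vars_diff)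
qed

lemma longest_perm_permutes: "longest_perm n permutes {1..n}"
proof (rule bij_imp_permutes)
  show "bij_betw (longest_perm n) {1..n} {1..n}"
    by (rule bij_betw_byWitness[where f' = "longest_perm n"]) (auto simp: longest_perm_def)
qed (auto simp: longest_perm_def)

lemma inv_longest_perm: "inv (longest_perm n) = longest_perm n"
  by (rule inv_equality) (auto simp: longest_perm_def)

lemma column_word_longest: "column_word n (longest_perm n) = [1..<Suc n]"
  unfolding column_word_def inv_longest_perm
  by (rule nth_equalityI) (auto simp: longest_perm_def rev_nth nth_upt simp del: upt_Suc)

text \<open>Fixes the value at \<open>w_0\<close>: it cancels the signs of the jumps
  \<open>- x_i\<close> and the sign of \<open>w_0\<close>, so that the staircase monomial
  remains.\<close>

definition normalization :: "nat \<Rightarrow> int" where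
  "normalization n = (\<Prod>i\<in>{1..n}. (- 1) ^ (n - i)) * sign (longest_perm n)"

definition signed_weight :: "nat \<Rightarrow> nat \<Rightarrow> (nat \<Rightarrow> nat) \<Rightarrow> mpoly" where
  "signed_weight n k w = of_int (normalization n * sign w) * weight n var k n (column_word n w)"

lemma signed_weight_longest: "signed_weight n k (longest_perm n) = staircase n"
proof -
  have "weight n var k n [1..<Suc n] = (\<Prod>i\<in>{1..n}. (- var i) ^ (n - i))"
  proof -
    have "labels n n = {1..n}" by auto
    then show ?thesis
      using weight_longest[OF le_refl, of n var k] by (simp only: diff_self_eq_0 One_nat_def)
  qed
  also have "\<dots> = (\<Prod>i\<in>{1..n}. of_int ((- 1) ^ (n - i)) * var i ^ (n - i))"
    by (intro prod.cong refl, subst power_minus) simp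
  also have "\<dots> = of_int (\<Prod>i\<in>{1..n}. (- 1) ^ (n - i)) * (\<Prod>i\<in>{1..n}. var i ^ (n - i))"
    by (simp add: prod.distrib)
  also have "(\<Prod>i\<in>{1..n}. var i ^ (n - i)) = staircase n"
    unfolding staircase_def by (intro prod.mono_neutral_right) auto
  finally have "signed_weight n k (longest_perm n) =
      of_int ((\<Prod>i\<in>{1..n}. (- 1) ^ (n - i)) * (\<Prod>i\<in>{1..n}. (- 1) ^ (n - i))) * staircase n"
    by (simp add: signed_weight_def normalization_def column_word_longest mult.assoc del: of_int_prod)
  also have "(\<Prod>i\<in>{1..n}. (- 1) ^ (n - i)) * (\<Prod>i\<in>{1..n}. (- 1) ^ (n - i)) = (1 :: int)"
    by (simp add: prod.distrib[symmetric] power_mult_distrib[symmetric])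
  finally show ?thesis by simp
qed

lemma sign_transp:
  assumes "w permutes {1..n}"
  shows "sign (w \<circ> simple_transp i) = - sign w"
proof -
  have "permutation w"
    using assms permutation_permutes by blast
  then show ?thesis
    by (simp add: simple_transp_def sign_compose permutation_swap_id sign_swap_id)
qed

text \<open>The exchange relation has the denominator \<open>x_{i+1} - x_i\<close>, the operator
  \<open>x_i - x_{i+1}\<close>; the change of sign is that of \<open>sign\<close> under a
  transposition.\<close>

lemma divided_diff_signed_weight:
  assumes w: "w permutes {1..n}" and i: "i \<in> {1..<n}" "w (i + 1) < w i"
    and kb: "k = 0 \<and> b = 0 \<or> n \<le> k \<and> b = 1"
  shows "divided_diff i ((1 - b * var (i + 1)) * signed_weight n k w) = signed_weight n k (w \<circ> simple_transp i)"
proof (rule divided_diff_eqI)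
  let ?W = "weight n var k n (column_word n w)" and ?c = "of_int (normalization n * sign w) :: mpoly"
  have b: "swap_vars i b = b"
    using kb by (auto simp: swap_vars_zero swap_vars_one)
  have "(1 - b * var (i + 1)) * signed_weight n k w - swap_vars i ((1 - b * var (i + 1)) * signed_weight n k w)
    = ?c * ((1 - b * var (Suc i)) * ?W - (1 - b * var i) * swap_vars i ?W)"
    by (simp add: signed_weight_def swap_vars_mult swap_vars_diff swap_vars_one swap_vars_of_int swap_vars_var b algebra_simps del: of_int_mult)
  also have "\<dots> = ?c * ((var (Suc i) - var i) * weight n var k n (column_word n (w \<circ> simple_transp i)))"
    by (simp only: weight_swap[OF w i kb])
  also have "\<dots> = signed_weight n k (w \<circ> simple_transp i) * (var i - var (i + 1))"
    by (simp add: signed_weight_def sign_transp[OF w] algebra_simps)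
  finally show "signed_weight n k (w \<circ> simple_transp i) * (var i - var (i + 1)) =
    (1 - b * var (i + 1)) * signed_weight n k w - swap_vars i ((1 - b * var (i + 1)) * signed_weight n k w)" ..
qed

lemma schubert_rel_signed_weight:
  "schubert_rel n w f \<Longrightarrow> w permutes {1..n} \<and> f = signed_weight n 0 w"
proof (induction rule: schubert_rel.induct)
  case (descent w f i)
  then show ?case
    using divided_diff_signed_weight[of w n i 0 0] permutes_transp[of w n i] by (simp add: comp_def)
qed (use longest_perm_permutes in \<open>simp add: signed_weight_longest\<close>)

lemma grothendieck_rel_signed_weight:
  "grothendieck_rel n w f \<Longrightarrow> w permutes {1..n} \<and> f = signed_weight n n w"
proof (induction rule: grothendieck_rel.induct)
  case (descent w f i)
  then show ?case
    using divided_diff_signed_weight[of w n i n 1] permutes_transp[of w n i] by (simp add: comp_def)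
qed (use longest_perm_permutes in \<open>simp add: signed_weight_longest\<close>)

section \<open>Descending chains from \<open>w_0\<close> reach every permutation\<close>

lemma decreasing_imp_longest:
  assumes w: "w permutes {1..n}" and dec: "\<And>i. i \<in> {1..<n} \<Longrightarrow> w (i + 1) < w i"
  shows "w = longest_perm n"
proof -
  have range: "w i \<in> {1..n}" if "i \<in> {1..n}" for i
    using permutes_in_image[OF w] that by blast
  \<comment> \<open>Counting down from \<open>w 1 <= n\<close>; the next bound counts up from
    \<open>w n >= 1\<close>, and the two squeeze \<open>w i\<close>.\<close>
  have up: "w (Suc i) + i \<le> n" if "i < n" for i
    using that
  proof (induction i)
    case 0
    then show ?case using range[of 1] by simp
  next
    case (Suc i)
    then show ?case using dec[of "Suc i"] by auto
  qed
  have low: "w (n - i) \<ge> Suc i" if "i < n" for i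
    using that
  proof (induction i)
    case 0
    then show ?case using range[of n] by simp
  next
    case (Suc i)
    then have "n - Suc i \<in> {1..<n}" "n - Suc i + 1 = n - i" by auto
    then show ?case using dec[of "n - Suc i"] Suc by auto
  qed
  have "w i = n + 1 - i" if "i \<in> {1..n}" for i
  proof -
    have "i - 1 < n" "n - i < n" "Suc (i - 1) = i" "n - (n - i) = i" using that by auto
    then show ?thesis using up[of "i - 1"] low[of "n - i"] that by auto
  qed
  then show ?thesis
    using permutes_not_in[OF w] by (auto simp: longest_perm_def fun_eq_iff)
qed

lemma ascent_sum_less:
  assumes w: "w permutes {1..n}" and i: "i \<in> {1..<n}" "w i < w (i + 1)"
  shows "(\<Sum>l\<in>{1..n}. l * (w \<circ> simple_transp i) l) < (\<Sum>l\<in>{1..n}. l * w l)"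
proof -
  let ?R = "{1..n} - {i, i + 1}"
  have split: "(\<Sum>l\<in>{1..n}. l * v l) = i * v i + (i + 1) * v (i + 1) + (\<Sum>l\<in>?R. l * v l)" for v :: "nat \<Rightarrow> nat"
  proof -
    have "{1..n} = insert i (insert (i + 1) ?R)" using i by auto
    then have "(\<Sum>l\<in>{1..n}. l * v l) = (\<Sum>l\<in>insert i (insert (i + 1) ?R). l * v l)" by simp
    then show ?thesis by (simp add: add.assoc)
  qed
  have "(\<Sum>l\<in>?R. l * (w \<circ> simple_transp i) l) = (\<Sum>l\<in>?R. l * w l)"
    by (intro sum.cong refl) (auto simp: simple_transp_def transpose_def)
  moreover have "i * w (i + 1) + (i + 1) * w i < i * w i + (i + 1) * w (i + 1)"
    using i by simp
  ultimately show ?thesis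
    unfolding split[of w] split[of "w \<circ> simple_transp i"] by (simp add: simple_transp_def)
qed

text \<open>Swapping an ascent decreases the sum of \<open>l * w l\<close>, and a permutation
  without ascents is \<open>w_0\<close>. Read backwards, these swaps are the descents by which the
  two families of polynomials are generated.\<close>

lemma ascent_induct [consumes 1, case_names longest ascent]:
  assumes "w permutes {1..n}" and "P (longest_perm n)"
    and step: "\<And>w i. \<lbrakk>w permutes {1..n}; i \<in> {1..<n}; w (i + 1) < w i; P w\<rbrakk> \<Longrightarrow> P (w \<circ> simple_transp i)"
  shows "P w"
  using assms(1)
proof (induction "\<Sum>l\<in>{1..n}. l * w l" arbitrary: w rule: less_induct)
  case less
  show ?case
  proof (cases "\<exists>i\<in>{1..<n}. w i < w (i + 1)")
    case True
    then obtain i where i: "i \<in> {1..<n}" "w i < w (i + 1)" by auto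
    let ?v = "w \<circ> simple_transp i"
    have "P ?v"
      by (rule less.hyps) (use less.prems i ascent_sum_less permutes_transp in auto)
    moreover have "?v (i + 1) < ?v i"
      using i by (simp add: simple_transp_def)
    ultimately have "P (?v \<circ> simple_transp i)"
      using step[OF permutes_transp[OF less.prems i(1)] i(1)] by blast
    moreover have "?v \<circ> simple_transp i = w"
      by (simp add: fun_eq_iff simple_transp_def)
    ultimately show ?thesis by simp
  next
    case False
    have ne: "w i \<noteq> w (i + 1)" for i
      using permutes_inj[OF less.prems] by (simp add: inj_eq)
    have "w (i + 1) < w i" if "i \<in> {1..<n}" for i
      using False that ne[of i] by (meson nat_neq_iff)
    then have "w = longest_perm n"
      by (rule decreasing_imp_longest[OF less.prems])
    then show ?thesis using assms(2) by simp
  qed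
qed

lemma schubert_eq:
  assumes "w permutes {1..n}"
  shows "schubert n w = signed_weight n 0 w"
proof -
  have "\<exists>f. schubert_rel n w f"
    using assms
  proof (induction rule: ascent_induct)
    case longest
    show ?case by (blast intro: schubert_rel.longest)
  next
    case (ascent w i)
    then show ?case by (blast intro: schubert_rel.descent)
  qed
  then show ?thesis
    unfolding schubert_def using schubert_rel_signed_weight by (intro the_equality) auto
qed

lemma grothendieck_eq:
  assumes "w permutes {1..n}"
  shows "grothendieck n w = signed_weight n n w"
proof -
  have "\<exists>f. grothendieck_rel n w f"
    using assms
  proof (induction rule: ascent_induct)
    case longest
    show ?case by (blast intro: grothendieck_rel.longest)
  next
    case (ascent w i)
    then show ?case by (blast intro: grothendieck_rel.descent)
  qed
  then show ?thesis
    unfolding grothendieck_def using grothendieck_rel_signed_weight by (intro the_equality) auto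
qed

section \<open>Rows of tiles\<close>

definition swap_at :: "nat \<Rightarrow> 'a list \<Rightarrow> 'a list" where
  "swap_at p xs = xs[p := xs ! Suc p, Suc p := xs ! p]"

definition sort_at :: "nat \<Rightarrow> 'a::linorder list \<Rightarrow> 'a list" where
  "sort_at p xs = (if xs ! p < xs ! Suc p then swap_at p xs else xs)"

fun descending :: "nat list \<Rightarrow> 'a::linorder list \<Rightarrow> bool" where
  "descending [] xs = True"
| "descending (p # ps) xs = (xs ! Suc p < xs ! p \<and> descending ps (swap_at p xs))"

lemma swap_at_append: "p = length A \<Longrightarrow> swap_at p (A @ a # b # C) = A @ b # a # C"
  by (simp add: swap_at_def list_update_append nth_append)

lemma sort_at_append:
  "p = length A \<Longrightarrow> sort_at p (A @ a # b # C) = (if a < b then A @ b # a # C else A @ a # b # C)"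
  by (simp add: sort_at_def swap_at_append nth_append)

lemma descending_append [simp]:
  "descending (ps @ qs) xs \<longleftrightarrow> descending ps xs \<and> descending qs (fold swap_at ps xs)"
  by (induction ps arbitrary: xs) auto

text \<open>Each tile satisfying \<open>P\<close> is recorded by the number of vertical pipes (\<open>Q\<close>) to its left, which is
  the position of its two labels among the labels of all pipes.\<close>

fun crossing_ops :: "(tile \<Rightarrow> bool) \<Rightarrow> (tile \<Rightarrow> bool) \<Rightarrow> tile list \<Rightarrow> nat list" where
  "crossing_ops P Q [] = []"
| "crossing_ops P Q (d # ts) = (if P d then [length (filter Q ts)] else []) @ crossing_ops P Q ts"

abbreviation "has_top d \<equiv> Top \<in> edges d"
abbreviation "no_bottom d \<equiv> Bottom \<notin> edges d"

abbreviation "bpd_ops \<equiv> crossing_ops (\<lambda>d. d = Crossing) has_top"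
abbreviation "cobpd_ops \<equiv> crossing_ops (\<lambda>d. d = Horizontal) no_bottom"

text \<open>Names the tile behind each branch of \<open>row_step\<close>. \<open>Horizontal\<close>
  is a crossing of the co-BPD, and \<open>y < t\<close> makes it length-increasing.
  \<open>Crossing\<close> sorts the BPD labels: the pipes go straight if \<open>t < b\<close> and
  bounce if \<open>b < t\<close>.\<close>

fun row_tiles :: "nat \<Rightarrow> tile list \<Rightarrow> nat list \<Rightarrow> nat list \<Rightarrow> (nat \<times> nat) option \<Rightarrow> bool" where
  "row_tiles k [] [] [] s \<longleftrightarrow> s = None"
| "row_tiles k (d # ts) (t # v) (q # w) None \<longleftrightarrow> (case d of
      Vertical \<Rightarrow> t \<le> k \<and> q = t \<and> row_tiles k ts v w None
    | Blank \<Rightarrow> k < t \<and> q = t \<and> row_tiles k ts v w None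
    | Elbow_TL \<Rightarrow> t \<le> k \<and> k < q \<and> row_tiles k ts v w (Some (t, q))
    | _ \<Rightarrow> False)"
| "row_tiles k (d # ts) (t # v) (q # w) (Some (b, y)) \<longleftrightarrow> (case d of
      Elbow_BR \<Rightarrow> k < t \<and> t = y \<and> q = b \<and> row_tiles k ts v w None
    | Horizontal \<Rightarrow> k < t \<and> y < t \<and> q = t \<and> row_tiles k ts v w (Some (b, y))
    | Crossing \<Rightarrow> t \<le> k \<and> (t < b \<and> q = t \<and> row_tiles k ts v w (Some (b, y)) \<or>
        b < t \<and> q = b \<and> row_tiles k ts v w (Some (t, y)))
    | _ \<Rightarrow> False)"
| "row_tiles k _ _ _ s \<longleftrightarrow> False"

lemma row_tiles_length: "row_tiles k ts v w s \<Longrightarrow> length v = length ts \<and> length w = length ts"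
  by (induction k ts v w s rule: row_tiles.induct) (auto split: tile.splits)

lemma row_tiles_unique: "row_tiles k ts v w s \<Longrightarrow> row_tiles k ts' v w s \<Longrightarrow> ts = ts'"
proof (induction ts arbitrary: ts' v w s)
  case Nil
  then show ?case
    using row_tiles_length[of k "[]" v w s] row_tiles_length[of k ts' v w s] by simp
next
  case (Cons d ts)
  have len: "length v = Suc (length ts)" "length w = Suc (length ts)" "length ts' = Suc (length ts)"
    using row_tiles_length[OF Cons.prems(1)] row_tiles_length[OF Cons.prems(2)] by auto
  obtain d' us where ts': "ts' = d' # us" using len by (cases ts') auto
  obtain t v' where v: "v = t # v'" using len by (cases v) auto
  obtain q w' where w: "w = q # w'" using len by (cases w) auto
  have "d = d' \<and> (\<exists>s'. row_tiles k ts v' w' s' \<and> row_tiles k us v' w' s')"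
  proof (cases s)
    case None
    then show ?thesis using Cons.prems unfolding ts' v w by (cases d; cases d'; auto)
  next
    case (Some p)
    obtain b y where "p = (b, y)" by fastforce
    then show ?thesis using Some Cons.prems unfolding ts' v w by (cases d; cases d'; auto)
  qed
  then show ?case using Cons.IH ts' by blast
qed

text \<open>The branches of \<open>row_step\<close> exclude each other, so an entry never adds up
  several rows of tiles.\<close>

lemma row_kernel_row_tiles:
  "(row_kernel k v w s :: 'r::comm_ring_1) = (if \<exists>ts. row_tiles k ts v w s then 1 else 0)"
proof (induction v arbitrary: w s)
  case Nil
  have "(\<exists>ts. row_tiles k ts [] w s) \<longleftrightarrow> w = [] \<and> s = None"
    by (metis length_0_conv row_tiles.simps(1) row_tiles_length)
  then show ?case by (cases w) auto
next
  case (Cons t v)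
  show ?case
  proof (cases w)
    case Nil
    have "\<not> row_tiles k ts (t # v) [] s" for ts using row_tiles_length[of k ts "t # v" "[]" s] by auto
    then show ?thesis using Nil by simp
  next
    case (Cons q w')
    have ex: "(\<exists>ts. row_tiles k ts (t # v) (q # w') s) \<longleftrightarrow> (\<exists>d ts. row_tiles k (d # ts) (t # v) (q # w') s)"
    proof -
      have "\<not> row_tiles k [] (t # v) (q # w') s" by (cases s) auto
      then show ?thesis by (metis neq_Nil_conv)
    qed
    have ds: "(\<exists>d. P d) \<longleftrightarrow> P Elbow_BR \<or> P Elbow_TL \<or> P Elbow_TR \<or> P Elbow_BL \<or> P Horizontal \<or> P Vertical \<or> P Crossing \<or> P Blank" for P
    proof
      assume "\<exists>d. P d"
      then obtain d where "P d" ..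
      then show "P Elbow_BR \<or> P Elbow_TL \<or> P Elbow_TR \<or> P Elbow_BL \<or> P Horizontal \<or> P Vertical \<or> P Crossing \<or> P Blank"
        by (cases d) auto
    qed blast
    show ?thesis
    proof (cases s)
      case None
      then show ?thesis unfolding Cons ex ds by (auto simp: row_step_def Cons.IH)
    next
      case (Some p)
      obtain b y where "p = (b, y)" by fastforce
      with Some show ?thesis unfolding Cons ex ds by (auto simp: row_step_def Cons.IH)
    qed
  qed
qed

section \<open>Labels along a row\<close>

lemma row_tiles_mset:
  "row_tiles k ts v w s \<Longrightarrow>
     (case s of None \<Rightarrow> mset v = mset w | Some (b, y) \<Rightarrow> add_mset b (mset v) = add_mset y (mset w))"
  by (induction k ts v w s rule: row_tiles.induct) (auto split: tile.splits simp: add_mset_commute)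

lemma row_tiles_tops: "row_tiles k ts v w s \<Longrightarrow> list_all2 (\<lambda>d t. has_top d \<longleftrightarrow> t \<le> k) ts v"
  by (induction k ts v w s rule: row_tiles.induct) (auto split: tile.splits)

text \<open>The critical label is \<open>k + 1\<close>, which belongs to the co-BPD above the row
  and to the BPD below. The condition on \<open>s\<close> keeps it from being handed straight down:
  either the co-BPD strand on the edge has this label and ends at its column, or
  \<open>k + 1\<close> does not occur further left.\<close>

lemma row_tiles_bottoms:
  assumes "row_tiles k ts v w s" "distinct v"
    "case s of None \<Rightarrow> Suc k \<notin> set v | Some (b, y) \<Rightarrow> b \<le> Suc k \<and> (y = Suc k \<or> Suc k \<notin> set v)"
  shows "list_all2 (\<lambda>d q. Bottom \<in> edges d \<longleftrightarrow> q \<le> Suc k) ts w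
      \<and> (\<forall>b y. s = Some (b, y) \<longrightarrow> y \<in> set v)"
  using assms
  by (induction k ts v w s rule: row_tiles.induct)
     (auto split: tile.splits, metis Suc_leI le_antisym)

lemma length_filter_list_all2:
  "list_all2 (\<lambda>d t. P d \<longleftrightarrow> Q t) ts v \<Longrightarrow> length (filter P ts) = length (filter Q v)"
  by (induction ts v rule: list_all2_induct) auto

lemma length_filter_not_list_all2:
  "list_all2 (\<lambda>d q. P d \<longleftrightarrow> q \<le> m) ts w \<Longrightarrow> length (filter (\<lambda>d. \<not> P d) ts) = length (filter (\<lambda>q. m < (q::nat)) w)"
  by (induction ts w rule: list_all2_induct) auto

definition bpd_label_list where "bpd_label_list s = (case s of None \<Rightarrow> [] | Some (b, y) \<Rightarrow> [b])"
definition cobpd_label_list where "cobpd_label_list s = (case s of None \<Rightarrow> [] | Some (b, y) \<Rightarrow> [y])"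

lemma label_list_simps [simp]:
  "bpd_label_list None = []" "bpd_label_list (Some (b, y)) = [b]" "cobpd_label_list None = []" "cobpd_label_list (Some (b, y)) = [y]"
  by (simp_all add: bpd_label_list_def cobpd_label_list_def)

text \<open>BPD labels are computed downwards. The list runs through the remaining columns from left
  to right, then the edge, then \<open>W\<close>, whatever is settled further right; tiles without a
  crossing leave it unchanged.\<close>

lemma row_tiles_bpd:
  assumes "row_tiles k ts v w s" "list_all2 (\<lambda>d q. Bottom \<in> edges d \<longleftrightarrow> q \<le> Suc k) ts w"
  shows "fold sort_at (bpd_ops ts) (rev (filter (\<lambda>t. t \<le> k) v) @ bpd_label_list s @ W)
     = rev (filter (\<lambda>q. q \<le> Suc k) w) @ W"
  using assms
proof (induction k ts v w s arbitrary: W rule: row_tiles.induct)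
  case (3 k d ts t v q w b y)
  have len: "length (filter has_top ts) = length (filter (\<lambda>t. t \<le> k) v)" if "row_tiles k ts v w s" for s
    using row_tiles_tops[OF that] by (rule length_filter_list_all2)
  show ?case using 3 len by (auto split: tile.splits simp: sort_at_append)
qed (auto split: tile.splits)

text \<open>Mirror image of the BPD case: co-BPD labels are computed upwards, and
  \<open>y < t\<close> at each \<open>Horizontal\<close> is the descent that
  \<open>descending\<close> asks for.\<close>

lemma row_tiles_cobpd:
  assumes "row_tiles k ts v w s" "list_all2 (\<lambda>d q. Bottom \<in> edges d \<longleftrightarrow> q \<le> Suc k) ts w"
  shows "descending (cobpd_ops ts) (rev (filter (\<lambda>q. Suc k < q) w) @ cobpd_label_list s @ V)
    \<and> fold swap_at (cobpd_ops ts) (rev (filter (\<lambda>q. Suc k < q) w) @ cobpd_label_list s @ V)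
     = rev (filter (\<lambda>t. k < t) v) @ V"
  using assms
proof (induction k ts v w s arbitrary: V rule: row_tiles.induct)
  case (3 k d ts t v q w b y)
  have "length (filter no_bottom ts) = length (filter (\<lambda>q. Suc k < q) w)"
    using 3 by (intro length_filter_not_list_all2) auto
  then show ?case using 3 by (auto split: tile.splits simp: swap_at_append nth_append)
qed (auto split: tile.splits)

section \<open>Rows with prescribed tiles\<close>

fun row_shape :: "tile list \<Rightarrow> bool \<Rightarrow> bool" where
  "row_shape [] h = (\<not> h)"
| "row_shape (d # ts) h = (d \<in> {Elbow_BR, Elbow_TL, Horizontal, Vertical, Crossing, Blank} \<and>
     (Right \<in> edges d \<longleftrightarrow> h) \<and> row_shape ts (Left \<in> edges d))"

lemma row_tiles_shape: "row_tiles k ts v w s \<Longrightarrow> row_shape ts (s \<noteq> None)"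
  by (induction k ts v w s rule: row_tiles.induct) (auto split: tile.splits)

text \<open>Within a row the two kinds of labels do not influence each other, so BPD labels may be
  prescribed above and co-BPD labels below. The tiles consume them from right to left;
  \<open>distinct\<close> decides the crossings and \<open>descending\<close> supplies
  \<open>y < t\<close>.\<close>

lemma row_tiles_exists:
  assumes "row_shape ts (s \<noteq> None)" "length bs = length (filter has_top ts)" "length cs = length (filter no_bottom ts)"
    and "distinct bs" "\<forall>b\<in>set bs. b \<le> k" "\<forall>c\<in>set cs. Suc k < c"
    and "\<forall>b y. s = Some (b, y) \<longrightarrow> b \<notin> set bs \<and> b \<le> Suc k \<and> k < y"
    and "descending (cobpd_ops ts) (rev cs @ cobpd_label_list s @ V)"
  shows "\<exists>v w. row_tiles k ts v w s \<and> filter (\<lambda>t. t \<le> k) v = bs \<and> filter (\<lambda>q. Suc k < q) w = cs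
    \<and> list_all2 (\<lambda>d q. Bottom \<in> edges d \<longleftrightarrow> q \<le> Suc k) ts w"
  using assms
proof (induction ts arbitrary: s bs cs V)
  case Nil
  then have "row_tiles k [] [] [] s \<and> filter (\<lambda>t. t \<le> k) [] = bs \<and> filter (\<lambda>q. Suc k < q) [] = cs \<and> list_all2 (\<lambda>d q. Bottom \<in> edges d \<longleftrightarrow> q \<le> Suc k) [] []"
    by (cases s) auto
  then show ?case by blast
next
  case (Cons d ts)
  consider (V) "d = Vertical" "s = None" | (B) "d = Blank" "s = None" | (TL) "d = Elbow_TL" "s = None"
    | (BR) b y where "d = Elbow_BR" "s = Some (b, y)" | (H) b y where "d = Horizontal" "s = Some (b, y)"
    | (X) b y where "d = Crossing" "s = Some (b, y)"
    using Cons.prems(1) by (cases s) auto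
  then show ?case
  proof cases
    case V
    obtain t bs' where bs: "bs = t # bs'" using Cons.prems(2) V by (cases bs) auto
    have t: "t \<le> k" using Cons.prems(5) bs by simp
    obtain v w where vw: "row_tiles k ts v w None" "filter (\<lambda>t. t \<le> k) v = bs'" "filter (\<lambda>q. Suc k < q) w = cs" "list_all2 (\<lambda>d q. Bottom \<in> edges d \<longleftrightarrow> q \<le> Suc k) ts w"
        using Cons.IH[of None bs' cs V] Cons.prems V bs by auto
    have "row_tiles k (d # ts) (t # v) (t # w) s \<and> filter (\<lambda>t. t \<le> k) (t # v) = bs \<and> filter (\<lambda>q. Suc k < q) (t # w) = cs \<and> list_all2 (\<lambda>d q. Bottom \<in> edges d \<longleftrightarrow> q \<le> Suc k) (d # ts) (t # w)"
      using V bs t vw by simp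
    then show ?thesis by blast
  next
    case B
    obtain t cs' where cs: "cs = t # cs'" using Cons.prems(3) B by (cases cs) auto
    have t: "Suc k < t" using Cons.prems(6) cs by simp
    obtain v w where vw: "row_tiles k ts v w None" "filter (\<lambda>t. t \<le> k) v = bs" "filter (\<lambda>q. Suc k < q) w = cs'" "list_all2 (\<lambda>d q. Bottom \<in> edges d \<longleftrightarrow> q \<le> Suc k) ts w"
        using Cons.IH[of None bs cs' "t # V"] Cons.prems B cs by auto
    have "row_tiles k (d # ts) (t # v) (t # w) s \<and> filter (\<lambda>t. t \<le> k) (t # v) = bs \<and> filter (\<lambda>q. Suc k < q) (t # w) = cs \<and> list_all2 (\<lambda>d q. Bottom \<in> edges d \<longleftrightarrow> q \<le> Suc k) (d # ts) (t # w)"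
      using B cs t vw by simp
    then show ?thesis by blast
  next
    case TL
    obtain t bs' where bs: "bs = t # bs'" using Cons.prems(2) TL by (cases bs) auto
    obtain q cs' where cs: "cs = q # cs'" using Cons.prems(3) TL by (cases cs) auto
    have t: "t \<le> k" "Suc k < q" "t \<notin> set bs'" using Cons.prems(4-6) bs cs by auto
    obtain v w where vw: "row_tiles k ts v w (Some (t, q))" "filter (\<lambda>t. t \<le> k) v = bs'" "filter (\<lambda>q. Suc k < q) w = cs'" "list_all2 (\<lambda>d q. Bottom \<in> edges d \<longleftrightarrow> q \<le> Suc k) ts w"
        using Cons.IH[of "Some (t, q)" bs' cs' V] Cons.prems TL bs cs t by auto
    have "row_tiles k (d # ts) (t # v) (q # w) s \<and> filter (\<lambda>t. t \<le> k) (t # v) = bs \<and> filter (\<lambda>q. Suc k < q) (q # w) = cs \<and> list_all2 (\<lambda>d q. Bottom \<in> edges d \<longleftrightarrow> q \<le> Suc k) (d # ts) (q # w)"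
      using TL bs cs t vw by simp
    then show ?thesis by blast
  next
    case BR
    have y: "k < y" "b \<le> Suc k" using Cons.prems(7) BR by auto
    obtain v w where vw: "row_tiles k ts v w None" "filter (\<lambda>t. t \<le> k) v = bs" "filter (\<lambda>q. Suc k < q) w = cs" "list_all2 (\<lambda>d q. Bottom \<in> edges d \<longleftrightarrow> q \<le> Suc k) ts w"
        using Cons.IH[of None bs cs "y # V"] Cons.prems BR by auto
    have "row_tiles k (d # ts) (y # v) (b # w) s \<and> filter (\<lambda>t. t \<le> k) (y # v) = bs \<and> filter (\<lambda>q. Suc k < q) (b # w) = cs \<and> list_all2 (\<lambda>d q. Bottom \<in> edges d \<longleftrightarrow> q \<le> Suc k) (d # ts) (b # w)"
      using BR y vw by simp
    then show ?thesis by blast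
  next
    case H
    obtain t cs' where cs: "cs = t # cs'" using Cons.prems(3) H by (cases cs) auto
    have t: "Suc k < t" using Cons.prems(6) cs by simp
    have len: "length cs' = length (filter no_bottom ts)" using Cons.prems(3) H cs by simp
    have de: "y < t" "descending (cobpd_ops ts) (rev cs' @ [y] @ t # V)"
      using Cons.prems(8) H cs len by (simp_all add: swap_at_append nth_append)
    obtain v w where vw: "row_tiles k ts v w s" "filter (\<lambda>t. t \<le> k) v = bs" "filter (\<lambda>q. Suc k < q) w = cs'" "list_all2 (\<lambda>d q. Bottom \<in> edges d \<longleftrightarrow> q \<le> Suc k) ts w"
        using Cons.IH[of s bs cs' "t # V"] Cons.prems H cs len de by auto
    have "row_tiles k (d # ts) (t # v) (t # w) s \<and> filter (\<lambda>t. t \<le> k) (t # v) = bs \<and> filter (\<lambda>q. Suc k < q) (t # w) = cs \<and> list_all2 (\<lambda>d q. Bottom \<in> edges d \<longleftrightarrow> q \<le> Suc k) (d # ts) (t # w)"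
      using H cs t de vw by simp
    then show ?thesis by blast
  next
    case X
    obtain t bs' where bs: "bs = t # bs'" using Cons.prems(2) X by (cases bs) auto
    have t: "t \<le> k" "t \<notin> set bs'" "b \<le> Suc k" "t \<noteq> b" "b \<notin> set bs'" "k < y" using Cons.prems(4,5,7) bs X by auto
    show ?thesis
    proof (cases "t < b")
      case True
      obtain v w where vw: "row_tiles k ts v w s" "filter (\<lambda>t. t \<le> k) v = bs'" "filter (\<lambda>q. Suc k < q) w = cs" "list_all2 (\<lambda>d q. Bottom \<in> edges d \<longleftrightarrow> q \<le> Suc k) ts w"
        using Cons.IH[of s bs' cs V] Cons.prems X bs t by auto
      have "row_tiles k (d # ts) (t # v) (t # w) s \<and> filter (\<lambda>t. t \<le> k) (t # v) = bs \<and> filter (\<lambda>q. Suc k < q) (t # w) = cs \<and> list_all2 (\<lambda>d q. Bottom \<in> edges d \<longleftrightarrow> q \<le> Suc k) (d # ts) (t # w)"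
        using X bs t vw True by simp
      then show ?thesis by blast
    next
      case False
      obtain v w where vw: "row_tiles k ts v w (Some (t, y))" "filter (\<lambda>t. t \<le> k) v = bs'" "filter (\<lambda>q. Suc k < q) w = cs" "list_all2 (\<lambda>d q. Bottom \<in> edges d \<longleftrightarrow> q \<le> Suc k) ts w"
        using Cons.IH[of "Some (t, y)" bs' cs V] Cons.prems X bs t by auto
      have "row_tiles k (d # ts) (t # v) (b # w) s \<and> filter (\<lambda>t. t \<le> k) (t # v) = bs \<and> filter (\<lambda>q. Suc k < q) (b # w) = cs \<and> list_all2 (\<lambda>d q. Bottom \<in> edges d \<longleftrightarrow> q \<le> Suc k) (d # ts) (b # w)"
        using X bs t vw False by simp
      then show ?thesis by blast
    qed
  qed
qed

section \<open>Stacks of rows\<close>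

text \<open>The lowest row is the head of the list.\<close>

fun chain :: "nat \<Rightarrow> tile list list \<Rightarrow> nat list \<Rightarrow> nat list \<Rightarrow> bool" where
  "chain n [] w u \<longleftrightarrow> u = w"
| "chain n (ts # T) w u \<longleftrightarrow> (\<exists>v\<in>arrangements {1..n}.
     row_tiles (length T) ts v w (Some (Suc (length T), Suc (length T))) \<and> chain n T v u)"

fun all_bpd_ops :: "tile list list \<Rightarrow> nat list" where
  "all_bpd_ops [] = []"
| "all_bpd_ops (ts # T) = all_bpd_ops T @ bpd_ops ts"

fun all_cobpd_ops :: "tile list list \<Rightarrow> nat list" where
  "all_cobpd_ops [] = []"
| "all_cobpd_ops (ts # T) = cobpd_ops ts @ all_cobpd_ops T"

text \<open>The edges above the top row count as empty, because no BPD pipe leaves through the top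
  of the grid.\<close>

fun bottoms :: "nat \<Rightarrow> tile list list \<Rightarrow> bool list" where
  "bottoms n [] = replicate n False"
| "bottoms n (ts # T) = map (\<lambda>d. Bottom \<in> edges d) ts"

fun rows_shape :: "nat \<Rightarrow> tile list list \<Rightarrow> bool" where
  "rows_shape n [] = True"
| "rows_shape n (ts # T) = (length ts = n \<and> row_shape ts True \<and> map has_top ts = bottoms n T \<and> rows_shape n T)"

lemma map_eq_iff_list_all2: "map P ts = map Q w \<longleftrightarrow> list_all2 (\<lambda>d q. P d = Q q) ts w"
  by (induction ts arbitrary: w) (auto simp: Cons_eq_map_conv list_all2_Cons1)

lemma filter_split_eqI:
  assumes "map P v = map P v'" "filter P v = filter P v'" "filter (\<lambda>x. \<not> P x) v = filter (\<lambda>x. \<not> P x) v'"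
  shows "v = v'"
proof -
  have "length v = length v'" using assms(1) by (rule map_eq_imp_length_eq)
  then show ?thesis using assms by (induction v v' rule: list_induct2) (auto split: if_splits)
qed

lemma arrangements_upto: "w \<in> arrangements {1..n} \<Longrightarrow> length w = n \<and> distinct w \<and> set w = {1..n}"
  using arrangements_length[of w "{1..n}"] by (auto simp: arrangements_def)

lemma chain_row:
  assumes "row_tiles k ts v w (Some (Suc k, Suc k))" "v \<in> arrangements {1..n}"
  shows "w \<in> arrangements {1..n}" "list_all2 (\<lambda>d q. Bottom \<in> edges d \<longleftrightarrow> q \<le> Suc k) ts w"
proof -
  have "mset w = mset v" using row_tiles_mset[OF assms(1)] by simp
  then show "w \<in> arrangements {1..n}"
    using assms(2) by (simp add: arrangements_iff_mset)
  show "list_all2 (\<lambda>d q. Bottom \<in> edges d \<longleftrightarrow> q \<le> Suc k) ts w"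
    using row_tiles_bottoms[OF assms(1)] assms(2) by (simp add: arrangements_def)
qed

text \<open>Below \<open>k\<close> rows, the BPD list consists of the pipes in the columns followed
  by the exits \<open>k + 1..n\<close> still to come; the co-BPD list consists of the pipes in the
  columns followed by the exits \<open>k..1\<close> of the rows above.\<close>

lemma chain_props:
  assumes "chain n T w u" "w \<in> arrangements {1..n}" "length T \<le> n"
  shows "rows_shape n T \<and> map (\<lambda>q. q \<le> length T) w = bottoms n T
    \<and> fold sort_at (all_bpd_ops T) [1..<Suc n] = rev (filter (\<lambda>q. q \<le> length T) w) @ [Suc (length T)..<Suc n]
    \<and> descending (all_cobpd_ops T) (rev (filter (\<lambda>q. length T < q) w) @ rev [1..<Suc (length T)])
    \<and> fold swap_at (all_cobpd_ops T) (rev (filter (\<lambda>q. length T < q) w) @ rev [1..<Suc (length T)]) = rev u"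
  using assms
proof (induction T arbitrary: w)
  case Nil
  have "filter (\<lambda>q. q \<le> 0) w = []" "filter (\<lambda>q. 0 < q) w = w" "map (\<lambda>q. q \<le> 0) w = replicate n False"
    using arrangements_upto[OF Nil(2)] by (auto simp: filter_empty_conv filter_id_conv intro!: replicate_eqI)
  then show ?case using Nil by simp
next
  case (Cons ts T)
  let ?k = "length T"
  obtain v where v: "v \<in> arrangements {1..n}" "row_tiles ?k ts v w (Some (Suc ?k, Suc ?k))" "chain n T v u"
    using Cons.prems by auto
  note IH = Cons.IH[OF v(3,1)]
  note b = chain_row(2)[OF v(2,1)]
  have len: "length ts = n" using row_tiles_length[OF v(2)] arrangements_upto[OF v(1)] by simp
  have sh: "row_shape ts True" using row_tiles_shape[OF v(2)] by simp
  have tp: "map has_top ts = map (\<lambda>q. q \<le> ?k) v" using row_tiles_tops[OF v(2)] by (simp add: map_eq_iff_list_all2)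
  have bt: "map (\<lambda>q. q \<le> Suc ?k) w = map (\<lambda>d. Bottom \<in> edges d) ts" using b by (metis map_eq_iff_list_all2)
  have u1: "[Suc ?k..<Suc n] = Suc ?k # [Suc (Suc ?k)..<Suc n]" using Cons.prems by (intro upt_conv_Cons) auto
  have u2: "rev [1..<Suc (Suc ?k)] = Suc ?k # rev [1..<Suc ?k]" by simp
  have B: "fold sort_at (bpd_ops ts) (rev (filter (\<lambda>q. q \<le> ?k) v) @ [Suc ?k..<Suc n]) = rev (filter (\<lambda>q. q \<le> Suc ?k) w) @ [Suc (Suc ?k)..<Suc n]"
    using row_tiles_bpd[OF v(2) b] unfolding u1 by simp
  have C: "descending (cobpd_ops ts) (rev (filter (\<lambda>q. Suc ?k < q) w) @ rev [1..<Suc (Suc ?k)])"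
    "fold swap_at (cobpd_ops ts) (rev (filter (\<lambda>q. Suc ?k < q) w) @ rev [1..<Suc (Suc ?k)]) = rev (filter (\<lambda>q. ?k < q) v) @ rev [1..<Suc ?k]"
    using row_tiles_cobpd[OF v(2) b] unfolding u2 by auto
  show ?case
    using IH Cons.prems len sh tp bt B C by (auto simp del: upt_Suc)
qed

text \<open>The rows above fix which columns carry BPD pipes and with which labels; the row below
  transports the co-BPD labels of \<open>w\<close> up to \<open>v\<close>.\<close>

lemma chain_predecessor_unique:
  assumes "row_tiles (length T) ts v w (Some (Suc (length T), Suc (length T)))" "v \<in> arrangements {1..n}" "chain n T v u"
    and "row_tiles (length T) ts v' w (Some (Suc (length T), Suc (length T)))" "v' \<in> arrangements {1..n}" "chain n T v' u'"
    and "length T \<le> n"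
  shows "v = v'"
proof (rule filter_split_eqI[where P = "\<lambda>q. q \<le> length T"])
  show "map (\<lambda>q. q \<le> length T) v = map (\<lambda>q. q \<le> length T) v'"
    using chain_props[OF assms(3,2,7)] chain_props[OF assms(6,5,7)] by simp
  show "filter (\<lambda>q. q \<le> length T) v = filter (\<lambda>q. q \<le> length T) v'"
    using chain_props[OF assms(3,2,7)] chain_props[OF assms(6,5,7)] by (metis append_same_eq rev_rev_ident)
  show "filter (\<lambda>q. \<not> q \<le> length T) v = filter (\<lambda>q. \<not> q \<le> length T) v'"
    using row_tiles_cobpd[OF assms(1) chain_row(2)[OF assms(1,2)], of "[]"]
      row_tiles_cobpd[OF assms(4) chain_row(2)[OF assms(4,5)], of "[]"] by (simp add: not_le)
qed

lemma weight_chain: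
  fixes X :: "nat \<Rightarrow> 'r::comm_ring_1"
  assumes "w \<in> arrangements {1..n}" "k \<le> n"
  shows "finite {(T, u). length T = k \<and> chain n T w u} \<and>
    weight n X k n w = (\<Sum>(T, u)\<in>{(T, u). length T = k \<and> chain n T w u}. weight n X 0 n u)"
  using assms
proof (induction k arbitrary: w)
  case 0
  have "{(T, u). length T = 0 \<and> chain n T w u} = {([], w)}" by auto
  then show ?case by simp
next
  case (Suc k)
  let ?L = "\<lambda>k w. {(T, u). length T = k \<and> chain n T w u}"
  let ?A = "arrangements {1..n}"
  have lab: "labels n n = {1..n}" by auto
  have Aw: "?A \<subseteq> words {1..n} n" using arrangements_upto by (auto simp: words_def)
  have finA: "finite ?A" using Aw finite_words[of "{1..n}" n] finite_subset by auto
  let ?R = "{(v, ts). v \<in> ?A \<and> row_tiles k ts v w (Some (Suc k, Suc k))}"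
  have fints: "finite {ts. row_tiles k ts v w (Some (Suc k, Suc k))}" for v
  proof (cases "\<exists>ts. row_tiles k ts v w (Some (Suc k, Suc k))")
    case True
    then obtain ts where "row_tiles k ts v w (Some (Suc k, Suc k))" by auto
    then have "{ts. row_tiles k ts v w (Some (Suc k, Suc k))} = {ts}" using row_tiles_unique by blast
    then show ?thesis by simp
  qed auto
  have Req: "?R = (SIGMA v:?A. {ts. row_tiles k ts v w (Some (Suc k, Suc k))})" by auto
  have finR: "finite ?R" unfolding Req using finA fints by auto
  have row: "full_row k v w * c = (\<Sum>ts\<in>{ts. row_tiles k ts v w (Some (Suc k, Suc k))}. c)" for v and c :: 'r
  proof (cases "\<exists>ts. row_tiles k ts v w (Some (Suc k, Suc k))")
    case True
    then obtain ts where "row_tiles k ts v w (Some (Suc k, Suc k))" by auto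
    then have "{ts. row_tiles k ts v w (Some (Suc k, Suc k))} = {ts}" using row_tiles_unique by blast
    then show ?thesis using True by (simp add: row_kernel_row_tiles)
  qed (simp add: row_kernel_row_tiles)
  have IH: "finite (?L k v) \<and> weight n X k n v = (\<Sum>(T, u)\<in>?L k v. weight n X 0 n u)" if "v \<in> ?A" for v
    using Suc that by auto
  let ?S = "SIGMA p:?R. ?L k (fst p)"
  let ?f = "\<lambda>((v, ts), (T, u)). (ts # T, u)"
  have img: "?f ` ?S = ?L (Suc k) w"
  proof (intro set_eqI iffI)
    fix z assume "z \<in> ?L (Suc k) w"
    then obtain ts T u where z: "z = (ts # T, u)" "length T = k" "chain n (ts # T) w u"
      by (auto simp: length_Suc_conv)
    then obtain v where v: "v \<in> ?A" "row_tiles k ts v w (Some (Suc k, Suc k))" "chain n T v u" by auto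
    then have "((v, ts), (T, u)) \<in> ?S" using z by auto
    then show "z \<in> ?f ` ?S" using z by force
  qed auto
  \<comment> \<open>Forgetting the intermediate word \<open>v\<close> loses nothing, so each stack
    is counted once.\<close>
  have inj: "inj_on ?f ?S"
  proof (rule inj_onI)
    fix p q assume p: "p \<in> ?S" and q: "q \<in> ?S" and eq: "?f p = ?f q"
    obtain v ts T u where p': "p = ((v, ts), (T, u))" by (metis surj_pair)
    obtain v' ts' T' u' where q': "q = ((v', ts'), (T', u'))" by (metis surj_pair)
    have "v = v'"
      using chain_predecessor_unique[of T ts v w n u v' u'] p q eq Suc.prems unfolding p' q' by auto
    then show "p = q" using eq p' q' by simp
  qed
  have finS: "finite ?S" using finR IH by auto
  have "weight n X (Suc k) n w = (\<Sum>v\<in>words {1..n} n. full_row k v w * weight n X k n v)"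
    by (rule weight_Suc) (use Suc.prems lab in auto)
  also have "\<dots> = (\<Sum>v\<in>?A. full_row k v w * weight n X k n v)"
  proof (rule sum.mono_neutral_right)
    show "\<forall>v\<in>words {1..n} n - ?A. full_row k v w * weight n X k n v = 0"
    proof
      fix v assume "v \<in> words {1..n} n - ?A"
      then have "weight n X k n v = 0"
        using weight_support[of n X k n v] lab by (auto simp: words_def)
      then show "full_row k v w * weight n X k n v = 0" by simp
    qed
  qed (use Aw finite_words[of "{1..n}" n] in auto)
  also have "\<dots> = (\<Sum>v\<in>?A. \<Sum>ts\<in>{ts. row_tiles k ts v w (Some (Suc k, Suc k))}. weight n X k n v)"
    by (simp only: row)
  also have "\<dots> = (\<Sum>(v, ts)\<in>?R. weight n X k n v)"
    unfolding Req using finA fints by (subst sum.Sigma) auto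
  also have "\<dots> = (\<Sum>p\<in>?R. \<Sum>(T, u)\<in>?L k (fst p). weight n X 0 n u)"
    by (intro sum.cong refl) (use IH in auto)
  also have "\<dots> = (\<Sum>(p, z)\<in>?S. weight n X 0 n (snd z))"
    using finR IH by (subst sum.Sigma) (auto simp: case_prod_unfold)
  also have "\<dots> = (\<Sum>z\<in>?f ` ?S. weight n X 0 n (snd z))"
    unfolding sum.reindex[OF inj] by (intro sum.cong refl) auto
  also have "\<dots> = (\<Sum>(T, u)\<in>?L (Suc k) w. weight n X 0 n u)"
    unfolding img by (intro sum.cong refl) auto
  finally have eq: "weight n X (Suc k) n w = (\<Sum>(T, u)\<in>?L (Suc k) w. weight n X 0 n u)" .
  have "finite (?L (Suc k) w)"
    unfolding img[symmetric] using finS by (rule finite_imageI)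
  then show ?case using eq by (rule conjI)
qed

text \<open>In each tile as many strands enter (bottom, left) as leave (top, right), and nothing
  enters a row from the left.\<close>

lemma row_shape_flux:
  "row_shape ts h \<Longrightarrow> length (filter (\<lambda>d. Bottom \<in> edges d) ts) = length (filter has_top ts) + (if h then 1 else 0)"
  by (induction ts arbitrary: h) (auto split: if_splits)

lemma length_filter_map_bool: "length (filter (\<lambda>h. h) (map P ts)) = length (filter P ts)"
  by (induction ts) auto

lemma bottoms_count: "rows_shape n T \<Longrightarrow> length (filter (\<lambda>h. h) (bottoms n T)) = length T \<and> length (bottoms n T) = n"
proof (induction T)
  case (Cons ts T)
  then have IH: "length (filter (\<lambda>h. h) (map has_top ts)) = length T" "row_shape ts True" "length ts = n"
    by auto
  then show ?case
    using row_shape_flux[of ts True] by (simp add: length_filter_map_bool del: length_filter_map)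
qed simp

text \<open>Two passes through the lowest row. Co-BPD labels are sent up to give the induction
  hypothesis its \<open>cs\<close>; the word \<open>v\<close> obtained for the rows above then has
  BPD labels, which are sent down.\<close>

lemma chain_exists:
  assumes "rows_shape n T" "length T \<le> n" "distinct cs" "set cs = {Suc (length T)..n}"
    and "descending (all_cobpd_ops T) (rev cs @ rev [1..<Suc (length T)])"
  shows "\<exists>w u. w \<in> arrangements {1..n} \<and> chain n T w u \<and> filter (\<lambda>q. length T < q) w = cs"
  using assms
proof (induction T arbitrary: cs)
  case Nil
  have "cs \<in> arrangements {1..n}" using Nil by (auto simp: arrangements_def)
  moreover have "filter (\<lambda>q. 0 < q) cs = cs" using Nil by (auto simp: filter_id_conv)
  ultimately show ?case by auto
next
  case (Cons ts T)
  let ?k = "length T" and ?s = "Some (Suc (length T), Suc (length T))" and ?V = "rev [1..<Suc (length T)]"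
  have sh: "length ts = n" "row_shape ts True" "map has_top ts = bottoms n T" "rows_shape n T"
    using Cons.prems by auto
  have cnt: "length (filter has_top ts) = ?k"
    using bottoms_count[OF sh(4)] unfolding sh(3)[symmetric] by (simp add: length_filter_map_bool del: length_filter_map)
  have "length (filter (\<lambda>d. Bottom \<in> edges d) ts) + length (filter no_bottom ts) = n"
    using sum_length_filter_compl[of "\<lambda>d. Bottom \<in> edges d" ts] sh(1) by simp
  moreover have "length cs = n - Suc ?k"
    using Cons.prems(3,4) distinct_card[of cs] by simp
  ultimately have len: "length cs = length (filter no_bottom ts)"
    using row_shape_flux[OF sh(2)] cnt Cons.prems(2) by simp
  have u2: "rev [1..<Suc (Suc ?k)] = Suc ?k # ?V" by simp
  have desc: "descending (cobpd_ops ts) (rev cs @ cobpd_label_list ?s @ ?V)"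
    "descending (all_cobpd_ops T) (fold swap_at (cobpd_ops ts) (rev cs @ cobpd_label_list ?s @ ?V))"
  proof -
    have "rev cs @ rev [1..<Suc (length (ts # T))] = rev cs @ cobpd_label_list ?s @ ?V" by simp
    then show "descending (cobpd_ops ts) (rev cs @ cobpd_label_list ?s @ ?V)"
      "descending (all_cobpd_ops T) (fold swap_at (cobpd_ops ts) (rev cs @ cobpd_label_list ?s @ ?V))"
      using Cons.prems(5) by (simp_all only: all_cobpd_ops.simps descending_append)
  qed
  have ex: "\<exists>v w. row_tiles ?k ts v w ?s \<and> filter (\<lambda>t. t \<le> ?k) v = bs \<and> filter (\<lambda>q. Suc ?k < q) w = cs
     \<and> list_all2 (\<lambda>d q. Bottom \<in> edges d \<longleftrightarrow> q \<le> Suc ?k) ts w"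
    if "length bs = ?k" "distinct bs" "\<forall>b\<in>set bs. b \<le> ?k" for bs
    by (rule row_tiles_exists[where V = ?V]) (use that sh cnt len desc(1) Cons.prems(4) in auto)
  \<comment> \<open>Trial run: the BPD labels above are still unknown and \<open>1..k\<close> stands
    in for them. The co-BPD labels \<open>cs'\<close> above the row do not depend on this
    choice.\<close>
  obtain v0 w0 where 0: "row_tiles ?k ts v0 w0 ?s" "filter (\<lambda>t. t \<le> ?k) v0 = [1..<Suc ?k]" "filter (\<lambda>q. Suc ?k < q) w0 = cs"
     "list_all2 (\<lambda>d q. Bottom \<in> edges d \<longleftrightarrow> q \<le> Suc ?k) ts w0"
  proof -
    have "length [1..<Suc ?k] = ?k" "distinct [1..<Suc ?k]" "\<forall>b\<in>set [1..<Suc ?k]. b \<le> ?k"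
      by (auto simp del: upt_Suc)
    from ex[OF this] show ?thesis using that by blast
  qed
  define cs' where "cs' = filter (\<lambda>q. ?k < q) v0"
  have fold: "fold swap_at (cobpd_ops ts) (rev cs @ cobpd_label_list ?s @ ?V) = rev cs' @ ?V"
    using row_tiles_cobpd[OF 0(1,4)] 0(3) by (simp add: cs'_def)
  have len': "length cs' = n - ?k"
    using sum_length_filter_compl[of "\<lambda>t. t \<le> ?k" v0] 0(2) row_tiles_length[OF 0(1)] sh(1)
    by (simp add: cs'_def not_le del: upt_Suc)
  have "mset cs' = filter_mset (\<lambda>q. ?k < q) (mset v0)" by (simp add: cs'_def)
  also have "mset v0 = mset w0" using row_tiles_mset[OF 0(1)] by simp
  also have "filter_mset (\<lambda>q. ?k < q) (mset w0) = filter_mset (\<lambda>q. Suc ?k < q) (mset w0) + filter_mset (\<lambda>q. q = Suc ?k) (mset w0)"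
    by (induction w0) auto
  also have "\<dots> = mset cs + replicate_mset (count (mset w0) (Suc ?k)) (Suc ?k)"
    by (simp add: 0(3)[symmetric] filter_eq_replicate_mset)
  finally have ms: "mset cs' = mset cs + replicate_mset (count (mset w0) (Suc ?k)) (Suc ?k)" .
  \<comment> \<open>\<open>cs'\<close> has length \<open>n - k\<close> and \<open>cs\<close> has
    length \<open>n - k - 1\<close>, so \<open>k + 1\<close> occurs exactly once.\<close>
  have "length cs' = length cs + count (mset w0) (Suc ?k)"
    using arg_cong[OF ms, of size] by simp
  then have "count (mset w0) (Suc ?k) = 1"
    using len' \<open>length cs = n - Suc ?k\<close> Cons.prems(2) by simp
  then have ms': "mset cs' = mset (Suc ?k # cs)" using ms by simp
  have "distinct (Suc ?k # cs)" using Cons.prems(3,4) by auto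
  then have d': "distinct cs'" using ms' by (metis mset_eq_imp_distinct_iff)
  have s': "set cs' = {Suc ?k..n}"
    using mset_eq_setD[OF ms'] Cons.prems(2,4) by auto
  obtain v u where v: "v \<in> arrangements {1..n}" "chain n T v u" "filter (\<lambda>q. ?k < q) v = cs'"
  proof -
    have "?k \<le> n" using Cons.prems(2) by simp
    from Cons.IH[OF sh(4) this d' s' desc(2)[unfolded fold]] show ?thesis using that by blast
  qed
  have vk: "?k \<le> n" using Cons.prems(2) by simp
  have pat: "map (\<lambda>q. q \<le> ?k) v = map has_top ts"
    using chain_props[OF v(2,1) vk] sh(3) by simp
  have lbs: "length (filter (\<lambda>q. q \<le> ?k) v) = ?k"
    using arg_cong[OF pat, of "\<lambda>z. length (filter (\<lambda>h. h) z)"] cnt by (simp add: length_filter_map_bool del: length_filter_map)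
  \<comment> \<open>Second run, with the true BPD labels taken from \<open>v\<close>; its upper word
    turns out to be \<open>v\<close>.\<close>
  obtain v2 w where w: "row_tiles ?k ts v2 w ?s" "filter (\<lambda>t. t \<le> ?k) v2 = filter (\<lambda>t. t \<le> ?k) v" "filter (\<lambda>q. Suc ?k < q) w = cs"
     "list_all2 (\<lambda>d q. Bottom \<in> edges d \<longleftrightarrow> q \<le> Suc ?k) ts w"
  proof -
    have "distinct (filter (\<lambda>t. t \<le> ?k) v)" "\<forall>b\<in>set (filter (\<lambda>t. t \<le> ?k) v). b \<le> ?k"
      using arrangements_upto[OF v(1)] by auto
    from ex[OF lbs this] show ?thesis using that by blast
  qed
  have "v2 = v"
  proof (rule filter_split_eqI[where P = "\<lambda>t. t \<le> ?k"])
    show "map (\<lambda>t. t \<le> ?k) v2 = map (\<lambda>t. t \<le> ?k) v"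
      using row_tiles_tops[OF w(1)] pat map_eq_iff_list_all2[of has_top ts "\<lambda>t. t \<le> ?k" v2] by simp
    have "rev (filter (\<lambda>t. ?k < t) v2) @ ?V = rev cs' @ ?V"
      using row_tiles_cobpd[OF w(1,4), of ?V] fold w(3) by simp
    then show "filter (\<lambda>t. \<not> t \<le> ?k) v2 = filter (\<lambda>t. \<not> t \<le> ?k) v"
      using v(3) by (simp add: not_le)
  qed (rule w(2))
  then have "chain n (ts # T) w u" "w \<in> arrangements {1..n}"
    using w(1) v chain_row(1)[of ?k ts v w n] by auto
  then show ?case using w(3) by auto
qed

definition good_rows :: "nat \<Rightarrow> nat list \<Rightarrow> tile list list set" where
  "good_rows n w = {T. length T = n \<and> rows_shape n T \<and> fold sort_at (all_bpd_ops T) [1..<Suc n] = rev w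
     \<and> descending (all_cobpd_ops T) (rev [1..<Suc n])}"

text \<open>For \<open>k = n\<close> all labels of the bottom word are BPD labels, so the stack
  determines the word, and the co-BPD list starts as the bare exits \<open>n..1\<close>.\<close>

lemma weight_good_rows:
  fixes X :: "nat \<Rightarrow> 'r::comm_ring_1"
  assumes w: "w \<in> arrangements {1..n}"
  shows "weight n X n n w = (\<Sum>T\<in>good_rows n w. weight n X 0 n (rev (fold swap_at (all_cobpd_ops T) (rev [1..<Suc n]))))"
proof -
  let ?f = "\<lambda>T. (T, rev (fold swap_at (all_cobpd_ops T) (rev [1..<Suc n])))"
  have filt: "filter (\<lambda>q. q \<le> n) v = v" "filter (\<lambda>q. n < q) v = []" if "v \<in> arrangements {1..n}" for v
    using arrangements_upto[OF that] by (auto simp: filter_id_conv filter_empty_conv)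
  have "{(T, u). length T = n \<and> chain n T w u} = ?f ` good_rows n w"
  proof (intro set_eqI iffI)
    fix z assume "z \<in> {(T, u). length T = n \<and> chain n T w u}"
    then obtain T u where z: "z = (T, u)" "length T = n" "chain n T w u" by auto
    then show "z \<in> ?f ` good_rows n w"
      using chain_props[OF z(3) w] filt[OF w] by (auto simp: good_rows_def image_iff simp del: upt_Suc)
  next
    fix z assume "z \<in> ?f ` good_rows n w"
    then obtain T where T: "z = ?f T" "length T = n" "rows_shape n T" "fold sort_at (all_bpd_ops T) [1..<Suc n] = rev w"
       "descending (all_cobpd_ops T) (rev [1..<Suc n])"
      by (auto simp: good_rows_def)
    obtain w' u where w': "w' \<in> arrangements {1..n}" "chain n T w' u"
      using chain_exists[of n T "[]"] T by auto
    have "length T \<le> n" using T by simp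
    note p = chain_props[OF w'(2,1) this, unfolded T(2) filt[OF w'(1)]]
    have "rev w' = rev w" using p T(4) by simp
    moreover have "u = rev (fold swap_at (all_cobpd_ops T) (rev [1..<Suc n]))"
      using p by (metis append_Nil rev.simps(1) rev_rev_ident)
    ultimately show "z \<in> {(T, u). length T = n \<and> chain n T w u}" using w' T by auto
  qed
  moreover have "inj_on ?f (good_rows n w)" by (auto simp: inj_on_def)
  ultimately show ?thesis
    using weight_chain[OF w, of n X] by (simp add: sum.reindex)
qed

section \<open>Demazure products and reduced words\<close>

text \<open>Multiplication by \<open>s_i\<close> in the 0-Hecke monoid: on the right it acts on
  positions, in \<open>left_sort\<close> on values.\<close>

definition right_sort :: "nat \<Rightarrow> (nat \<Rightarrow> nat) \<Rightarrow> nat \<Rightarrow> nat" where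
  "right_sort i w = (if w i < w (Suc i) then w \<circ> transpose i (Suc i) else w)"

definition left_sort :: "nat \<Rightarrow> (nat \<Rightarrow> nat) \<Rightarrow> nat \<Rightarrow> nat" where
  "left_sort i w = (if inv w i < inv w (Suc i) then transpose i (Suc i) \<circ> w else w)"

lemma bij_right_sort: "bij w \<Longrightarrow> bij (right_sort i w)"
  by (simp add: right_sort_def bij_comp)

lemma bij_left_sort: "bij w \<Longrightarrow> bij (left_sort i w)"
  by (simp add: left_sort_def bij_comp)

lemma left_sort_inv: "bij w \<Longrightarrow> left_sort i w = inv (right_sort i (inv w))"
  by (simp add: left_sort_def right_sort_def o_inv_distrib bij_imp_bij_inv inv_inv_eq)

text \<open>The associativity of the Demazure product. The two sorts interfere only if
  \<open>w\<close> maps \<open>{i, i + 1}\<close> onto \<open>{j, j + 1}\<close>, where they are the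
  same step or both idle.\<close>

lemma sort_commute:
  assumes w: "bij w"
  shows "right_sort i (left_sort j w) = left_sort j (right_sort i w)"
proof (cases "{w i, w (Suc i)} = {j, Suc j}")
  case True
  have inj: "inv w (w a) = a" for a using w by (simp add: bij_is_inj)
  have fw: "w a = b \<longleftrightarrow> a = inv w b" for a b using w by (metis bij_inv_eq_iff)
  consider "w i = j" "w (Suc i) = Suc j" | "w i = Suc j" "w (Suc i) = j"
    using True by (auto simp: doubleton_eq_iff)
  then show ?thesis
  proof cases
    case 1
    have i: "inv w j = i" "inv w (Suc j) = Suc i" using 1 inj[of i] inj[of "Suc i"] by auto
    have wj: "w x = j \<longleftrightarrow> x = i" "w x = Suc j \<longleftrightarrow> x = Suc i" for x
      using fw i by auto
    have eq: "transpose j (Suc j) \<circ> w = w \<circ> transpose i (Suc i)"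
      by (rule ext) (simp add: transpose_def wj 1)
    have "inv (w \<circ> transpose i (Suc i)) = transpose i (Suc i) \<circ> inv w"
      using w by (simp add: o_inv_distrib)
    then show ?thesis
      using 1 i eq by (simp add: right_sort_def left_sort_def)
  next
    case 2
    have "inv w (Suc j) = i" "inv w j = Suc i" using 2 inj[of i] inj[of "Suc i"] by auto
    then show ?thesis using 2 by (simp add: right_sort_def left_sort_def)
  qed
next
  case False
  have ff: "w (inv w a) = a" for a using w by (simp add: bij_is_surj surj_f_inv_f)
  have "{inv w j, inv w (Suc j)} \<noteq> {i, Suc i}"
  proof
    assume "{inv w j, inv w (Suc j)} = {i, Suc i}"
    then have "w ` {inv w j, inv w (Suc j)} = w ` {i, Suc i}" by simp
    then show False using False by (simp add: ff)
  qed
  then have 1: "transpose i (Suc i) (inv w j) < transpose i (Suc i) (inv w (Suc j)) \<longleftrightarrow> inv w j < inv w (Suc j)"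
    by (rule transpose_Suc_less_iff)
  have 2: "transpose j (Suc j) (w i) < transpose j (Suc j) (w (Suc i)) \<longleftrightarrow> w i < w (Suc i)"
    by (rule transpose_Suc_less_iff[OF False])
  have "inv (w \<circ> transpose i (Suc i)) = transpose i (Suc i) \<circ> inv w"
    using w by (simp add: o_inv_distrib)
  then show ?thesis
    using 1 2 by (simp add: right_sort_def left_sort_def comp_assoc)
qed

lemma bij_ident: "bij (\<lambda>a. a)"
  using bij_id by (simp add: id_def)

lemma fold_right_sort_eq_left:
  "bij (foldr left_sort ps (\<lambda>a. a)) \<and> fold right_sort ps (\<lambda>a. a) = foldr left_sort ps (\<lambda>a. a)"
proof (induction ps rule: rev_induct)
  case (snoc i ps)
  have comm: "right_sort i (foldr left_sort qs w) = foldr left_sort qs (right_sort i w) \<and> bij (foldr left_sort qs w)" if "bij w" for qs w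
    using that by (induction qs) (auto simp: sort_commute bij_left_sort)
  have "inv (\<lambda>a. a) = (\<lambda>a::nat. a)"
    using inv_id by (simp add: id_def)
  then have "right_sort i (\<lambda>a. a) = left_sort i (\<lambda>a. a)"
    by (simp add: right_sort_def left_sort_def comp_def)
  then show ?case
    using snoc comm[OF bij_ident, of ps] comm[OF bij_left_sort[OF bij_ident, of i], of ps] by simp
qed (simp add: bij_ident)

text \<open>Inversion exchanges left and right sorts, and by commutation a word may be multiplied up
  from either end. This links the stacks, which start from the exits, with \<open>bpd_perm\<close>,
  which starts from the entries.\<close>

lemma inv_fold_right_sort: "inv (fold right_sort (rev ps) (\<lambda>a. a)) = fold right_sort ps (\<lambda>a. a)"
proof -
  have l: "left_sort i (inv w) = inv (right_sort i w)" if "bij w" for i w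
    using that by (simp add: left_sort_inv bij_imp_bij_inv inv_inv_eq)
  have "inv (foldr right_sort ps (\<lambda>a. a)) = foldr left_sort ps (\<lambda>a. a) \<and> bij (foldr right_sort ps (\<lambda>a. a))"
  proof (induction ps)
    case Nil
    have "inv (\<lambda>a. a) = (\<lambda>a::nat. a)"
      using inv_id by (simp add: id_def)
    then show ?case by (simp add: bij_ident)
  next
    case (Cons i ps)
    then show ?case
      using l[of "foldr right_sort ps (\<lambda>a. a)" i] by (simp add: bij_right_sort)
  qed
  then show ?thesis
    using fold_right_sort_eq_left[of ps] by (simp add: foldr_conv_fold)
qed

lemma swap_at_map:
  assumes "Suc p < n"
  shows "swap_at p (map w [1..<Suc n]) = map (w \<circ> transpose (Suc p) (Suc (Suc p))) [1..<Suc n]"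
  using assms by (intro nth_equalityI) (auto simp: swap_at_def nth_list_update transpose_def nth_append simp del: upt_Suc)

lemma sort_at_map:
  assumes "Suc p < n"
  shows "sort_at p (map w [1..<Suc n]) = map (right_sort (Suc p) w) [1..<Suc n]"
proof -
  have "map w [1..<Suc n] ! p = w (Suc p)" "map w [1..<Suc n] ! Suc p = w (Suc (Suc p))"
    using assms by (simp_all del: upt_Suc)
  then show ?thesis
    by (simp only: sort_at_def swap_at_map[OF assms] right_sort_def split: if_splits) simp
qed

lemma fold_sort_at_map:
  assumes "\<forall>p\<in>set ps. Suc p < n"
  shows "fold sort_at ps (map w [1..<Suc n]) = map (fold right_sort (map Suc ps) w) [1..<Suc n]"
  using assms by (induction ps arbitrary: w) (simp_all add: sort_at_map[unfolded One_nat_def] del: upt_Suc)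

lemma fold_right_sort_permutes:
  assumes "\<forall>p\<in>set ps. Suc p < n" "w permutes {1..n}"
  shows "fold right_sort (map Suc ps) w permutes {1..n}"
  using assms
proof (induction ps arbitrary: w)
  case (Cons p ps)
  have "right_sort (Suc p) w permutes {1..n}"
    using Cons.prems by (auto simp: right_sort_def intro!: permutes_compose permutes_swap_id)
  then show ?case using Cons by simp
qed simp

lemma permutes_eq_iff_map:
  assumes "v permutes {1..n}" "w permutes {1..n}"
  shows "map v [1..<Suc n] = map w [1..<Suc n] \<longleftrightarrow> v = w"
proof
  assume "map v [1..<Suc n] = map w [1..<Suc n]"
  then have "v i = w i" if "i \<in> {1..n}" for i
    using that by (auto simp: map_eq_conv simp del: upt_Suc)
  then show "v = w"
    using permutes_not_in[OF assms(1)] permutes_not_in[OF assms(2)] by (metis ext)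
qed simp

lemma fold_sort_at_rev:
  assumes "\<forall>p\<in>set ps. Suc p < n" "w permutes {1..n}"
  shows "fold sort_at (rev ps) [1..<Suc n] = map w [1..<Suc n] \<longleftrightarrow> fold sort_at ps [1..<Suc n] = map (inv w) [1..<Suc n]"
proof -
  let ?F = "\<lambda>ps. fold right_sort (map Suc ps) (\<lambda>a. a)"
  have fold: "fold sort_at qs [1..<Suc n] = map (?F qs) [1..<Suc n]" if "\<forall>p\<in>set qs. Suc p < n" for qs
    using fold_sort_at_map[OF that, of "\<lambda>a. a"] by (simp only: list.map_ident)
  have perm: "?F qs permutes {1..n}" if "\<forall>p\<in>set qs. Suc p < n" for qs
    using fold_right_sort_permutes[OF that permutes_id] by (simp add: id_def)
  have r: "\<forall>p\<in>set (rev ps). Suc p < n" using assms(1) by simp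
  have "inv (?F (rev ps)) = ?F ps"
    using inv_fold_right_sort[of "map Suc ps"] by (simp add: rev_map)
  moreover have "inv (?F (rev ps)) = inv w \<longleftrightarrow> ?F (rev ps) = w"
    by (metis assms(2) perm[OF r] permutes_inv_inv)
  ultimately have "?F (rev ps) = w \<longleftrightarrow> ?F ps = inv w" by simp
  then show ?thesis
    unfolding fold[OF assms(1)] fold[OF r]
    using permutes_eq_iff_map[OF perm[OF r] assms(2)] permutes_eq_iff_map[OF perm[OF assms(1)] permutes_inv[OF assms(2)]]
    by simp
qed

section \<open>Reducedness as distinctness of the exchanged pairs\<close>

fun trace :: "nat list \<Rightarrow> 'a list \<Rightarrow> 'a set list" where
  "trace [] xs = []"
| "trace (p # ps) xs = {xs ! p, xs ! Suc p} # trace ps (swap_at p xs)"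

fun ascending :: "nat list \<Rightarrow> 'a::linorder list \<Rightarrow> bool" where
  "ascending [] xs = True"
| "ascending (p # ps) xs = (xs ! p < xs ! Suc p \<and> ascending ps (swap_at p xs))"

lemma length_swap_at [simp]: "length (swap_at p xs) = length xs"
  by (simp add: swap_at_def)

lemma length_fold_swap_at [simp]: "length (fold swap_at ps xs) = length xs"
  by (induction ps arbitrary: xs) simp_all

lemma nth_swap_at:
  "Suc p < length xs \<Longrightarrow> i < length xs \<Longrightarrow> swap_at p xs ! i = xs ! transpose p (Suc p) i"
  by (auto simp: swap_at_def nth_list_update transpose_def)

lemma mset_swap_at: "Suc p < length xs \<Longrightarrow> mset (swap_at p xs) = mset xs"
  by (simp add: swap_at_def mset_swap)

lemma mset_fold_swap_at: "\<forall>p\<in>set ps. Suc p < length xs \<Longrightarrow> mset (fold swap_at ps xs) = mset xs"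
  by (induction ps arbitrary: xs) (simp_all add: mset_swap_at)

lemma swap_at_swap_at: "Suc p < length xs \<Longrightarrow> swap_at p (swap_at p xs) = xs"
  by (intro nth_equalityI) (auto simp: nth_swap_at transpose_def)

lemma map_swap_at: "Suc p < length xs \<Longrightarrow> map f (swap_at p xs) = swap_at p (map f xs)"
  by (simp add: swap_at_def map_update)

lemma map_fold_swap_at: "\<forall>p\<in>set ps. Suc p < length xs \<Longrightarrow> map f (fold swap_at ps xs) = fold swap_at ps (map f xs)"
  by (induction ps arbitrary: xs) (simp_all add: map_swap_at)

lemma trace_map: "\<forall>p\<in>set ps. Suc p < length xs \<Longrightarrow> trace ps (map f xs) = map ((`) f) (trace ps xs)"
  by (induction ps arbitrary: xs) (simp_all add: map_swap_at[symmetric])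

lemma trace_append: "trace (ps @ qs) xs = trace ps xs @ trace qs (fold swap_at ps xs)"
  by (induction ps arbitrary: xs) simp_all

lemma fold_swap_at_rev:
  "\<forall>p\<in>set ps. Suc p < length xs \<Longrightarrow> fold swap_at (rev ps) (fold swap_at ps xs) = xs"
  by (induction ps arbitrary: xs) (simp_all add: swap_at_swap_at)

lemma trace_rev:
  "\<forall>p\<in>set ps. Suc p < length xs \<Longrightarrow> trace (rev ps) (fold swap_at ps xs) = rev (trace ps xs)"
proof (induction ps arbitrary: xs)
  case (Cons p ps)
  then show ?case
    by (auto simp: trace_append fold_swap_at_rev nth_swap_at)
qed simp

lemma trace_subset: "\<forall>p\<in>set ps. Suc p < length xs \<Longrightarrow> P \<in> set (trace ps xs) \<Longrightarrow> P \<subseteq> set xs"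
proof (induction ps arbitrary: xs)
  case (Cons p ps)
  then show ?case
    using Cons.IH[of "swap_at p xs"] mset_eq_setD[OF mset_swap_at[of p xs]] by auto
qed simp

text \<open>\<open>A\<close> remembers the pairs already exchanged, which are exactly the inverted
  ones; a step is an ascent iff its pair is new.\<close>

lemma ascending_iff_distinct_trace_aux:
  assumes "\<forall>p\<in>set ps. Suc p < length xs" "distinct xs"
    and "\<forall>i j. i < j \<and> j < length xs \<longrightarrow> ({xs ! i, xs ! j} \<in> A \<longleftrightarrow> xs ! j < xs ! i)"
  shows "ascending ps xs \<longleftrightarrow> distinct (trace ps xs) \<and> set (trace ps xs) \<inter> A = {}"
  using assms
proof (induction ps arbitrary: xs A)
  case (Cons p ps)
  let ?P = "{xs ! p, xs ! Suc p}" and ?s = "transpose p (Suc p)"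
  have p: "Suc p < length xs" using Cons.prems by simp
  have P: "?P \<in> A \<longleftrightarrow> xs ! Suc p < xs ! p" using Cons.prems(3) p by auto
  have neq: "xs ! p \<noteq> xs ! Suc p" using Cons.prems(2) p by (simp add: nth_eq_iff_index_eq)
  show ?case
  proof (cases "xs ! p < xs ! Suc p")
    case True
    have d: "distinct (swap_at p xs)"
      using Cons.prems(2) mset_swap_at[OF p] by (metis mset_eq_imp_distinct_iff)
    have "ascending ps (swap_at p xs) \<longleftrightarrow> distinct (trace ps (swap_at p xs)) \<and> set (trace ps (swap_at p xs)) \<inter> insert ?P A = {}"
    proof (rule Cons.IH)
      show "\<forall>i j. i < j \<and> j < length (swap_at p xs) \<longrightarrow>
        ({swap_at p xs ! i, swap_at p xs ! j} \<in> insert ?P A \<longleftrightarrow> swap_at p xs ! j < swap_at p xs ! i)"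
      proof (intro allI impI)
        fix i j assume ij: "i < j \<and> j < length (swap_at p xs)"
        have n: "swap_at p xs ! i = xs ! ?s i" "swap_at p xs ! j = xs ! ?s j"
          using ij p by (simp_all add: nth_swap_at)
        show "{swap_at p xs ! i, swap_at p xs ! j} \<in> insert ?P A \<longleftrightarrow> swap_at p xs ! j < swap_at p xs ! i"
        proof (cases "i = p \<and> j = Suc p")
          case True
          then show ?thesis using n \<open>xs ! p < xs ! Suc p\<close> by (auto simp: insert_commute)
        next
          case False
          then have s: "?s i < ?s j" "?s j < length xs" "{?s i, ?s j} \<noteq> {p, Suc p}"
            using ij p by (auto simp: transpose_def doubleton_eq_iff split: if_splits)
          have "{xs ! ?s i, xs ! ?s j} \<noteq> ?P"
            using s p Cons.prems(2) by (auto simp: doubleton_eq_iff nth_eq_iff_index_eq)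
          then show ?thesis using n s Cons.prems(3) by auto
        qed
      qed
    qed (use Cons.prems d in auto)
    then show ?thesis using True P neq by auto
  next
    case False
    then have "?P \<in> A" using P neq by auto
    then show ?thesis using False by auto
  qed
qed simp

lemma ascending_iff_distinct_trace:
  assumes "\<forall>p\<in>set ps. Suc p < n"
  shows "ascending ps [1..<Suc n] \<longleftrightarrow> distinct (trace ps [1..<Suc n])"
  using ascending_iff_distinct_trace_aux[of ps "[1..<Suc n]" "{}"] assms by (simp del: upt_Suc)

lemma descending_iff_ascending:
  assumes "\<forall>p\<in>set ps. Suc p < length xs" "\<forall>x\<in>set xs. x \<le> n"
  shows "descending ps xs \<longleftrightarrow> ascending ps (map (\<lambda>x. Suc n - x) xs)"
  using assms
proof (induction ps arbitrary: xs)
  case (Cons p ps)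
  have p: "Suc p < length xs" using Cons.prems by simp
  have "xs ! p \<le> n" "xs ! Suc p \<le> n" using Cons.prems p by auto
  then have e: "Suc n - xs ! p < Suc n - xs ! Suc p \<longleftrightarrow> xs ! Suc p < xs ! p" by linarith
  have "\<forall>x\<in>set (swap_at p xs). x \<le> n"
    using Cons.prems mset_eq_setD[OF mset_swap_at[OF p]] by simp
  then show ?case
    using Cons.IH[of "swap_at p xs"] Cons.prems p e by (simp add: map_swap_at)
qed simp

text \<open>Distinctness of the trace survives relabelling and reversal. The reversed word is run
  from the final list of \<open>ps\<close>, renumbered by position; replacing \<open>x\<close> by
  \<open>n + 1 - x\<close> turns descents into ascents.\<close>

lemma descending_rev_iff_distinct_trace:
  assumes ps: "\<forall>p\<in>set ps. Suc p < n"
  shows "descending (rev ps) (rev [1..<Suc n]) \<longleftrightarrow> distinct (trace ps [1..<Suc n])"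
proof -
  let ?I = "[1..<Suc n]" and ?F = "fold swap_at ps [1..<Suc n]"
  have len: "length ?I = n" "\<forall>p\<in>set ps. Suc p < length ?I" "\<forall>p\<in>set (rev ps). Suc p < length ?F" "\<forall>p\<in>set (rev ps). Suc p < length (rev ?I)"
    using ps by (simp_all del: upt_Suc)
  have dF: "distinct ?F" "set ?F = set ?I"
    using mset_fold_swap_at[OF len(2)] by (metis distinct_upt mset_eq_imp_distinct_iff, metis mset_eq_setD)
  define f where "f x = Suc (THE i. i < n \<and> ?F ! i = x)" for x
  have f: "f (?F ! i) = Suc i" if "i < n" for i
  proof -
    have "(THE j. j < n \<and> ?F ! j = ?F ! i) = i"
      using that dF(1) len(1) by (intro the_equality) (auto simp: nth_eq_iff_index_eq)
    then show ?thesis by (simp add: f_def)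
  qed
  have I: "?I = map f ?F"
    using f len(1) by (intro nth_equalityI) (simp_all del: upt_Suc)
  have inj: "inj_on f (set ?F)"
    using I by (metis distinct_map distinct_upt)
  have "map (\<lambda>x. Suc n - x) (rev ?I) = ?I"
    by (intro nth_equalityI) (auto simp: rev_nth simp del: upt_Suc)
  then have "descending (rev ps) (rev ?I) \<longleftrightarrow> ascending (rev ps) ?I"
    using descending_iff_ascending[OF len(4), of n] by (simp del: upt_Suc)
  also have "\<dots> \<longleftrightarrow> distinct (trace (rev ps) ?I)"
    by (rule ascending_iff_distinct_trace) (use ps in simp)
  also have "trace (rev ps) ?I = map ((`) f) (trace (rev ps) ?F)"
    by (subst I) (rule trace_map[OF len(3)])
  also have "distinct \<dots> \<longleftrightarrow> distinct (trace (rev ps) ?F)"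
  proof -
    have "inj_on ((`) f) (set (trace (rev ps) ?F))"
    proof (rule inj_onI)
      fix P Q assume PQ: "P \<in> set (trace (rev ps) ?F)" "Q \<in> set (trace (rev ps) ?F)" and eq: "f ` P = f ` Q"
      show "P = Q"
        using inj_on_image_eq_iff[OF inj trace_subset[OF len(3) PQ(1)] trace_subset[OF len(3) PQ(2)]] eq by simp
    qed
    then show ?thesis by (simp add: distinct_map)
  qed
  also have "trace (rev ps) ?F = rev (trace ps ?I)"
    by (rule trace_rev[OF len(2)])
  finally show ?thesis by simp
qed

lemma fold_swap_at_column_word:
  assumes ps: "\<forall>p\<in>set ps. Suc p < n" and v: "v permutes {1..n}" "fold swap_at ps [1..<Suc n] = map v (rev [1..<Suc n])"
  shows "fold swap_at (rev ps) (rev [1..<Suc n]) = map (inv v) [1..<Suc n]"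
proof -
  let ?I = "[1..<Suc n]" and ?F = "fold swap_at ps [1..<Suc n]"
  have len: "\<forall>p\<in>set ps. Suc p < length ?I" "\<forall>p\<in>set (rev ps). Suc p < length ?F"
    using ps by (simp_all del: upt_Suc)
  have "rev ?I = map (inv v) ?F"
    unfolding v(2) by (simp add: permutes_inv_o[OF v(1)] del: upt_Suc)
  then have "fold swap_at (rev ps) (rev ?I) = map (inv v) (fold swap_at (rev ps) ?F)"
    using map_fold_swap_at[OF len(2), of "inv v"] by (simp only:)
  then show ?thesis
    by (simp only: fold_swap_at_rev[OF len(1)])
qed

lemma ascending_imp_fold_sort_at:
  "ascending ps xs \<Longrightarrow> fold sort_at ps xs = fold swap_at ps xs"
  by (induction ps arbitrary: xs) (simp_all add: sort_at_def)

section \<open>Labels of pipes\<close>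

text \<open>In the travelling direction of the pipes, BPDs and co-BPDs are the same kind of flow.\<close>

definition "v_in d \<longleftrightarrow> d \<in> {Vertical, Elbow_BR, Elbow_TR, Crossing}"
definition "v_out d \<longleftrightarrow> d \<in> {Vertical, Elbow_TL, Elbow_BL, Crossing}"
definition "h_in d \<longleftrightarrow> d \<in> {Horizontal, Elbow_TL, Elbow_BL, Crossing}"
definition "h_out d \<longleftrightarrow> d \<in> {Horizontal, Elbow_BR, Elbow_TR, Crossing}"

lemmas flow_defs = v_in_def v_out_def h_in_def h_out_def

abbreviation flow_ops :: "(nat \<Rightarrow> nat \<Rightarrow> tile) \<Rightarrow> nat \<Rightarrow> nat \<Rightarrow> nat list" where
  "flow_ops T k c \<equiv> rev (crossing_ops (\<lambda>d. d = Crossing) v_out (map (T k) (rev [1..<Suc c])))"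

lemma flow_ops_Suc:
  "flow_ops T k (Suc c) = flow_ops T k c
     @ (if T k (Suc c) = Crossing then [length (filter (\<lambda>c. v_out (T k c)) [1..<Suc c])] else [])"
proof -
  have "length (filter v_out (map (T k) (rev [1..<Suc c]))) = length (filter (\<lambda>c. v_out (T k c)) [1..<Suc c])"
    by (simp add: filter_map rev_filter[symmetric] comp_def del: upt_Suc)
  moreover have "rev [1..<Suc (Suc c)] = Suc c # rev [1..<Suc c]" by simp
  ultimately show ?thesis by (simp del: upt_Suc)
qed

locale flow =
  fixes T :: "nat \<Rightarrow> nat \<Rightarrow> tile" and n :: nat
  assumes vertical: "\<And>k c. \<lbrakk>1 \<le> k; k < n; 1 \<le> c; c \<le> n\<rbrakk> \<Longrightarrow> v_in (T (Suc k) c) \<longleftrightarrow> v_out (T k c)"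
    and v_first: "\<And>c. \<lbrakk>1 \<le> c; c \<le> n\<rbrakk> \<Longrightarrow> v_in (T 1 c)"
    and v_last: "\<And>c. \<lbrakk>1 \<le> c; c \<le> n\<rbrakk> \<Longrightarrow> \<not> v_out (T n c)"
    and horizontal: "\<And>k c. \<lbrakk>1 \<le> k; k \<le> n; 1 \<le> c; c < n\<rbrakk> \<Longrightarrow> h_in (T k (Suc c)) \<longleftrightarrow> h_out (T k c)"
    and h_first: "\<And>k. \<lbrakk>1 \<le> k; k \<le> n\<rbrakk> \<Longrightarrow> \<not> h_in (T k 1)"
    and h_last: "\<And>k. \<lbrakk>1 \<le> k; k \<le> n\<rbrakk> \<Longrightarrow> h_out (T k n)"
begin

definition exits where "exits X m = map (\<lambda>k. h_label X T k n) (rev [1..<Suc m])"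

text \<open>The labels along the lattice path that separates the first \<open>k - 1\<close> rows and the first \<open>c\<close> cells of
  row \<open>k\<close> from the remaining cells, followed by the exits of the earlier rows. Adding a
  cell changes this list only at a crossing, where the rule is applied to two adjacent entries.\<close>

definition cut where
  "cut X k c = map (v_label X T k) (filter (\<lambda>c. v_out (T k c)) [1..<Suc c])
     @ (if c \<noteq> 0 \<and> h_out (T k c) then [h_label X T k c] else [])
     @ map (v_label X T (k - 1)) (filter (\<lambda>c. v_in (T k c)) [Suc c..<Suc n]) @ exits X (k - 1)"

lemma cut_Suc:
  fixes X :: "nat \<Rightarrow> nat \<Rightarrow> nat \<times> nat"
  assumes k: "1 \<le> k" "k \<le> n" and c: "c < n"
  defines "A \<equiv> map (v_label X T k) (filter (\<lambda>c. v_out (T k c)) [1..<Suc c])"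
    and "C \<equiv> map (v_label X T (k - 1)) (filter (\<lambda>c. v_in (T k c)) [Suc (Suc c)..<Suc n]) @ exits X (k - 1)"
  shows "T k (Suc c) \<noteq> Crossing \<Longrightarrow> cut X k (Suc c) = cut X k c"
    and "T k (Suc c) = Crossing \<Longrightarrow> cut X k c = A @ h_label X T k c # v_label X T (k - 1) (Suc c) # C"
    and "T k (Suc c) = Crossing \<Longrightarrow> cut X k (Suc c) = A @ fst (X (v_label X T (k - 1) (Suc c)) (h_label X T k c))
        # snd (X (v_label X T (k - 1) (Suc c)) (h_label X T k c)) # C"
proof -
  obtain k' where k': "k = Suc k'" using k by (cases k) auto
  have h: "h_in (T k (Suc c)) \<longleftrightarrow> c \<noteq> 0 \<and> h_out (T k c)"
    using horizontal[of k c] h_first[of k] k c by (cases "c = 0") auto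
  have u: "[Suc c..<Suc n] = Suc c # [Suc (Suc c)..<Suc n]"
    using c by (intro upt_conv_Cons) auto
  have u': "[1..<Suc (Suc c)] = [1..<Suc c] @ [Suc c]" by simp
  have 1: "cut X k c = A @ (if h_in (T k (Suc c)) then [h_label X T k c] else [])
      @ (if v_in (T k (Suc c)) then [v_label X T (k - 1) (Suc c)] else []) @ C"
    unfolding cut_def A_def C_def h u by simp
  have 2: "cut X k (Suc c) = A @ (if v_out (T k (Suc c)) then [v_label X T k (Suc c)] else [])
      @ (if h_out (T k (Suc c)) then [h_label X T k (Suc c)] else []) @ C"
    unfolding cut_def A_def C_def u' by simp
  have v: "v_label X T k (Suc c) = (let v = v_label X T (k - 1) (Suc c); h = h_label X T k c in
     case T k (Suc c) of Vertical \<Rightarrow> v | Elbow_TL \<Rightarrow> h | Elbow_BL \<Rightarrow> h | Crossing \<Rightarrow> fst (X v h) | _ \<Rightarrow> 0)"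
    unfolding k' v_label.simps by simp
  have h': "h_label X T k (Suc c) = (let v = v_label X T (k - 1) (Suc c); h = h_label X T k c in
     case T k (Suc c) of Horizontal \<Rightarrow> h | Elbow_BR \<Rightarrow> v | Elbow_TR \<Rightarrow> v | Crossing \<Rightarrow> snd (X v h) | _ \<Rightarrow> 0)"
    unfolding k' h_label.simps by simp
  show "T k (Suc c) \<noteq> Crossing \<Longrightarrow> cut X k (Suc c) = cut X k c"
    unfolding 1 2 v h' Let_def by (cases "T k (Suc c)") (simp_all add: flow_defs)
  show "T k (Suc c) = Crossing \<Longrightarrow> cut X k c = A @ h_label X T k c # v_label X T (k - 1) (Suc c) # C"
    unfolding 1 by (simp add: flow_defs)
  show "T k (Suc c) = Crossing \<Longrightarrow> cut X k (Suc c) = A @ fst (X (v_label X T (k - 1) (Suc c)) (h_label X T k c))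
        # snd (X (v_label X T (k - 1) (Suc c)) (h_label X T k c)) # C"
    unfolding 2 v h' Let_def by (simp add: flow_defs)
qed

definition crossing_cells where
  "crossing_cells k c = map (Pair k) (filter (\<lambda>c. T k c = Crossing) [1..<Suc c])"

definition meeting where
  "meeting X = (\<lambda>(k, c). {h_label X T k (c - 1), v_label X T (k - 1) c})"

text \<open>\<open>f\<close> stays abstract to cover both \<open>sort_at\<close> with
  \<open>sort_rule\<close> and \<open>swap_at\<close> with \<open>straight_rule\<close>.\<close>

lemma fold_flow_ops:
  assumes k: "1 \<le> k" "k \<le> n" and c: "c \<le> n"
    and f: "\<And>p A h v C. p = length A \<Longrightarrow> f p (A @ h # v # C) = A @ fst (X v h) # snd (X v h) # C"
  shows "cut X k c = fold f (flow_ops T k c) (cut X k 0) \<and> length (cut X k c) = length (cut X k 0)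
    \<and> (\<forall>p\<in>set (flow_ops T k c). Suc p < length (cut X k 0))"
  using c
proof (induction c)
  case (Suc c)
  then have c: "c < n" by simp
  show ?case
  proof (cases "T k (Suc c) = Crossing")
    case True
    note s = cut_Suc(2,3)[OF k c True]
    have "f (length (filter (\<lambda>c. v_out (T k c)) [1..<Suc c])) (cut X k c) = cut X k (Suc c)"
      unfolding s by (rule f) simp
    moreover have "length (cut X k (Suc c)) = length (cut X k c)"
      "Suc (length (filter (\<lambda>c. v_out (T k c)) [1..<Suc c])) < length (cut X k c)"
      unfolding s by simp_all
    ultimately show ?thesis
      using Suc True unfolding flow_ops_Suc by (auto simp del: upt_Suc)
  next
    case False
    then show ?thesis
      using Suc cut_Suc(1)[OF k c False] unfolding flow_ops_Suc by (auto simp del: upt_Suc)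
  qed
qed simp

lemma trace_flow_ops:
  assumes k: "1 \<le> k" "k \<le> n" and c: "c \<le> n"
  shows "trace (flow_ops T k c) (cut straight_rule k 0) = map (meeting straight_rule) (crossing_cells k c)"
  using c
proof (induction c)
  case 0
  show ?case by (simp add: crossing_cells_def)
next
  case (Suc c)
  then have c: "c < n" by simp
  have u: "[1..<Suc (Suc c)] = [1..<Suc c] @ [Suc c]" by simp
  let ?p = "length (filter (\<lambda>c. v_out (T k c)) [1..<Suc c])"
  have fold: "fold swap_at (flow_ops T k c) (cut straight_rule k 0) = cut straight_rule k c"
    using fold_flow_ops[OF k, of c swap_at straight_rule] c by (simp add: swap_at_append straight_rule_def)
  show ?case
  proof (cases "T k (Suc c) = Crossing")
    case True
    have "{cut straight_rule k c ! ?p, cut straight_rule k c ! Suc ?p} = meeting straight_rule (k, Suc c)"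
      unfolding cut_Suc(2)[OF k c True] by (simp add: meeting_def nth_append)
    then show ?thesis
      using Suc True fold unfolding flow_ops_Suc
      by (simp add: trace_append crossing_cells_def u[unfolded One_nat_def] del: upt_Suc)
  next
    case False
    then show ?thesis
      using Suc unfolding flow_ops_Suc by (simp add: crossing_cells_def u[unfolded One_nat_def] del: upt_Suc)
  qed
qed

lemma cut_first: "n \<ge> 1 \<Longrightarrow> cut X 1 0 = [1..<Suc n]"
proof -
  have "filter (\<lambda>c. v_in (T 1 c)) [Suc 0..<Suc n] = [1..<Suc n]"
    using v_first by (auto simp: filter_id_conv simp del: upt_Suc)
  moreover have "map (v_label X T 0) [1..<Suc n] = [1..<Suc n]"
    by (rule map_idI) simp
  ultimately show ?thesis
    by (simp add: cut_def exits_def del: upt_Suc)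
qed

lemma exits_step: "1 \<le> k \<Longrightarrow> exits X k = h_label X T k n # exits X (k - 1)"
  by (cases k) (simp_all add: exits_def del: h_label.simps)

lemma cut_next:
  assumes "1 \<le> k" "k < n"
  shows "cut X (Suc k) 0 = cut X k n"
proof -
  have "filter (\<lambda>c. v_in (T (Suc k) c)) [1..<Suc n] = filter (\<lambda>c. v_out (T k c)) [1..<Suc n]"
    by (rule filter_cong) (use vertical[OF assms] in auto)
  moreover have "exits X k = h_label X T k n # exits X (k - 1)"
    using assms by (intro exits_step) simp
  ultimately show ?thesis
    using assms h_last[of k] by (simp add: cut_def del: upt_Suc)
qed

lemma cut_last: "n \<ge> 1 \<Longrightarrow> cut X n n = exits X n"
proof -
  assume n: "n \<ge> 1"
  have "filter (\<lambda>c. v_out (T n c)) [1..<Suc n] = []"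
    using v_last by (auto simp: filter_empty_conv)
  moreover have "exits X n = h_label X T n n # exits X (n - 1)"
    using n by (rule exits_step)
  ultimately show ?thesis
    using n h_last[of n] by (simp add: cut_def del: upt_Suc)
qed

definition total_ops where "total_ops m = concat (map (\<lambda>k. flow_ops T k n) [1..<Suc m])"

lemma total_ops_Suc: "total_ops (Suc m) = total_ops m @ flow_ops T (Suc m) n"
  by (simp add: total_ops_def)

lemma fold_total_ops_aux:
  assumes n: "n \<ge> 1" and m: "m < n"
    and f: "\<And>p A h v C. p = length A \<Longrightarrow> f p (A @ h # v # C) = A @ fst (X v h) # snd (X v h) # C"
  shows "fold f (total_ops (Suc m)) [1..<Suc n] = cut X (Suc m) n \<and> length (cut X (Suc m) n) = n
    \<and> (\<forall>p\<in>set (total_ops (Suc m)). Suc p < n)"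
  using m
proof (induction m)
  case 0
  have "total_ops (Suc 0) = flow_ops T 1 n" by (simp add: total_ops_def)
  moreover have "length [1..<Suc n] = n" by simp
  ultimately show ?case
    using fold_flow_ops[of 1 n f X, OF _ _ _ f] n cut_first[OF n, of X] by (auto simp del: upt_Suc)
next
  case (Suc m)
  then have IH: "fold f (total_ops (Suc m)) [1..<Suc n] = cut X (Suc m) n" "length (cut X (Suc m) n) = n"
    "\<forall>p\<in>set (total_ops (Suc m)). Suc p < n" by auto
  have next_cut: "cut X (Suc (Suc m)) 0 = cut X (Suc m) n" using Suc.prems by (intro cut_next) auto
  have "cut X (Suc (Suc m)) n = fold f (flow_ops T (Suc (Suc m)) n) (cut X (Suc m) n) \<and> length (cut X (Suc (Suc m)) n) = n
    \<and> (\<forall>p\<in>set (flow_ops T (Suc (Suc m)) n). Suc p < n)"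
    using fold_flow_ops[of "Suc (Suc m)" n f X, OF _ _ _ f] Suc.prems IH(2) next_cut by (auto simp del: upt_Suc)
  then show ?case
    using IH unfolding total_ops_Suc[of "Suc m"] by (auto simp del: upt_Suc)
qed

lemma fold_total_ops:
  assumes n: "n \<ge> 1"
    and f: "\<And>p A h v C. p = length A \<Longrightarrow> f p (A @ h # v # C) = A @ fst (X v h) # snd (X v h) # C"
  shows "fold f (total_ops n) [1..<Suc n] = exits X n" "\<forall>p\<in>set (total_ops n). Suc p < n"
  using fold_total_ops_aux[OF n, of "n - 1" f X, OF _ f] n cut_last[OF n, of X] by (simp_all del: upt_Suc)

definition all_cells where "all_cells m = concat (map (\<lambda>k. crossing_cells k n) [1..<Suc m])"

lemma trace_total_ops_aux:
  assumes n: "n \<ge> 1" and m: "m < n"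
  shows "trace (total_ops (Suc m)) [1..<Suc n] = map (meeting straight_rule) (all_cells (Suc m))"
  using m
proof (induction m)
  case 0
  have "total_ops (Suc 0) = flow_ops T 1 n" "all_cells (Suc 0) = crossing_cells 1 n" by (simp_all add: total_ops_def all_cells_def)
  then show ?case
    using trace_flow_ops[of 1 n] n cut_first[OF n, of straight_rule] by (simp del: upt_Suc)
next
  case (Suc m)
  have a: "all_cells (Suc (Suc m)) = all_cells (Suc m) @ crossing_cells (Suc (Suc m)) n" by (simp add: all_cells_def)
  have "fold swap_at (total_ops (Suc m)) [1..<Suc n] = cut straight_rule (Suc m) n"
    using fold_total_ops_aux[OF n, of m swap_at straight_rule] Suc.prems by (simp add: swap_at_append straight_rule_def del: upt_Suc)
  moreover have "cut straight_rule (Suc (Suc m)) 0 = cut straight_rule (Suc m) n" using Suc.prems by (intro cut_next) auto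
  ultimately show ?case
    using Suc trace_flow_ops[of "Suc (Suc m)" n] unfolding total_ops_Suc[of "Suc m"] a
    by (simp add: trace_append del: upt_Suc)
qed

lemma trace_total_ops:
  assumes "n \<ge> 1"
  shows "trace (total_ops n) [1..<Suc n] = map (meeting straight_rule) (all_cells n)"
  using trace_total_ops_aux[OF assms, of "n - 1"] assms by simp

lemma distinct_all_cells: "distinct (all_cells m)"
  and set_all_cells: "set (all_cells m) = {(k, c). k \<in> {1..m} \<and> c \<in> {1..n} \<and> T k c = Crossing}"
proof -
  have "distinct (all_cells m) \<and> set (all_cells m) = {(k, c). k \<in> {1..m} \<and> c \<in> {1..n} \<and> T k c = Crossing}"
  proof (induction m)
    case (Suc m)
    have a: "all_cells (Suc m) = all_cells m @ crossing_cells (Suc m) n" by (simp add: all_cells_def)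
    have "distinct (crossing_cells (Suc m) n)"
      by (simp add: crossing_cells_def distinct_map inj_on_def del: upt_Suc)
    moreover have "set (crossing_cells (Suc m) n) = {(k, c). k = Suc m \<and> c \<in> {1..n} \<and> T k c = Crossing}"
      by (auto simp: crossing_cells_def simp del: upt_Suc)
    ultimately show ?case
      using Suc unfolding a by (auto simp: le_Suc_eq)
  qed (simp add: all_cells_def)
  then show "distinct (all_cells m)" "set (all_cells m) = {(k, c). k \<in> {1..m} \<and> c \<in> {1..n} \<and> T k c = Crossing}" by auto
qed

end

section \<open>From tilings to stacks of rows\<close>

lemma mset_sort_at: "Suc p < length xs \<Longrightarrow> mset (sort_at p xs) = mset xs"
  by (simp add: sort_at_def mset_swap_at)

lemma mset_fold_sort_at: "\<forall>p\<in>set ps. Suc p < length xs \<Longrightarrow> mset (fold sort_at ps xs) = mset xs"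
proof (induction ps arbitrary: xs)
  case (Cons p ps)
  have "length (sort_at p xs) = length xs" by (simp add: sort_at_def)
  then show ?case using Cons by (simp add: mset_sort_at)
qed simp

lemma permutes_of_mset:
  assumes "mset (map v [1..<Suc n]) = mset [1..<Suc n]" "\<And>i. i \<notin> {1..n} \<Longrightarrow> v i = i"
  shows "v permutes {1..n}"
proof (rule bij_imp_permutes)
  have s: "set [1..<Suc n] = {1..n}" by auto
  have "distinct (map v [1..<Suc n])"
    using assms(1) by (metis distinct_upt mset_eq_imp_distinct_iff)
  then have "inj_on v {1..n}" by (simp only: distinct_map s)
  moreover have "v ` {1..n} = {1..n}"
    using mset_eq_setD[OF assms(1)] by (simp only: set_map s)
  ultimately show "bij_betw v {1..n} {1..n}" by (simp add: bij_betw_def)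
qed (rule assms(2))

lemma ball_atLeastAtMost_Suc:
  "(\<forall>c\<in>{1..Suc m}. P c) \<longleftrightarrow> P (Suc m) \<and> (\<forall>c\<in>{1..m}. P c)"
proof -
  have e: "{1..Suc m} = insert (Suc m) {1..m}" by auto
  show ?thesis unfolding e by blast
qed

lemma ball_atLeastLessThan_Suc:
  "(\<forall>c\<in>{1..<Suc m}. P c) \<longleftrightarrow> (m \<noteq> 0 \<longrightarrow> P m) \<and> (\<forall>c\<in>{1..<m}. P c)"
proof -
  have e: "{1..<Suc m} = (if m = 0 then {} else insert m {1..<m})" by auto
  show ?thesis unfolding e by simp
qed

definition bpd_row :: "nat \<Rightarrow> tiling \<Rightarrow> nat \<Rightarrow> tile list" where
  "bpd_row n B r = map (\<lambda>c. B (r, c)) (rev [1..<Suc n])"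

definition bpd_rows :: "nat \<Rightarrow> tiling \<Rightarrow> nat \<Rightarrow> tile list list" where
  "bpd_rows n B m = map (bpd_row n B) (rev [1..<Suc m])"

lemma bpd_rows_Suc: "bpd_rows n B (Suc m) = bpd_row n B (Suc m) # bpd_rows n B m"
  by (simp add: bpd_rows_def)

lemma all_bpd_ops_rows: "all_bpd_ops (bpd_rows n B m) = concat (map (\<lambda>r. bpd_ops (bpd_row n B r)) [1..<Suc m])"
  by (induction m) (simp_all add: bpd_rows_Suc, simp add: bpd_rows_def)

lemma all_cobpd_ops_rows: "all_cobpd_ops (bpd_rows n B m) = concat (map (\<lambda>r. cobpd_ops (bpd_row n B r)) (rev [1..<Suc m]))"
  by (induction m) (simp_all add: bpd_rows_Suc, simp add: bpd_rows_def)

abbreviation "bpd_tiles \<equiv> {Elbow_BR, Elbow_TL, Horizontal, Vertical, Crossing, Blank}"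
abbreviation "cobpd_tiles \<equiv> {Elbow_TR, Elbow_BL, Horizontal, Vertical, Crossing, Blank}"

lemma bpd_tile_flow:
  "d \<in> bpd_tiles \<Longrightarrow> v_in d = (Bottom \<in> edges d)" "d \<in> bpd_tiles \<Longrightarrow> v_out d = (Top \<in> edges d)"
  "d \<in> bpd_tiles \<Longrightarrow> h_in d = (Left \<in> edges d)" "d \<in> bpd_tiles \<Longrightarrow> h_out d = (Right \<in> edges d)"
  by (auto simp: flow_defs)

lemma cobpd_tile_flow:
  "d \<in> cobpd_tiles \<Longrightarrow> v_in d = (Top \<in> edges d)" "d \<in> cobpd_tiles \<Longrightarrow> v_out d = (Bottom \<in> edges d)"
  "d \<in> cobpd_tiles \<Longrightarrow> h_in d = (Left \<in> edges d)" "d \<in> cobpd_tiles \<Longrightarrow> h_out d = (Right \<in> edges d)"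
  by (auto simp: flow_defs)

lemma bpd_flow:
  assumes "B \<in> bpds n"
  shows "flow (\<lambda>k c. B (n + 1 - k, c)) n"
proof -
  have t: "B (r, c) \<in> bpd_tiles" if "1 \<le> r" "r \<le> n" "1 \<le> c" "c \<le> n" for r c
    using assms that by (auto simp: bpds_def grid_def PiE_def Pi_def)
  have h: "Right \<in> edges (B (r, c)) \<longleftrightarrow> Left \<in> edges (B (r, c + 1))" if "1 \<le> r" "r \<le> n" "1 \<le> c" "c < n" for r c
    using assms that by (auto simp: bpds_def connected_tiling_def)
  have v: "Bottom \<in> edges (B (r, c)) \<longleftrightarrow> Top \<in> edges (B (r + 1, c))" if "1 \<le> r" "r < n" "1 \<le> c" "c \<le> n" for r c
    using assms that by (auto simp: bpds_def connected_tiling_def)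
  have b: "Bottom \<in> edges (B (n, c))" "Top \<notin> edges (B (1, c))" if "1 \<le> c" "c \<le> n" for c
    using assms that by (auto simp: bpds_def)
  have e: "Right \<in> edges (B (r, n))" "Left \<notin> edges (B (r, 1))" if "1 \<le> r" "r \<le> n" for r
    using assms that by (auto simp: bpds_def)
  show ?thesis
  proof
    fix k c assume *: "1 \<le> k" "k < n" "1 \<le> c" "c \<le> n"
    then have r: "1 \<le> n - k" "n - k < n" "n + 1 - k = n - k + 1" "n + 1 - Suc k = n - k" by auto
    have "v_in (B (n - k, c)) = (Bottom \<in> edges (B (n - k, c)))"
      by (rule bpd_tile_flow(1), rule t) (use * r in auto)
    moreover have "v_out (B (n - k + 1, c)) = (Top \<in> edges (B (n - k + 1, c)))"
      by (rule bpd_tile_flow(2), rule t) (use * r in auto)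
    ultimately show "v_in (B (n + 1 - Suc k, c)) = v_out (B (n + 1 - k, c))"
      using v[of "n - k" c] * r by simp
  next
    fix c assume *: "1 \<le> c" "c \<le> n"
    show "v_in (B (n + 1 - 1, c))" using b[of c] bpd_tile_flow(1)[OF t[of n c]] * by simp
    show "\<not> v_out (B (n + 1 - n, c))" using b[of c] bpd_tile_flow(2)[OF t[of 1 c]] * by simp
  next
    fix k c assume *: "1 \<le> k" "k \<le> n" "1 \<le> c" "c < n"
    then have r: "1 \<le> n + 1 - k" "n + 1 - k \<le> n" by auto
    show "h_in (B (n + 1 - k, Suc c)) = h_out (B (n + 1 - k, c))"
      using h[of "n + 1 - k" c] bpd_tile_flow(3)[OF t[of "n + 1 - k" "Suc c"]] bpd_tile_flow(4)[OF t[of "n + 1 - k" c]] * r by simp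
  next
    fix k assume *: "1 \<le> k" "k \<le> n"
    then have r: "1 \<le> n + 1 - k" "n + 1 - k \<le> n" "1 \<le> n" by auto
    show "\<not> h_in (B (n + 1 - k, 1))" using e[of "n + 1 - k"] bpd_tile_flow(3)[OF t[of "n + 1 - k" 1]] r by simp
    show "h_out (B (n + 1 - k, n))" using e[of "n + 1 - k"] bpd_tile_flow(4)[OF t[of "n + 1 - k" n]] r by simp
  qed
qed

lemma cobpd_flow:
  assumes "D \<in> cobpds n"
  shows "flow (\<lambda>k c. D (k, c)) n"
proof -
  have t: "D (r, c) \<in> cobpd_tiles" if "1 \<le> r" "r \<le> n" "1 \<le> c" "c \<le> n" for r c
    using assms that by (auto simp: cobpds_def grid_def PiE_def Pi_def)
  have h: "Right \<in> edges (D (r, c)) \<longleftrightarrow> Left \<in> edges (D (r, c + 1))" if "1 \<le> r" "r \<le> n" "1 \<le> c" "c < n" for r c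
    using assms that by (auto simp: cobpds_def connected_tiling_def)
  have v: "Bottom \<in> edges (D (r, c)) \<longleftrightarrow> Top \<in> edges (D (r + 1, c))" if "1 \<le> r" "r < n" "1 \<le> c" "c \<le> n" for r c
    using assms that by (auto simp: cobpds_def connected_tiling_def)
  have b: "Top \<in> edges (D (1, c))" "Bottom \<notin> edges (D (n, c))" if "1 \<le> c" "c \<le> n" for c
    using assms that by (auto simp: cobpds_def)
  have e: "Right \<in> edges (D (r, n))" "Left \<notin> edges (D (r, 1))" if "1 \<le> r" "r \<le> n" for r
    using assms that by (auto simp: cobpds_def)
  show ?thesis
  proof
    fix k c assume *: "1 \<le> k" "k < n" "1 \<le> c" "c \<le> n"
    show "v_in (D (Suc k, c)) = v_out (D (k, c))"
      using v[of k c] cobpd_tile_flow(1)[OF t[of "Suc k" c]] cobpd_tile_flow(2)[OF t[of k c]] * by simp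
  next
    fix c assume *: "1 \<le> c" "c \<le> n"
    show "v_in (D (1, c))" using b[of c] cobpd_tile_flow(1)[OF t[of 1 c]] * by simp
    show "\<not> v_out (D (n, c))" using b[of c] cobpd_tile_flow(2)[OF t[of n c]] * by simp
  next
    fix k c assume *: "1 \<le> k" "k \<le> n" "1 \<le> c" "c < n"
    show "h_in (D (k, Suc c)) = h_out (D (k, c))"
      using h[of k c] cobpd_tile_flow(3)[OF t[of k "Suc c"]] cobpd_tile_flow(4)[OF t[of k c]] * by simp
  next
    fix k assume *: "1 \<le> k" "k \<le> n"
    show "\<not> h_in (D (k, 1))" using e[of k] cobpd_tile_flow(3)[OF t[of k 1]] * by simp
    show "h_out (D (k, n))" using e[of k] cobpd_tile_flow(4)[OF t[of k n]] * by simp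
  qed
qed

section \<open>Crossings of a tiling compared with the operations of its rows\<close>

lemma crossing_ops_cong:
  "\<forall>d\<in>set ts. P d = P' (f d) \<and> Q d = Q' (f d) \<Longrightarrow> crossing_ops P Q ts = crossing_ops P' Q' (map f ts)"
proof (induction ts)
  case (Cons d ts)
  have "length (filter Q ts) = length (filter Q' (map f ts))"
    using Cons.prems by (induction ts) auto
  then show ?case using Cons by simp
qed simp

text \<open>The flow meets the crossings row by row upwards and from left to right; the stack lists
  them from the exits backwards. The co-BPD shows the same reversal.\<close>

lemma total_ops_bpd:
  assumes "B \<in> bpds n"
  shows "flow.total_ops (\<lambda>k c. B (n + 1 - k, c)) n n = rev (all_bpd_ops (bpd_rows n B n))"
proof -
  interpret flow "\<lambda>k c. B (n + 1 - k, c)" n by (rule bpd_flow[OF assms])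
  have "flow_ops (\<lambda>k c. B (n + 1 - k, c)) k n = rev (bpd_ops (bpd_row n B (n + 1 - k)))" if "k \<in> set [1..<Suc n]" for k
  proof -
    have "n + 1 - k \<in> {1..n}" using that by (auto simp del: upt_Suc)
    then have "\<forall>d\<in>set (bpd_row n B (n + 1 - k)). d \<in> bpd_tiles"
      using assms by (auto simp: bpd_row_def bpds_def grid_def PiE_def Pi_def simp del: upt_Suc)
    then have "\<forall>d\<in>set (bpd_row n B (n + 1 - k)). (d = Crossing) = (d = Crossing) \<and> has_top d = v_out d"
      using bpd_tile_flow(2) by blast
    from crossing_ops_cong[where f = "\<lambda>d. d", OF this] show ?thesis
      by (simp add: bpd_row_def comp_def del: upt_Suc)
  qed
  then have "total_ops n = concat (map (\<lambda>k. rev (bpd_ops (bpd_row n B (n + 1 - k)))) [1..<Suc n])"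
    unfolding total_ops_def by (intro arg_cong[of _ _ concat] map_cong refl)
  also have "map (\<lambda>k. rev (bpd_ops (bpd_row n B (n + 1 - k)))) [1..<Suc n]
      = map (\<lambda>r. rev (bpd_ops (bpd_row n B r))) (rev [1..<Suc n])"
    by (intro nth_equalityI) (auto simp: rev_nth Suc_diff_Suc simp del: upt_Suc)
  also have "concat \<dots> = rev (all_bpd_ops (bpd_rows n B n))"
    unfolding all_bpd_ops_rows by (simp add: rev_concat rev_map comp_def del: upt_Suc)
  finally show ?thesis .
qed

lemma check_bpd_nth: "r \<in> {1..n} \<Longrightarrow> c \<in> {1..n} \<Longrightarrow> check_bpd n B (r, c) = check_tile (B (r, c))"
  by (simp add: check_bpd_def grid_def)

lemma total_ops_check_bpd:
  assumes "B \<in> bpds n"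
  shows "flow.total_ops (\<lambda>k c. check_bpd n B (k, c)) n n = rev (all_cobpd_ops (bpd_rows n B n))"
proof -
  interpret flow "\<lambda>k c. check_bpd n B (k, c)" n by (rule cobpd_flow[OF check_bpd_in_cobpds[OF assms]])
  have "flow_ops (\<lambda>k c. check_bpd n B (k, c)) k n = rev (cobpd_ops (bpd_row n B k))" if k: "k \<in> set [1..<Suc n]" for k
  proof -
    have "\<forall>d\<in>set (bpd_row n B k). d \<in> bpd_tiles"
      using assms that by (auto simp: bpd_row_def bpds_def grid_def PiE_def Pi_def simp del: upt_Suc)
    moreover have "d \<in> bpd_tiles \<Longrightarrow> (d = Horizontal) = (check_tile d = Crossing) \<and> no_bottom d = v_out (check_tile d)" for d
      by (auto simp: flow_defs)
    ultimately have "\<forall>d\<in>set (bpd_row n B k). (d = Horizontal) = (check_tile d = Crossing) \<and> no_bottom d = v_out (check_tile d)"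
      by blast
    from crossing_ops_cong[where f = check_tile and P' = "\<lambda>d. d = Crossing" and Q' = v_out, OF this]
    have "cobpd_ops (bpd_row n B k) = crossing_ops (\<lambda>d. d = Crossing) v_out (map check_tile (bpd_row n B k))" .
    also have "map check_tile (bpd_row n B k) = map (\<lambda>c. check_bpd n B (k, c)) (rev [1..<Suc n])"
      using k by (auto simp: bpd_row_def check_bpd_nth simp del: upt_Suc)
    finally show ?thesis by simp
  qed
  then have "total_ops n = concat (map (\<lambda>k. rev (cobpd_ops (bpd_row n B k))) [1..<Suc n])"
    unfolding total_ops_def by (intro arg_cong[of _ _ concat] map_cong refl)
  also have "\<dots> = rev (all_cobpd_ops (bpd_rows n B n))"
    unfolding all_cobpd_ops_rows by (simp add: rev_concat rev_map comp_def del: upt_Suc)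
  finally show ?thesis .
qed

lemma sort_at_sort_rule: "p = length A \<Longrightarrow> sort_at p (A @ h # v # C) = A @ fst (sort_rule v h) # snd (sort_rule v h) # C"
  by (simp add: sort_at_append sort_rule_def max_def min_def)

lemma bpd_perm_list:
  assumes "n \<ge> 1" "B \<in> bpds n"
  shows "map (bpd_perm n B) [1..<Suc n] = fold sort_at (rev (all_bpd_ops (bpd_rows n B n))) [1..<Suc n]"
    and "\<forall>p\<in>set (all_bpd_ops (bpd_rows n B n)). Suc p < n"
proof -
  interpret flow "\<lambda>k c. B (n + 1 - k, c)" n by (rule bpd_flow[OF assms(2)])
  note f = fold_total_ops[OF assms(1), of sort_at sort_rule, OF sort_at_sort_rule, unfolded total_ops_bpd[OF assms(2)]]
  have "map (bpd_perm n B) [1..<Suc n] = exits sort_rule n"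
    unfolding exits_def by (intro nth_equalityI) (auto simp: bpd_perm_def rev_nth Suc_diff_Suc simp del: upt_Suc)
  then show "map (bpd_perm n B) [1..<Suc n] = fold sort_at (rev (all_bpd_ops (bpd_rows n B n))) [1..<Suc n]"
    using f(1) by simp
  show "\<forall>p\<in>set (all_bpd_ops (bpd_rows n B n)). Suc p < n"
    using f(2) by simp
qed

lemma bpd_perm_permutes:
  assumes "n \<ge> 1" "B \<in> bpds n"
  shows "bpd_perm n B permutes {1..n}"
proof (rule permutes_of_mset)
  show "mset (map (bpd_perm n B) [1..<Suc n]) = mset [1..<Suc n]"
    unfolding bpd_perm_list(1)[OF assms]
    by (rule mset_fold_sort_at) (use bpd_perm_list(2)[OF assms] in \<open>simp del: upt_Suc\<close>)
qed (auto simp: bpd_perm_def)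

lemma cobpd_perm_list:
  assumes "n \<ge> 1" "B \<in> bpds n"
  shows "map (cobpd_perm n (check_bpd n B)) (rev [1..<Suc n]) = fold sort_at (rev (all_cobpd_ops (bpd_rows n B n))) [1..<Suc n]"
    and "\<forall>p\<in>set (all_cobpd_ops (bpd_rows n B n)). Suc p < n"
proof -
  interpret flow "\<lambda>k c. check_bpd n B (k, c)" n by (rule cobpd_flow[OF check_bpd_in_cobpds[OF assms(2)]])
  note f = fold_total_ops[OF assms(1), of sort_at sort_rule, OF sort_at_sort_rule, unfolded total_ops_check_bpd[OF assms(2)]]
  have "map (cobpd_perm n (check_bpd n B)) (rev [1..<Suc n]) = exits sort_rule n"
    unfolding exits_def by (intro map_cong refl) (auto simp: cobpd_perm_def simp del: upt_Suc)
  then show "map (cobpd_perm n (check_bpd n B)) (rev [1..<Suc n]) = fold sort_at (rev (all_cobpd_ops (bpd_rows n B n))) [1..<Suc n]"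
    using f(1) by simp
  show "\<forall>p\<in>set (all_cobpd_ops (bpd_rows n B n)). Suc p < n"
    using f(2) by simp
qed

lemma cobpd_perm_permutes:
  assumes "n \<ge> 1" "B \<in> bpds n"
  shows "cobpd_perm n (check_bpd n B) permutes {1..n}"
proof (rule permutes_of_mset)
  have "mset (map (cobpd_perm n (check_bpd n B)) (rev [1..<Suc n])) = mset [1..<Suc n]"
    unfolding cobpd_perm_list(1)[OF assms]
    by (rule mset_fold_sort_at) (use cobpd_perm_list(2)[OF assms] in \<open>simp del: upt_Suc\<close>)
  then show "mset (map (cobpd_perm n (check_bpd n B)) [1..<Suc n]) = mset [1..<Suc n]"
    by (simp only: mset_map mset_rev)
qed (auto simp: cobpd_perm_def)

lemma trace_pair:
  assumes "\<forall>p\<in>set ps. Suc p < length xs" "distinct xs" "P \<in> set (trace ps xs)"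
  shows "\<exists>a b. a \<noteq> b \<and> a \<in> set xs \<and> b \<in> set xs \<and> P = {a, b}"
  using assms
proof (induction ps arbitrary: xs)
  case (Cons p ps)
  have p: "Suc p < length xs" using Cons.prems by simp
  show ?case
  proof (cases "P = {xs ! p, xs ! Suc p}")
    case True
    moreover have "xs ! p \<noteq> xs ! Suc p" "xs ! p \<in> set xs" "xs ! Suc p \<in> set xs"
      using Cons.prems(2) p by (simp_all add: nth_eq_iff_index_eq)
    ultimately show ?thesis by blast
  next
    case False
    have "distinct (swap_at p xs)" "set (swap_at p xs) = set xs"
      using mset_swap_at[OF p] Cons.prems(2) by (metis mset_eq_imp_distinct_iff, metis mset_eq_setD)
    then show ?thesis using Cons.IH[of "swap_at p xs"] Cons.prems False by auto
  qed
qed simp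

text \<open>The trace lists, crossing by crossing, the two straight pipes that meet there, so a
  repeated entry means that two pipes cross twice.\<close>

lemma reduced_check_bpd:
  assumes n: "n \<ge> 1" and B: "B \<in> bpds n"
  shows "reduced_cobpd n (check_bpd n B) \<longleftrightarrow> distinct (trace (rev (all_cobpd_ops (bpd_rows n B n))) [1..<Suc n])"
proof -
  let ?D = "check_bpd n B"
  have D: "?D \<in> cobpds n" by (rule check_bpd_in_cobpds[OF B])
  interpret flow "\<lambda>k c. ?D (k, c)" n by (rule cobpd_flow[OF D])
  let ?m = "meeting straight_rule" and ?ps = "rev (all_cobpd_ops (bpd_rows n B n))"
  have tr: "trace ?ps [1..<Suc n] = map ?m (all_cells n)"
    using trace_total_ops[OF n] unfolding total_ops_check_bpd[OF B] .
  have cr: "cobpd_crossings n ?D a b = {x \<in> set (all_cells n). ?m x = {a, b}}" for a b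
    by (auto simp: cobpd_crossings_def set_all_cells grid_def meeting_def insert_commute)
  \<comment> \<open>Every crossing involves two distinct labels in \<open>1..n\<close>, hence is
    covered by the quantifiers over \<open>a\<close> and \<open>b\<close>.\<close>
  have pair: "\<exists>a b. a \<noteq> b \<and> a \<in> {1..n} \<and> b \<in> {1..n} \<and> ?m x = {a, b}" if "x \<in> set (all_cells n)" for x
  proof -
    have "?m x \<in> set (trace ?ps [1..<Suc n])" unfolding tr using that by simp
    moreover have "\<forall>p\<in>set ?ps. Suc p < length [1..<Suc n]"
      using cobpd_perm_list(2)[OF n B] by (simp del: upt_Suc)
    ultimately have "\<exists>a b. a \<noteq> b \<and> a \<in> set [1..<Suc n] \<and> b \<in> set [1..<Suc n] \<and> ?m x = {a, b}"
      using trace_pair[of ?ps "[1..<Suc n]" "?m x"] distinct_upt by blast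
    moreover have "set [1..<Suc n] = {1..n}" by auto
    ultimately show ?thesis by (simp only:)
  qed
  have "distinct (trace ?ps [1..<Suc n]) \<longleftrightarrow> inj_on ?m (set (all_cells n))"
    unfolding tr by (simp add: distinct_map distinct_all_cells)
  also have "\<dots> \<longleftrightarrow> (\<forall>a\<in>{1..n}. \<forall>b\<in>{1..n}. a \<noteq> b \<longrightarrow> card (cobpd_crossings n ?D a b) \<le> 1)"
  proof
    assume inj: "inj_on ?m (set (all_cells n))"
    show "\<forall>a\<in>{1..n}. \<forall>b\<in>{1..n}. a \<noteq> b \<longrightarrow> card (cobpd_crossings n ?D a b) \<le> 1"
    proof (intro ballI impI)
      fix a b
      have "finite (cobpd_crossings n ?D a b)" unfolding cr by simp
      moreover have "x = y" if "x \<in> cobpd_crossings n ?D a b" "y \<in> cobpd_crossings n ?D a b" for x y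
        using that inj unfolding cr by (auto dest: inj_onD)
      ultimately show "card (cobpd_crossings n ?D a b) \<le> 1"
        by (simp add: card_le_Suc0_iff_eq)
    qed
  next
    assume c: "\<forall>a\<in>{1..n}. \<forall>b\<in>{1..n}. a \<noteq> b \<longrightarrow> card (cobpd_crossings n ?D a b) \<le> 1"
    show "inj_on ?m (set (all_cells n))"
    proof (rule inj_onI)
      fix x y assume xy: "x \<in> set (all_cells n)" "y \<in> set (all_cells n)" "?m x = ?m y"
      obtain a b where ab: "a \<noteq> b" "a \<in> {1..n}" "b \<in> {1..n}" "?m x = {a, b}" using pair[OF xy(1)] by blast
      then have "card (cobpd_crossings n ?D a b) \<le> 1" using c by blast
      moreover have "finite (cobpd_crossings n ?D a b)" unfolding cr by simp
      moreover have "x \<in> cobpd_crossings n ?D a b" "y \<in> cobpd_crossings n ?D a b"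
        unfolding cr using xy ab by auto
      ultimately show "x = y" by (simp add: card_le_Suc0_iff_eq)
    qed
  qed
  finally show ?thesis using D by (simp add: reduced_cobpd_def)
qed

section \<open>Tilings as stacks of rows\<close>

lemma row_shape_map:
  "row_shape (map f (rev [1..<Suc m])) h \<longleftrightarrow> (\<forall>c\<in>{1..m}. f c \<in> bpd_tiles)
     \<and> (if m = 0 then \<not> h else (Right \<in> edges (f m) \<longleftrightarrow> h) \<and> Left \<notin> edges (f 1))
     \<and> (\<forall>c\<in>{1..<m}. Right \<in> edges (f c) \<longleftrightarrow> Left \<in> edges (f (Suc c)))"
proof (induction m arbitrary: h)
  case (Suc m)
  note a = ball_atLeastAtMost_Suc and b = ball_atLeastLessThan_Suc
  have "rev [1..<Suc (Suc m)] = Suc m # rev [1..<Suc m]" by simp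
  then have "row_shape (map f (rev [1..<Suc (Suc m)])) h \<longleftrightarrow> f (Suc m) \<in> bpd_tiles \<and> (Right \<in> edges (f (Suc m)) \<longleftrightarrow> h)
     \<and> row_shape (map f (rev [1..<Suc m])) (Left \<in> edges (f (Suc m)))"
    by (simp only: list.map row_shape.simps)
  then show ?case
    unfolding Suc.IH a b by (cases "m = 0") auto
qed simp

lemma rows_shape_bpd_rows:
  "rows_shape n (bpd_rows n B m) \<longleftrightarrow> (\<forall>r\<in>{1..m}. row_shape (bpd_row n B r) True)
     \<and> (m \<noteq> 0 \<longrightarrow> (\<forall>c\<in>{1..n}. Top \<notin> edges (B (1, c))))
     \<and> (\<forall>r\<in>{1..<m}. \<forall>c\<in>{1..n}. Bottom \<in> edges (B (r, c)) \<longleftrightarrow> Top \<in> edges (B (Suc r, c)))"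
proof (induction m)
  case 0
  show ?case by (simp add: bpd_rows_def)
next
  case (Suc m)
  note a = ball_atLeastAtMost_Suc and b = ball_atLeastLessThan_Suc
  have eq: "map has_top (bpd_row n B (Suc m)) = bottoms n (bpd_rows n B m) \<longleftrightarrow>
     (if m = 0 then \<forall>c\<in>{1..n}. Top \<notin> edges (B (1, c)) else \<forall>c\<in>{1..n}. Bottom \<in> edges (B (m, c)) \<longleftrightarrow> Top \<in> edges (B (Suc m, c)))"
  proof (cases m)
    case 0
    have "replicate n False = map (\<lambda>c. False) (rev [1..<Suc n])"
      by (simp add: map_replicate_const del: upt_Suc)
    then show ?thesis
      using 0 by (auto simp: bpd_rows_def bpd_row_def simp del: upt_Suc)
  next
    case (Suc m')
    then show ?thesis
      by (auto simp: bpd_rows_Suc bpd_row_def simp del: upt_Suc)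
  qed
  have "length (bpd_row n B (Suc m)) = n" by (simp add: bpd_row_def del: upt_Suc)
  then show ?case
    unfolding bpd_rows_Suc rows_shape.simps Suc.IH eq a b by auto
qed

text \<open>\<open>rows_shape\<close> does not mention the bottom of the grid. Each row releases one
  pipe to the right, so \<open>n\<close> pipes enter at the bottom and every one of the
  \<open>n\<close> columns is used.\<close>

lemma bpds_iff_rows_shape:
  assumes "n \<ge> 1" and ext: "B \<in> extensional (grid n)"
  shows "B \<in> bpds n \<longleftrightarrow> rows_shape n (bpd_rows n B n)"
proof
  assume "B \<in> bpds n"
  then show "rows_shape n (bpd_rows n B n)"
    unfolding rows_shape_bpd_rows bpd_row_def row_shape_map
    by (auto simp: bpds_def connected_tiling_def grid_def PiE_def Pi_def)
next
  assume sh: "rows_shape n (bpd_rows n B n)"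
  have len: "length (bpd_rows n B n) = n" by (simp add: bpd_rows_def del: upt_Suc)
  have "length (filter (\<lambda>h. h) (bottoms n (bpd_rows n B n))) = length (bottoms n (bpd_rows n B n))"
    using bottoms_count[OF sh] len by simp
  then have all: "\<forall>h\<in>set (bottoms n (bpd_rows n B n)). h"
    by (metis filter_id_conv length_filter_less less_irrefl)
  obtain n' where n': "n = Suc n'" using assms by (cases n) auto
  have "bottoms n (bpd_rows n B n) = map (\<lambda>d. Bottom \<in> edges d) (bpd_row n B n)"
    unfolding n' by (simp add: bpd_rows_Suc)
  then have bot: "Bottom \<in> edges (B (n, c))" if "c \<in> {1..n}" for c
    using all that by (auto simp: bpd_row_def simp del: upt_Suc)
  from sh[unfolded rows_shape_bpd_rows bpd_row_def row_shape_map]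
  show "B \<in> bpds n"
    using bot ext assms(1) by (auto simp: bpds_def connected_tiling_def grid_def PiE_def Pi_def)
qed

lemma bpd_rows_nth: "r \<in> {1..n} \<Longrightarrow> c \<in> {1..n} \<Longrightarrow> bpd_rows n B n ! (n - r) ! (n - c) = B (r, c)"
  by (auto simp: bpd_rows_def bpd_row_def rev_nth simp del: upt_Suc)

lemma inj_bpd_rows: "inj_on (\<lambda>B. bpd_rows n B n) (bpds n)"
proof (rule inj_onI)
  fix B C assume BC: "B \<in> bpds n" "C \<in> bpds n" "bpd_rows n B n = bpd_rows n C n"
  show "B = C"
  proof (rule extensionalityI[of _ "grid n"])
    show "B \<in> extensional (grid n)" "C \<in> extensional (grid n)"
      using BC by (auto simp: bpds_def PiE_def)
    fix x assume "x \<in> grid n"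
    then obtain r c where "x = (r, c)" "r \<in> {1..n}" "c \<in> {1..n}" by (auto simp: grid_def)
    then show "B x = C x" using bpd_rows_nth[of r n c B] bpd_rows_nth[of r n c C] BC(3) by simp
  qed
qed

lemma rows_shape_lengths: "rows_shape n T \<Longrightarrow> \<forall>ts\<in>set T. length ts = n"
  by (induction T) auto

lemma ex_bpd_rows:
  assumes "length T = n" "rows_shape n T"
  obtains B where "B \<in> extensional (grid n)" "bpd_rows n B n = T"
proof
  let ?B = "restrict (\<lambda>(r, c). T ! (n - r) ! (n - c)) (grid n)"
  show "?B \<in> extensional (grid n)" by simp
  show "bpd_rows n ?B n = T"
  proof (rule nth_equalityI)
    show "length (bpd_rows n ?B n) = length T" using assms by (simp add: bpd_rows_def del: upt_Suc)
    fix i assume "i < length (bpd_rows n ?B n)"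
    then have i: "i < n" by (simp add: bpd_rows_def del: upt_Suc)
    then have "length (T ! i) = n" using rows_shape_lengths[OF assms(2)] assms(1) by simp
    then show "bpd_rows n ?B n ! i = T ! i"
      using i by (intro nth_equalityI) (auto simp: bpd_rows_def bpd_row_def rev_nth grid_def simp del: upt_Suc)
  qed
qed

lemma good_rows_column_word:
  assumes n: "n \<ge> 1" and w: "w permutes {1..n}"
  shows "good_rows n (column_word n w) = (\<lambda>B. bpd_rows n B n) ` {B \<in> bpds_of n w. reduced_cobpd n (check_bpd n B)}"
proof -
  have len: "length (bpd_rows n B n) = n" for B by (simp add: bpd_rows_def del: upt_Suc)
  have rw: "rev (column_word n w) = map (inv w) [1..<Suc n]"
    by (simp add: column_word_def rev_map[symmetric] del: upt_Suc)
  have good: "bpd_rows n B n \<in> good_rows n (column_word n w) \<longleftrightarrow> bpd_perm n B = w \<and> reduced_cobpd n (check_bpd n B)"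
    if B: "B \<in> bpds n" for B
  proof -
    have "rows_shape n (bpd_rows n B n)"
      using bpds_iff_rows_shape[OF n, of B] B by (auto simp: bpds_def PiE_def)
    moreover have "fold sort_at (all_bpd_ops (bpd_rows n B n)) [1..<Suc n] = rev (column_word n w) \<longleftrightarrow> bpd_perm n B = w"
      unfolding rw fold_sort_at_rev[OF bpd_perm_list(2)[OF n B] w, symmetric] bpd_perm_list(1)[OF n B, symmetric]
      by (rule permutes_eq_iff_map[OF bpd_perm_permutes[OF n B] w])
    moreover have "descending (all_cobpd_ops (bpd_rows n B n)) (rev [1..<Suc n]) \<longleftrightarrow> reduced_cobpd n (check_bpd n B)"
      unfolding reduced_check_bpd[OF n B]
      using descending_rev_iff_distinct_trace[of "rev (all_cobpd_ops (bpd_rows n B n))" n] cobpd_perm_list(2)[OF n B]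
      by simp
    ultimately show ?thesis by (simp add: good_rows_def len del: upt_Suc)
  qed
  show ?thesis
  proof (intro set_eqI iffI)
    fix T assume T: "T \<in> good_rows n (column_word n w)"
    then obtain B where B: "B \<in> extensional (grid n)" "bpd_rows n B n = T"
      using ex_bpd_rows[of T n] by (auto simp: good_rows_def)
    then have "B \<in> bpds n" using T bpds_iff_rows_shape[OF n B(1)] by (simp add: good_rows_def)
    then show "T \<in> (\<lambda>B. bpd_rows n B n) ` {B \<in> bpds_of n w. reduced_cobpd n (check_bpd n B)}"
      using good T B(2) by (auto simp: bpds_of_def)
  qed (use good in \<open>auto simp: bpds_of_def\<close>)
qed

text \<open>In a reduced co-BPD each crossing exchanges an ascending pair, so sorting is plain
  swapping and \<open>cobpd_perm\<close> follows the actual pipes.\<close>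

lemma cobpd_column_word:
  assumes n: "n \<ge> 1" and B: "B \<in> bpds n" and red: "reduced_cobpd n (check_bpd n B)"
  shows "rev (fold swap_at (all_cobpd_ops (bpd_rows n B n)) (rev [1..<Suc n])) = column_word n (cobpd_perm n (check_bpd n B))"
proof -
  let ?ps = "rev (all_cobpd_ops (bpd_rows n B n))" and ?v = "cobpd_perm n (check_bpd n B)"
  have ps: "\<forall>p\<in>set ?ps. Suc p < n" using cobpd_perm_list(2)[OF n B] by simp
  have "ascending ?ps [1..<Suc n]"
    using red unfolding reduced_check_bpd[OF n B] ascending_iff_distinct_trace[OF ps] .
  then have "fold swap_at ?ps [1..<Suc n] = map ?v (rev [1..<Suc n])"
    unfolding cobpd_perm_list(1)[OF n B] by (simp only: ascending_imp_fold_sort_at)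
  from fold_swap_at_column_word[OF ps cobpd_perm_permutes[OF n B] this]
  show ?thesis by (simp add: column_word_def rev_map del: upt_Suc)
qed

section \<open>Signs and Coxeter length\<close>

lemma sign_word: "sign (foldr (\<circ>) (map simple_transp is) id) = (- 1) ^ length is \<and> permutation (foldr (\<circ>) (map simple_transp is) id)"
proof (induction "is")
  case Nil
  have "foldr (\<circ>) (map simple_transp []) id = (id :: nat \<Rightarrow> nat)" by simp
  then show ?case by (metis list.size(3) permutation_id power_0 sign_id)
next
  case (Cons i js)
  let ?w = "foldr (\<circ>) (map simple_transp js) id"
  have e: "foldr (\<circ>) (map simple_transp (i # js)) id = simple_transp i \<circ> ?w" by simp
  have p: "permutation (simple_transp i)" by (simp add: simple_transp_def permutation_swap_id)
  have s: "sign (simple_transp i) = - 1" by (simp add: simple_transp_def sign_swap_id)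
  have "sign (simple_transp i \<circ> ?w) = sign (simple_transp i) * sign ?w"
    by (rule sign_compose[OF p Cons.IH[THEN conjunct2]])
  moreover have "permutation (simple_transp i \<circ> ?w)"
    by (rule permutation_compose[OF p Cons.IH[THEN conjunct2]])
  moreover have "sign (simple_transp i) * sign ?w = (- 1) ^ length (i # js)"
    unfolding s Cons.IH[THEN conjunct1] by simp
  ultimately show ?case unfolding e by (simp only: simp_thms)
qed

text \<open>\<open>ascent_induct\<close> provides words to be multiplied onto \<open>w_0\<close>.
  Its instance for the identity yields, by reversal, a word for \<open>w_0\<close> itself.\<close>

lemma ex_word:
  assumes "w permutes {1..n}"
  shows "\<exists>is. set is \<subseteq> {1..<n} \<and> w = foldr (\<circ>) (map simple_transp is) id"
proof -
  let ?W = "\<lambda>is. foldr (\<circ>) (map simple_transp is) id"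
  have app: "?W (is @ js) = ?W is \<circ> ?W js" for "is" js
    by (induction "is") (simp_all add: comp_assoc)
  have one: "?W [i] = simple_transp i" for i by (simp add: fun_eq_iff)
  have inv: "?W (rev is) \<circ> ?W is = id" for "is"
  proof (induction "is")
    case (Cons i js)
    have "?W (rev (i # js)) \<circ> ?W (i # js) = ?W (rev js) \<circ> (simple_transp i \<circ> simple_transp i) \<circ> ?W js"
      by (simp only: rev.simps app one) (simp add: comp_assoc)
    also have "simple_transp i \<circ> simple_transp i = id" by (simp add: fun_eq_iff simple_transp_def)
    finally show ?case using Cons by simp
  qed (simp add: fun_eq_iff)
  have ex: "\<exists>is. set is \<subseteq> {1..<n} \<and> v = longest_perm n \<circ> ?W is" if "v permutes {1..n}" for v
    using that
  proof (induction rule: ascent_induct)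
    case longest
    show ?case by (rule exI[of _ "[]"]) (simp add: fun_eq_iff)
  next
    case (ascent v i)
    then obtain "is" where "set is \<subseteq> {1..<n}" "v = longest_perm n \<circ> ?W is" by blast
    then have "set (is @ [i]) \<subseteq> {1..<n} \<and> v \<circ> simple_transp i = longest_perm n \<circ> ?W (is @ [i])"
      using ascent(2) by (simp add: app one comp_assoc del: foldr_append map_append)
    then show ?case by blast
  qed
  obtain is0 where is0: "set is0 \<subseteq> {1..<n}" "id = longest_perm n \<circ> ?W is0" using ex[OF permutes_id] by blast
  obtain is1 where is1: "set is1 \<subseteq> {1..<n}" "w = longest_perm n \<circ> ?W is1" using ex[OF assms] by blast
  have "longest_perm n \<circ> ?W is0 \<circ> ?W (rev is0) = ?W (rev is0)" using is0(2) by simp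
  moreover have "?W is0 \<circ> ?W (rev is0) = id" using inv[of "rev is0"] by simp
  ultimately have "longest_perm n = ?W (rev is0)" by (metis comp_assoc comp_id)
  then have "w = ?W (rev is0 @ is1)" using is1(2) app by metis
  then show ?thesis using is0(1) is1(1) by (intro exI[of _ "rev is0 @ is1"]) auto
qed

lemma sign_coxeter_length:
  assumes "w permutes {1..n}"
  shows "(- 1) ^ coxeter_length n w = sign w"
proof -
  let ?P = "\<lambda>k. \<exists>is. length is = k \<and> set is \<subseteq> {1..<n} \<and> w = foldr (\<circ>) (map simple_transp is) id"
  have "\<exists>k. ?P k" using ex_word[OF assms] by blast
  then have "?P (coxeter_length n w)" unfolding coxeter_length_def by (rule LeastI_ex)
  then show ?thesis using sign_word by metis
qed

text \<open>The absolute value keeps the exponent natural and does not change its parity.\<close>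

lemma sign_length_difference:
  assumes "v permutes {1..n}" "w permutes {1..n}"
  shows "(- 1) ^ nat \<bar>int (coxeter_length n v) - int (coxeter_length n w)\<bar> = sign v * sign w"
proof -
  have "even (nat \<bar>int a - int b\<bar>) \<longleftrightarrow> even (a + b)" for a b :: nat
    by (simp add: even_nat_iff)
  then have "(- 1 :: int) ^ nat \<bar>int a - int b\<bar> = (- 1) ^ (a + b)" for a b :: nat
    by (simp add: uminus_power_if)
  then show ?thesis
    by (simp add: power_add sign_coxeter_length[OF assms(1)] sign_coxeter_length[OF assms(2)])
qed

theorem theorem1p1:
  fixes n :: nat and w :: "nat \<Rightarrow> nat"
  assumes "n \<ge> 1" and "w permutes {1..n}"
  shows "grothendieck n w =
    (\<Sum>B\<in>{B \<in> bpds_of n w. reduced_cobpd n (check_bpd n B)}.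
       (-1) ^ nat \<bar>int (coxeter_length n (cobpd_perm n (check_bpd n B))) - int (coxeter_length n w)\<bar>
       * schubert n (cobpd_perm n (check_bpd n B)))"
proof -
  let ?S = "{B \<in> bpds_of n w. reduced_cobpd n (check_bpd n B)}"
  let ?v = "\<lambda>B. cobpd_perm n (check_bpd n B)"
  have S: "B \<in> bpds n" "reduced_cobpd n (check_bpd n B)" if "B \<in> ?S" for B
    using that by (auto simp: bpds_of_def)
  have arr: "column_word n w \<in> arrangements {1..n}"
  proof -
    have "labels n n = {1..n}" by auto
    then show ?thesis using column_word_arrangements[OF assms(2)] by simp
  qed
  have inj: "inj_on (\<lambda>B. bpd_rows n B n) ?S"
    by (rule inj_on_subset[OF inj_bpd_rows]) (auto simp: bpds_of_def)
  have "weight n var n n (column_word n w) =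
      (\<Sum>B\<in>?S. weight n var 0 n (rev (fold swap_at (all_cobpd_ops (bpd_rows n B n)) (rev [1..<Suc n]))))"
    unfolding weight_good_rows[OF arr] good_rows_column_word[OF assms] by (simp only: sum.reindex[OF inj] comp_def)
  also have "\<dots> = (\<Sum>B\<in>?S. weight n var 0 n (column_word n (?v B)))"
    by (intro sum.cong refl) (simp only: cobpd_column_word[OF assms(1) S])
  finally have W: "weight n var n n (column_word n w) = (\<Sum>B\<in>?S. weight n var 0 n (column_word n (?v B)))" .
  have summand: "of_int (normalization n * sign w) * weight n var 0 n (column_word n (?v B))
     = (-1) ^ nat \<bar>int (coxeter_length n (?v B)) - int (coxeter_length n w)\<bar> * schubert n (?v B)" if B: "B \<in> ?S" for B
  proof -
    have v: "?v B permutes {1..n}" by (rule cobpd_perm_permutes[OF assms(1) S(1)[OF B]])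
    have pow: "(-1) ^ nat \<bar>int (coxeter_length n (?v B)) - int (coxeter_length n w)\<bar> = (of_int (sign (?v B) * sign w) :: mpoly)"
      unfolding sign_length_difference[OF v assms(2), symmetric] by simp
    \<comment> \<open>The sign of \<open>?v B\<close> from the length and the one inside its
      Schubert polynomial cancel.\<close>
    have "sign (?v B) * sign w * (normalization n * sign (?v B)) = normalization n * sign w"
      using sign_idempotent[of "?v B"] by (metis mult.assoc mult.commute mult.left_commute mult_1)
    then have "(of_int (sign (?v B) * sign w) * of_int (normalization n * sign (?v B)) :: mpoly) = of_int (normalization n * sign w)"
      by (simp only: of_int_mult[symmetric])
    then show ?thesis
      unfolding schubert_eq[OF v] signed_weight_def pow mult.assoc[symmetric] by (simp only:)
  qed
  show ?thesis
    unfolding grothendieck_eq[OF assms(2)] signed_weight_def W sum_distrib_left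
    by (rule sum.cong[OF refl summand])
qed

end
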